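(* Over $\mathsf{ACA}_0^\omega+\mathsf{IND}_0$, each of the following is equivalent to $\mathsf{NIN}$ (there is no injection from $[0,1]$ to $\mathbb{N}$): (1) $\mathsf{NIN}_{\mathsf{bv}}$: there is no injection from $[0,1]$ to $\mathbb{Q}$ that has bounded variation; (2) $\mathsf{NIN}_{\mathsf{Y}}$: there is no injection from $[0,1]$ to $\mathbb{Q}$ that has property $\mathsf{Y}$; (3) $\mathsf{NIN}_{\mathsf{Riemann}}$: there is no injection from $[0,1]$ to $\mathbb{Q}$ that is Riemann integrable; (4) $\mathsf{NIN}_{\mathsf{Borel}}$: there is no Borel function that is an injection from $[0,1]$ to $\mathbb{Q}$; (5) $\mathsf{NIN}_{\mathsf{cliq}}$: there is no injection from $[0,1]$ to $\mathbb{Q}$ that is cliquish; (6) $\mathsf{NIN}_{\mathsf{semi}}$: there is no upper semi-continuous injection from $[0,1]$ to $\mathbb{Q}$; (7) $\mathsf{NIN}_{\mathsf{semi}}'$: there is no lower semi-continuous injection from $[0,1]$ to $\mathbb{Q}$. Moreover, only the implications involving items (4)–(7) require $\mathsf{IND}_0$ (the remaining equivalences hold over $\mathsf{ACA}_0^\omega$).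
   Context: Work in higher-order arithmetic: $\mathsf{RCA}_0^\omega$ is Kohlenbach's base theory, $\mathsf{ACA}_0^\omega$ is $\mathsf{RCA}_0^\omega$ plus $(\exists^2)$: there is $\varphi^2\le_2 1$ with $(\exists n)(f(n)=0)\leftrightarrow\varphi(f)=0$ for all $f\in\mathbb{N}^{\mathbb{N}}$. Reals are fast-converging Cauchy sequences; functions on reals respect real equality; sets of reals are characteristic functions. $\mathsf{IND}_0$: for every $Y^2$ such that for each $n\in\mathbb{N}$ there is at most one $f\in2^{\mathbb{N}}$ with $Y(f,n)=0$, and every $k\in\mathbb{N}$, there is a finite sequence $w$ (of elements of $\mathbb{N}^{\mathbb{N}}$) such that for all $m\le k$: $(\exists i<|w|)(w(i)\in2^{\mathbb{N}}\wedge Y(w(i),m)=0)\leftrightarrow(\exists f\in2^{\mathbb{N}})(Y(f,m)=0)$. $f:[0,1]\to\mathbb{R}$ has bounded variation if there is $k_0\in\mathbb{N}$ with $k_0\ge\sum_{i}|f(x_i)-f(x_{i+1})|$ for every partition $0=x_0<x_1<\dots<x_n=1$. $\mathsf{Y}$ is an arbitrary property of functions $\mathbb{R}\to\mathbb{R}$ such that ($\mathsf{RCA}_0^\omega$ proves that) every function of bounded variation on $[0,1]$ has property $\mathsf{Y}$. $f$ is upper (resp. lower) semi-continuous if for all $x_0$, $f(x_0)\ge\limsup_{x\to x_0}f(x)$ (resp. $f(x_0)\le\liminf_{x\to x_0}f(x)$). $f$ is cliquish at $x$ if for every $\epsilon>0$ and every open neighbourhood $U$ of $x$ there is a non-empty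 open ball $G\subset U$ with $|f(z)-f(y)|<\epsilon$ for all $y,z\in G$; cliquish means cliquish at every point. Borel sets are defined as usual (countable unions via $(\exists^2)$), and $f:[0,1]\to\mathbb{R}$ is Borel if $\{x\in[0,1]:f(x)>a\}$ is a Borel set for every $a\in\mathbb{R}$. An injection from $[0,1]$ to $\mathbb{Q}$ is a function $[0,1]\to\mathbb{R}$ with rational values that is injective. *)

theory Defs
  imports Main
begin

section \<open>Many-sorted classical logic over the finite types\<close>

datatype ty = T0 | Fun ty ty (infixr \<open>\<rightarrow>\<close> 65)

abbreviation T1 :: ty where "T1 \<equiv> T0 \<rightarrow> T0"
abbreviation T2 :: ty where "T2 \<equiv> T1 \<rightarrow> T0"
abbreviation T3 :: ty where "T3 \<equiv> T2 \<rightarrow> T0"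

text \<open>
  Variables are de Bruijn indices counted separately for every type: \<open>Var \<tau> i\<close> refers to the
  \<open>i\<close>-th enclosing binder of type \<open>\<tau>\<close>, and binders of other types do not shift it.
  \<open>Proj\<close> and \<open>Comb\<close> are the combinators \<open>\<Pi>\<close> and \<open>\<Sigma>\<close>, \<open>Rec\<close> is the recursor
  \<open>R\<^sub>0\<close> (recursion with values of type 0 only).
\<close>

datatype tm =
    Var ty nat
  | Zero
  | Succ
  | Proj ty ty
  | Comb ty ty ty
  | Rec
  | App tm tm (infixl \<open>\<cdot>\<close> 100)

primrec cod :: "ty \<Rightarrow> ty" where
  "cod T0 = T0"
| "cod (\<rho> \<rightarrow> \<tau>) = \<tau>"

primrec tyof :: "tm \<Rightarrow> ty" where
  "tyof (Var \<tau> i) = \<tau>"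
| "tyof Zero = T0"
| "tyof Succ = T0 \<rightarrow> T0"
| "tyof (Proj \<rho> \<tau>) = \<rho> \<rightarrow> \<tau> \<rightarrow> \<rho>"
| "tyof (Comb \<delta> \<rho> \<tau>) = (\<delta> \<rightarrow> \<rho> \<rightarrow> \<tau>) \<rightarrow> (\<delta> \<rightarrow> \<rho>) \<rightarrow> \<delta> \<rightarrow> \<tau>"
| "tyof Rec = T0 \<rightarrow> T0 \<rightarrow> (T0 \<rightarrow> T0 \<rightarrow> T0) \<rightarrow> T0"
| "tyof (s \<cdot> t) = cod (tyof s)"

primrec wt :: "tm \<Rightarrow> bool" where
  "wt (Var \<tau> i) = True"
| "wt Zero = True"
| "wt Succ = True"
| "wt (Proj \<rho> \<tau>) = True"
| "wt (Comb \<delta> \<rho> \<tau>) = True"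
| "wt Rec = True"
| "wt (s \<cdot> t) = (wt s \<and> wt t \<and> tyof s = (tyof t \<rightarrow> cod (tyof s)))"

text \<open>Prime formulas are equations between terms of type 0.\<close>

datatype fm =
    Eq tm tm
  | Falsum
  | Imp fm fm (infixr \<open>\<^bold>\<longrightarrow>\<close> 25)
  | All ty fm (\<open>\<^bold>\<forall>\<^bsub>_\<^esub> _\<close> [0, 10] 10)

primrec wff :: "fm \<Rightarrow> bool" where
  "wff (Eq s t) = (wt s \<and> wt t \<and> tyof s = T0 \<and> tyof t = T0)"
| "wff Falsum = True"
| "wff (\<phi> \<^bold>\<longrightarrow> \<psi>) = (wff \<phi> \<and> wff \<psi>)"
| "wff (\<^bold>\<forall>\<^bsub>\<tau>\<^esub> \<phi>) = wff \<phi>"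

primrec qfree :: "fm \<Rightarrow> bool" where
  "qfree (Eq s t) = True"
| "qfree Falsum = True"
| "qfree (\<phi> \<^bold>\<longrightarrow> \<psi>) = (qfree \<phi> \<and> qfree \<psi>)"
| "qfree (\<^bold>\<forall>\<^bsub>\<tau>\<^esub> \<phi>) = False"

definition Neg :: "fm \<Rightarrow> fm" (\<open>\<^bold>\<not> _\<close> [40] 40) where
  "(\<^bold>\<not> \<phi>) = (\<phi> \<^bold>\<longrightarrow> Falsum)"

definition Conj :: "fm \<Rightarrow> fm \<Rightarrow> fm" (infixr \<open>\<^bold>\<and>\<close> 35) where
  "(\<phi> \<^bold>\<and> \<psi>) = (\<^bold>\<not> (\<phi> \<^bold>\<longrightarrow> \<^bold>\<not> \<psi>))"

definition Iff :: "fm \<Rightarrow> fm \<Rightarrow> fm" (infixr \<open>\<^bold>\<longleftrightarrow>\<close> 25) where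
  "(\<phi> \<^bold>\<longleftrightarrow> \<psi>) = ((\<phi> \<^bold>\<longrightarrow> \<psi>) \<^bold>\<and> (\<psi> \<^bold>\<longrightarrow> \<phi>))"

definition Ex :: "ty \<Rightarrow> fm \<Rightarrow> fm" (\<open>\<^bold>\<exists>\<^bsub>_\<^esub> _\<close> [0, 10] 10) where
  "(\<^bold>\<exists>\<^bsub>\<tau>\<^esub> \<phi>) = (\<^bold>\<not> (\<^bold>\<forall>\<^bsub>\<tau>\<^esub> \<^bold>\<not> \<phi>))"

text \<open>
  \<open>lift \<sigma> k\<close> renames the free variables \<open>Var \<sigma> i\<close>, \<open>i \<ge> k\<close>, to \<open>Var \<sigma> (Suc i)\<close>;
  \<open>subst \<sigma> k s\<close> replaces \<open>Var \<sigma> k\<close> by \<open>s\<close> and removes that index.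
\<close>

primrec lift :: "ty \<Rightarrow> nat \<Rightarrow> tm \<Rightarrow> tm" where
  "lift \<sigma> k (Var \<tau> i) = Var \<tau> (if \<tau> = \<sigma> \<and> k \<le> i then Suc i else i)"
| "lift \<sigma> k Zero = Zero"
| "lift \<sigma> k Succ = Succ"
| "lift \<sigma> k (Proj \<rho> \<tau>) = Proj \<rho> \<tau>"
| "lift \<sigma> k (Comb \<delta> \<rho> \<tau>) = Comb \<delta> \<rho> \<tau>"
| "lift \<sigma> k Rec = Rec"
| "lift \<sigma> k (s \<cdot> t) = lift \<sigma> k s \<cdot> lift \<sigma> k t"

primrec subst :: "ty \<Rightarrow> nat \<Rightarrow> tm \<Rightarrow> tm \<Rightarrow> tm" where
  "subst \<sigma> k s (Var \<tau> i) =
     (if \<tau> \<noteq> \<sigma> \<or> i < k then Var \<tau> i else if i = k then s else Var \<tau> (i - 1))"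
| "subst \<sigma> k s Zero = Zero"
| "subst \<sigma> k s Succ = Succ"
| "subst \<sigma> k s (Proj \<rho> \<tau>) = Proj \<rho> \<tau>"
| "subst \<sigma> k s (Comb \<delta> \<rho> \<tau>) = Comb \<delta> \<rho> \<tau>"
| "subst \<sigma> k s Rec = Rec"
| "subst \<sigma> k s (t \<cdot> u) = subst \<sigma> k s t \<cdot> subst \<sigma> k s u"

primrec liftf :: "ty \<Rightarrow> nat \<Rightarrow> fm \<Rightarrow> fm" where
  "liftf \<sigma> k (Eq s t) = Eq (lift \<sigma> k s) (lift \<sigma> k t)"
| "liftf \<sigma> k Falsum = Falsum"
| "liftf \<sigma> k (\<phi> \<^bold>\<longrightarrow> \<psi>) = (liftf \<sigma> k \<phi> \<^bold>\<longrightarrow> liftf \<sigma> k \<psi>)"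
| "liftf \<sigma> k (\<^bold>\<forall>\<^bsub>\<tau>\<^esub> \<phi>) = (\<^bold>\<forall>\<^bsub>\<tau>\<^esub> liftf \<sigma> (if \<tau> = \<sigma> then Suc k else k) \<phi>)"

primrec substf :: "ty \<Rightarrow> nat \<Rightarrow> tm \<Rightarrow> fm \<Rightarrow> fm" where
  "substf \<sigma> k s (Eq t u) = Eq (subst \<sigma> k s t) (subst \<sigma> k s u)"
| "substf \<sigma> k s Falsum = Falsum"
| "substf \<sigma> k s (\<phi> \<^bold>\<longrightarrow> \<psi>) = (substf \<sigma> k s \<phi> \<^bold>\<longrightarrow> substf \<sigma> k s \<psi>)"
| "substf \<sigma> k s (\<^bold>\<forall>\<^bsub>\<tau>\<^esub> \<phi>) =
     (\<^bold>\<forall>\<^bsub>\<tau>\<^esub> substf \<sigma> (if \<tau> = \<sigma> then Suc k else k) (lift \<tau> 0 s) \<phi>)"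

text \<open>
  Classical natural deduction. Free variables in the axioms \<open>T\<close> are read as universally
  quantified: \<open>T\<close> is not lifted in the rule \<open>AllI\<close>, whereas the local assumptions are.
\<close>

inductive deriv :: "fm set \<Rightarrow> fm list \<Rightarrow> fm \<Rightarrow> bool" for T where
  Ax: "\<phi> \<in> T \<Longrightarrow> deriv T \<Gamma> \<phi>"
| Hyp: "\<phi> \<in> set \<Gamma> \<Longrightarrow> deriv T \<Gamma> \<phi>"
| ImpI: "wff \<phi> \<Longrightarrow> deriv T (\<phi> # \<Gamma>) \<psi> \<Longrightarrow> deriv T \<Gamma> (\<phi> \<^bold>\<longrightarrow> \<psi>)"
| ImpE: "deriv T \<Gamma> (\<phi> \<^bold>\<longrightarrow> \<psi>) \<Longrightarrow> deriv T \<Gamma> \<phi> \<Longrightarrow> deriv T \<Gamma> \<psi>"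
| RAA: "wff \<phi> \<Longrightarrow> deriv T ((\<phi> \<^bold>\<longrightarrow> Falsum) # \<Gamma>) Falsum \<Longrightarrow> deriv T \<Gamma> \<phi>"
| AllI: "deriv T (map (liftf \<tau> 0) \<Gamma>) \<phi> \<Longrightarrow> deriv T \<Gamma> (\<^bold>\<forall>\<^bsub>\<tau>\<^esub> \<phi>)"
| AllE: "deriv T \<Gamma> (\<^bold>\<forall>\<^bsub>\<tau>\<^esub> \<phi>) \<Longrightarrow> wt t \<Longrightarrow> tyof t = \<tau> \<Longrightarrow> deriv T \<Gamma> (substf \<tau> 0 t \<phi>)"

definition proves :: "fm set \<Rightarrow> fm \<Rightarrow> bool" (infix \<open>\<turnstile>\<close> 5) where
  "(T \<turnstile> \<phi>) \<longleftrightarrow> deriv T [] \<phi>"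


section \<open>The systems RCA and ACA of higher-order arithmetic\<close>

text \<open>Equality at higher types is defined extensionally.\<close>

primrec eqt :: "ty \<Rightarrow> tm \<Rightarrow> tm \<Rightarrow> fm" where
  "eqt T0 s t = Eq s t"
| "eqt (\<rho> \<rightarrow> \<tau>) s t =
     (\<^bold>\<forall>\<^bsub>\<rho>\<^esub> eqt \<tau> (lift \<rho> 0 s \<cdot> Var \<rho> 0) (lift \<rho> 0 t \<cdot> Var \<rho> 0))"

text \<open>
  \<open>RCA0\<omega>\<close> is E-PRA\<open>\<^sup>\<omega>\<close> together with QF-AC\<open>\<^sup>1\<^sup>,\<^sup>0\<close>. In \<open>QF_IND\<close> the induction variable is
  \<open>Var T0 0\<close>; in \<open>QF_AC\<close> the formula \<open>\<phi>\<close> has the function argument as \<open>Var T1 0\<close> and the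
  number as \<open>Var T0 0\<close>. All other free variables of \<open>\<phi>\<close> are parameters.
\<close>

inductive_set RCA0\<omega> :: "fm set" where
  Eq_refl: "Eq (Var T0 0) (Var T0 0) \<in> RCA0\<omega>"
| Eq_sym: "(Eq (Var T0 0) (Var T0 1) \<^bold>\<longrightarrow> Eq (Var T0 1) (Var T0 0)) \<in> RCA0\<omega>"
| Eq_trans: "(Eq (Var T0 0) (Var T0 1) \<^bold>\<longrightarrow> Eq (Var T0 1) (Var T0 2) \<^bold>\<longrightarrow>
     Eq (Var T0 0) (Var T0 2)) \<in> RCA0\<omega>"
| Ext: "(eqt \<rho> (Var \<rho> 1) (Var \<rho> 2) \<^bold>\<longrightarrow>
     eqt \<tau> (Var (\<rho> \<rightarrow> \<tau>) 0 \<cdot> Var \<rho> 1) (Var (\<rho> \<rightarrow> \<tau>) 0 \<cdot> Var \<rho> 2)) \<in> RCA0\<omega>"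
| Succ_nonzero: "(\<^bold>\<not> Eq (Succ \<cdot> Var T0 0) Zero) \<in> RCA0\<omega>"
| Succ_inj: "(Eq (Succ \<cdot> Var T0 0) (Succ \<cdot> Var T0 1) \<^bold>\<longrightarrow> Eq (Var T0 0) (Var T0 1)) \<in> RCA0\<omega>"
| Proj: "eqt \<rho> (Proj \<rho> \<tau> \<cdot> Var \<rho> 0 \<cdot> Var \<tau> 1) (Var \<rho> 0) \<in> RCA0\<omega>"
| Comb: "eqt \<tau>
     (Comb \<delta> \<rho> \<tau> \<cdot> Var (\<delta> \<rightarrow> \<rho> \<rightarrow> \<tau>) 0 \<cdot> Var (\<delta> \<rightarrow> \<rho>) 1 \<cdot> Var \<delta> 2)
     (Var (\<delta> \<rightarrow> \<rho> \<rightarrow> \<tau>) 0 \<cdot> Var \<delta> 2 \<cdot> (Var (\<delta> \<rightarrow> \<rho>) 1 \<cdot> Var \<delta> 2)) \<in> RCA0\<omega>"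
| Rec_0: "Eq (Rec \<cdot> Zero \<cdot> Var T0 0 \<cdot> Var (T0 \<rightarrow> T0 \<rightarrow> T0) 0) (Var T0 0) \<in> RCA0\<omega>"
| Rec_Succ: "Eq (Rec \<cdot> (Succ \<cdot> Var T0 1) \<cdot> Var T0 0 \<cdot> Var (T0 \<rightarrow> T0 \<rightarrow> T0) 0)
     (Var (T0 \<rightarrow> T0 \<rightarrow> T0) 0 \<cdot> (Rec \<cdot> Var T0 1 \<cdot> Var T0 0 \<cdot> Var (T0 \<rightarrow> T0 \<rightarrow> T0) 0) \<cdot> Var T0 1)
     \<in> RCA0\<omega>"
| QF_IND: "wff \<phi> \<Longrightarrow> qfree \<phi> \<Longrightarrow>
     (substf T0 0 Zero \<phi> \<^bold>\<longrightarrow>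
      (\<^bold>\<forall>\<^bsub>T0\<^esub> \<phi> \<^bold>\<longrightarrow> substf T0 0 (Succ \<cdot> Var T0 0) (liftf T0 1 \<phi>)) \<^bold>\<longrightarrow>
      (\<^bold>\<forall>\<^bsub>T0\<^esub> \<phi>)) \<in> RCA0\<omega>"
| QF_AC: "wff \<phi> \<Longrightarrow> qfree \<phi> \<Longrightarrow>
     ((\<^bold>\<forall>\<^bsub>T1\<^esub> \<^bold>\<exists>\<^bsub>T0\<^esub> \<phi>) \<^bold>\<longrightarrow>
      (\<^bold>\<exists>\<^bsub>T2\<^esub> \<^bold>\<forall>\<^bsub>T1\<^esub> substf T0 0 (Var T2 0 \<cdot> Var T1 0) (liftf T2 0 \<phi>))) \<in> RCA0\<omega>"

text \<open>
  Abstraction of \<open>Var \<sigma> 0\<close>; the result satisfies \<open>(\<^bold>\<lambda>\<^bsub>\<sigma>\<^esub> t) \<cdot> s = subst \<sigma> 0 s t\<close>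
  provably in \<open>RCA0\<omega>\<close>.
\<close>

primrec lam :: "ty \<Rightarrow> tm \<Rightarrow> tm" (\<open>\<^bold>\<lambda>\<^bsub>_\<^esub> _\<close> [0, 10] 10) where
  "lam \<sigma> (Var \<tau> i) =
     (if \<tau> \<noteq> \<sigma> then Proj \<tau> \<sigma> \<cdot> Var \<tau> i
      else if i = 0 then Comb \<sigma> (\<sigma> \<rightarrow> \<sigma>) \<sigma> \<cdot> Proj \<sigma> (\<sigma> \<rightarrow> \<sigma>) \<cdot> Proj \<sigma> \<sigma>
      else Proj \<sigma> \<sigma> \<cdot> Var \<sigma> (i - 1))"
| "lam \<sigma> Zero = Proj T0 \<sigma> \<cdot> Zero"
| "lam \<sigma> Succ = Proj (tyof Succ) \<sigma> \<cdot> Succ"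
| "lam \<sigma> (Proj \<rho> \<tau>) = Proj (tyof (Proj \<rho> \<tau>)) \<sigma> \<cdot> Proj \<rho> \<tau>"
| "lam \<sigma> (Comb \<delta> \<rho> \<tau>) = Proj (tyof (Comb \<delta> \<rho> \<tau>)) \<sigma> \<cdot> Comb \<delta> \<rho> \<tau>"
| "lam \<sigma> Rec = Proj (tyof Rec) \<sigma> \<cdot> Rec"
| "lam \<sigma> (s \<cdot> t) = Comb \<sigma> (tyof t) (cod (tyof s)) \<cdot> lam \<sigma> s \<cdot> lam \<sigma> t"

abbreviation v0 :: "nat \<Rightarrow> tm" where "v0 \<equiv> Var T0"
abbreviation v1 :: "nat \<Rightarrow> tm" where "v1 \<equiv> Var T1"

abbreviation suc :: "tm \<Rightarrow> tm" where "suc t \<equiv> Succ \<cdot> t"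
abbreviation one :: tm where "one \<equiv> suc Zero"


subsection \<open>Natural numbers\<close>

definition add :: tm where
  "add = (\<^bold>\<lambda>\<^bsub>T0\<^esub> \<^bold>\<lambda>\<^bsub>T0\<^esub> Rec \<cdot> v0 0 \<cdot> v0 1 \<cdot> (\<^bold>\<lambda>\<^bsub>T0\<^esub> \<^bold>\<lambda>\<^bsub>T0\<^esub> suc (v0 1)))"
abbreviation add' (infixl \<open>+\<^sub>N\<close> 65) where "s +\<^sub>N t \<equiv> add \<cdot> s \<cdot> t"

definition pred :: tm where
  "pred = (\<^bold>\<lambda>\<^bsub>T0\<^esub> Rec \<cdot> v0 0 \<cdot> Zero \<cdot> (\<^bold>\<lambda>\<^bsub>T0\<^esub> \<^bold>\<lambda>\<^bsub>T0\<^esub> v0 0))"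

text \<open>Truncated subtraction.\<close>
definition monus :: tm where
  "monus = (\<^bold>\<lambda>\<^bsub>T0\<^esub> \<^bold>\<lambda>\<^bsub>T0\<^esub> Rec \<cdot> v0 0 \<cdot> v0 1 \<cdot> (\<^bold>\<lambda>\<^bsub>T0\<^esub> \<^bold>\<lambda>\<^bsub>T0\<^esub> pred \<cdot> v0 1))"
abbreviation monus' (infixl \<open>-\<^sub>N\<close> 65) where "s -\<^sub>N t \<equiv> monus \<cdot> s \<cdot> t"

definition mult :: tm where
  "mult = (\<^bold>\<lambda>\<^bsub>T0\<^esub> \<^bold>\<lambda>\<^bsub>T0\<^esub> Rec \<cdot> v0 0 \<cdot> Zero \<cdot> (\<^bold>\<lambda>\<^bsub>T0\<^esub> \<^bold>\<lambda>\<^bsub>T0\<^esub> v0 1 +\<^sub>N v0 3))"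
abbreviation mult' (infixl \<open>*\<^sub>N\<close> 70) where "s *\<^sub>N t \<equiv> mult \<cdot> s \<cdot> t"

definition pow2 :: tm where
  "pow2 = (\<^bold>\<lambda>\<^bsub>T0\<^esub> Rec \<cdot> v0 0 \<cdot> one \<cdot> (\<^bold>\<lambda>\<^bsub>T0\<^esub> \<^bold>\<lambda>\<^bsub>T0\<^esub> v0 1 +\<^sub>N v0 1))"

definition le :: "tm \<Rightarrow> tm \<Rightarrow> fm" (infix \<open>\<le>\<^sub>N\<close> 50) where "(s \<le>\<^sub>N t) = Eq (s -\<^sub>N t) Zero"
definition lt :: "tm \<Rightarrow> tm \<Rightarrow> fm" (infix \<open><\<^sub>N\<close> 50) where "(s <\<^sub>N t) = (suc s \<le>\<^sub>N t)"

text \<open>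
  \<open>isqrt\<close> is the integer square root: its successor step increments the value \<open>u\<close> at \<open>n\<close> iff
  \<open>(u + 1)\<^sup>2 \<le> n + 1\<close>. The pair \<open>(a, b)\<close> is coded by \<open>(a + b)\<^sup>2 + a\<close>, whose root is \<open>a + b\<close>.
\<close>

definition isqrt :: tm where
  "isqrt = (\<^bold>\<lambda>\<^bsub>T0\<^esub> Rec \<cdot> v0 0 \<cdot> Zero \<cdot> (\<^bold>\<lambda>\<^bsub>T0\<^esub> \<^bold>\<lambda>\<^bsub>T0\<^esub>
     Rec \<cdot> (suc (v0 1) *\<^sub>N suc (v0 1) -\<^sub>N suc (v0 0)) \<cdot> suc (v0 1) \<cdot> (\<^bold>\<lambda>\<^bsub>T0\<^esub> \<^bold>\<lambda>\<^bsub>T0\<^esub> v0 3)))"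

definition pair :: tm where
  "pair = (\<^bold>\<lambda>\<^bsub>T0\<^esub> \<^bold>\<lambda>\<^bsub>T0\<^esub> (v0 1 +\<^sub>N v0 0) *\<^sub>N (v0 1 +\<^sub>N v0 0) +\<^sub>N v0 1)"
definition left :: tm where
  "left = (\<^bold>\<lambda>\<^bsub>T0\<^esub> v0 0 -\<^sub>N isqrt \<cdot> v0 0 *\<^sub>N (isqrt \<cdot> v0 0))"
definition right :: tm where
  "right = (\<^bold>\<lambda>\<^bsub>T0\<^esub> isqrt \<cdot> v0 0 -\<^sub>N left \<cdot> v0 0)"


subsection \<open>Rational numbers\<close>

text \<open>
  Every number \<open>q\<close> codes the rational \<open>(pos q - neg q) / den q\<close>; a rational has many codes.
  \<open>rat a b c\<close> is a code of \<open>(a - b) / c\<close> for \<open>c > 0\<close>.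
\<close>

abbreviation pos :: "tm \<Rightarrow> tm" where "pos q \<equiv> left \<cdot> (left \<cdot> q)"
abbreviation neg :: "tm \<Rightarrow> tm" where "neg q \<equiv> right \<cdot> (left \<cdot> q)"
abbreviation den :: "tm \<Rightarrow> tm" where "den q \<equiv> suc (right \<cdot> q)"
abbreviation rat :: "tm \<Rightarrow> tm \<Rightarrow> tm \<Rightarrow> tm" where
  "rat a b c \<equiv> pair \<cdot> (pair \<cdot> a \<cdot> b) \<cdot> (pred \<cdot> c)"

definition qadd :: tm where
  "qadd = (\<^bold>\<lambda>\<^bsub>T0\<^esub> \<^bold>\<lambda>\<^bsub>T0\<^esub> rat
     (pos (v0 1) *\<^sub>N den (v0 0) +\<^sub>N pos (v0 0) *\<^sub>N den (v0 1))
     (neg (v0 1) *\<^sub>N den (v0 0) +\<^sub>N neg (v0 0) *\<^sub>N den (v0 1))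
     (den (v0 1) *\<^sub>N den (v0 0)))"
abbreviation qadd' (infixl \<open>+\<^sub>Q\<close> 65) where "p +\<^sub>Q q \<equiv> qadd \<cdot> p \<cdot> q"

definition qsub :: tm where
  "qsub = (\<^bold>\<lambda>\<^bsub>T0\<^esub> \<^bold>\<lambda>\<^bsub>T0\<^esub> v0 1 +\<^sub>Q rat (neg (v0 0)) (pos (v0 0)) (den (v0 0)))"
abbreviation qsub' (infixl \<open>-\<^sub>Q\<close> 65) where "p -\<^sub>Q q \<equiv> qsub \<cdot> p \<cdot> q"

definition qmul :: tm where
  "qmul = (\<^bold>\<lambda>\<^bsub>T0\<^esub> \<^bold>\<lambda>\<^bsub>T0\<^esub> rat
     (pos (v0 1) *\<^sub>N pos (v0 0) +\<^sub>N neg (v0 1) *\<^sub>N neg (v0 0))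
     (pos (v0 1) *\<^sub>N neg (v0 0) +\<^sub>N neg (v0 1) *\<^sub>N pos (v0 0))
     (den (v0 1) *\<^sub>N den (v0 0)))"

definition qabs :: tm where
  "qabs = (\<^bold>\<lambda>\<^bsub>T0\<^esub> rat
     ((pos (v0 0) -\<^sub>N neg (v0 0)) +\<^sub>N (neg (v0 0) -\<^sub>N pos (v0 0))) Zero (den (v0 0)))"

definition qle :: "tm \<Rightarrow> tm \<Rightarrow> fm" (infix \<open>\<le>\<^sub>Q\<close> 50) where "(p \<le>\<^sub>Q q) =
     (pos p *\<^sub>N den q +\<^sub>N neg q *\<^sub>N den p \<le>\<^sub>N pos q *\<^sub>N den p +\<^sub>N neg p *\<^sub>N den q)"
definition qlt :: "tm \<Rightarrow> tm \<Rightarrow> fm" (infix \<open><\<^sub>Q\<close> 50) where "(p <\<^sub>Q q) = (\<^bold>\<not> q \<le>\<^sub>Q p)"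

definition qnat :: tm where "qnat = (\<^bold>\<lambda>\<^bsub>T0\<^esub> rat (v0 0) Zero one)"

text \<open>\<open>qeps \<cdot> n\<close> is \<open>2\<^sup>-\<^sup>n\<close>.\<close>
definition qeps :: tm where "qeps = (\<^bold>\<lambda>\<^bsub>T0\<^esub> rat one Zero (pow2 \<cdot> v0 0))"


subsection \<open>Real numbers\<close>

text \<open>A real is a sequence of (codes of) rationals with \<open>\<bar>x\<^sub>n - x\<^sub>n\<^sub>+\<^sub>m\<bar> < 2\<^sup>-\<^sup>n\<close>.\<close>

abbreviation up :: "tm \<Rightarrow> tm" (\<open>_\<up>\<close> [1000] 1000) where "t\<up> \<equiv> lift T0 0 t"

definition is_real :: "tm \<Rightarrow> fm" where
  "is_real x = (\<^bold>\<forall>\<^bsub>T0\<^esub> \<^bold>\<forall>\<^bsub>T0\<^esub>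
     qabs \<cdot> (x\<up>\<up> \<cdot> v0 1 -\<^sub>Q x\<up>\<up> \<cdot> (v0 1 +\<^sub>N v0 0)) <\<^sub>Q qeps \<cdot> v0 1)"

definition req :: "tm \<Rightarrow> tm \<Rightarrow> fm" (infix \<open>=\<^sub>R\<close> 50) where
  "(x =\<^sub>R y) = (\<^bold>\<forall>\<^bsub>T0\<^esub>
     qabs \<cdot> (x\<up> \<cdot> v0 0 -\<^sub>Q y\<up> \<cdot> v0 0) \<le>\<^sub>Q qeps \<cdot> v0 0 +\<^sub>Q qeps \<cdot> v0 0)"

definition rle :: "tm \<Rightarrow> tm \<Rightarrow> fm" (infix \<open>\<le>\<^sub>R\<close> 50) where "(x \<le>\<^sub>R y) = (\<^bold>\<forall>\<^bsub>T0\<^esub>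
     x\<up> \<cdot> v0 0 \<le>\<^sub>Q y\<up> \<cdot> v0 0 +\<^sub>Q (qeps \<cdot> v0 0 +\<^sub>Q qeps \<cdot> v0 0))"

definition rlt :: "tm \<Rightarrow> tm \<Rightarrow> fm" (infix \<open><\<^sub>R\<close> 50) where "(x <\<^sub>R y) = (\<^bold>\<not> y \<le>\<^sub>R x)"

definition radd :: tm where
  "radd = (\<^bold>\<lambda>\<^bsub>T1\<^esub> \<^bold>\<lambda>\<^bsub>T1\<^esub> \<^bold>\<lambda>\<^bsub>T0\<^esub> v1 1 \<cdot> suc (v0 0) +\<^sub>Q v1 0 \<cdot> suc (v0 0))"
abbreviation radd' (infixl \<open>+\<^sub>R\<close> 65) where "x +\<^sub>R y \<equiv> radd \<cdot> x \<cdot> y"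

definition rsub :: tm where
  "rsub = (\<^bold>\<lambda>\<^bsub>T1\<^esub> \<^bold>\<lambda>\<^bsub>T1\<^esub> \<^bold>\<lambda>\<^bsub>T0\<^esub> v1 1 \<cdot> suc (v0 0) -\<^sub>Q v1 0 \<cdot> suc (v0 0))"
abbreviation rsub' (infixl \<open>-\<^sub>R\<close> 65) where "x -\<^sub>R y \<equiv> rsub \<cdot> x \<cdot> y"

definition rabs :: tm where "rabs = (\<^bold>\<lambda>\<^bsub>T1\<^esub> \<^bold>\<lambda>\<^bsub>T0\<^esub> qabs \<cdot> (v1 0 \<cdot> v0 0))"

text \<open>
  \<open>(x * y)\<^sub>n = x\<^sub>n\<^sub>+\<^sub>k * y\<^sub>n\<^sub>+\<^sub>k\<close> where \<open>k\<close> is a natural number with \<open>k \<ge> \<bar>x\<^sub>0\<bar> + \<bar>y\<^sub>0\<bar> + 2\<close>, hence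
  \<open>\<bar>x\<^sub>i\<bar> + \<bar>y\<^sub>j\<bar> \<le> 2\<^sup>k\<close> for all \<open>i\<close>, \<open>j\<close>.
\<close>
definition rmul :: tm where
  "rmul = (\<^bold>\<lambda>\<^bsub>T1\<^esub> \<^bold>\<lambda>\<^bsub>T1\<^esub> \<^bold>\<lambda>\<^bsub>T0\<^esub>
     (let k = pos (qabs \<cdot> (v1 1 \<cdot> Zero)) +\<^sub>N pos (qabs \<cdot> (v1 0 \<cdot> Zero)) +\<^sub>N suc one
      in qmul \<cdot> (v1 1 \<cdot> (v0 0 +\<^sub>N k)) \<cdot> (v1 0 \<cdot> (v0 0 +\<^sub>N k))))"
abbreviation rmul' (infixl \<open>*\<^sub>R\<close> 70) where "x *\<^sub>R y \<equiv> rmul \<cdot> x \<cdot> y"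

text \<open>
  \<open>rsum \<cdot> g \<cdot> n\<close> is \<open>g\<^sub>0 + \<dots> + g\<^sub>n\<^sub>-\<^sub>1\<close>; its \<open>k\<close>-th approximation sums the approximations of
  index \<open>k + n\<close>, as \<open>n * 2\<^sup>-\<^sup>(\<^sup>k\<^sup>+\<^sup>n\<^sup>) < 2\<^sup>-\<^sup>k\<close>.
\<close>
definition rsum :: tm where
  "rsum = (\<^bold>\<lambda>\<^bsub>T0 \<rightarrow> T1\<^esub> \<^bold>\<lambda>\<^bsub>T0\<^esub> \<^bold>\<lambda>\<^bsub>T0\<^esub> Rec \<cdot> v0 1 \<cdot> (qnat \<cdot> Zero) \<cdot>
     (\<^bold>\<lambda>\<^bsub>T0\<^esub> \<^bold>\<lambda>\<^bsub>T0\<^esub> v0 1 +\<^sub>Q Var (T0 \<rightarrow> T1) 0 \<cdot> v0 0 \<cdot> (v0 2 +\<^sub>N v0 3)))"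

text \<open>The real given by a code of a rational, and by a natural number.\<close>
abbreviation of_rat :: "tm \<Rightarrow> tm" where "of_rat q \<equiv> Proj T0 T0 \<cdot> q"
abbreviation of_nat0 :: "tm \<Rightarrow> tm" where "of_nat0 n \<equiv> of_rat (qnat \<cdot> n)"
abbreviation r0 :: tm where "r0 \<equiv> of_nat0 Zero"
abbreviation r1 :: tm where "r1 \<equiv> of_nat0 one"

definition in01 :: "tm \<Rightarrow> fm" where
  "in01 x = (is_real x \<^bold>\<and> r0 \<le>\<^sub>R x \<^bold>\<and> x \<le>\<^sub>R r1)"

abbreviation rdist :: "tm \<Rightarrow> tm \<Rightarrow> tm" where "rdist x y \<equiv> rabs \<cdot> (x -\<^sub>R y)"

definition pos_real :: "tm \<Rightarrow> fm" where
  "pos_real x = (is_real x \<^bold>\<and> r0 <\<^sub>R x)"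


subsection \<open>The axioms \<open>(\<exists>\<^sup>2)\<close> and \<open>IND\<^sub>0\<close>\<close>

definition exists2 :: fm where
  "exists2 = (\<^bold>\<exists>\<^bsub>T2\<^esub> \<^bold>\<forall>\<^bsub>T1\<^esub>
     Var T2 0 \<cdot> v1 0 \<le>\<^sub>N one \<^bold>\<and>
     ((\<^bold>\<exists>\<^bsub>T0\<^esub> Eq (v1 0 \<cdot> v0 0) Zero) \<^bold>\<longleftrightarrow> Eq (Var T2 0 \<cdot> v1 0) Zero))"

definition ACA0\<omega> :: "fm set" where
  "ACA0\<omega> = insert exists2 RCA0\<omega>"

definition binary :: "tm \<Rightarrow> fm" where
  "binary f = (\<^bold>\<forall>\<^bsub>T0\<^esub> f\<up> \<cdot> v0 0 \<le>\<^sub>N one)"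

text \<open>A finite sequence of elements of type 1 is an infinite sequence together with a length.\<close>
definition IND0 :: fm where
  "IND0 = (let Y = Var (T1 \<rightarrow> T0 \<rightarrow> T0) 0; w = Var (T0 \<rightarrow> T1) 0 in
     \<^bold>\<forall>\<^bsub>T1 \<rightarrow> T0 \<rightarrow> T0\<^esub>
       (\<^bold>\<forall>\<^bsub>T0\<^esub> \<^bold>\<forall>\<^bsub>T1\<^esub> \<^bold>\<forall>\<^bsub>T1\<^esub>
          binary (v1 1) \<^bold>\<and> binary (v1 0) \<^bold>\<and>
          Eq (Y \<cdot> v1 1 \<cdot> v0 0) Zero \<^bold>\<and> Eq (Y \<cdot> v1 0 \<cdot> v0 0) Zero \<^bold>\<longrightarrow>
          eqt T1 (v1 1) (v1 0)) \<^bold>\<longrightarrow>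
       (\<^bold>\<forall>\<^bsub>T0\<^esub> \<^bold>\<exists>\<^bsub>T0 \<rightarrow> T1\<^esub> \<^bold>\<exists>\<^bsub>T0\<^esub> \<^bold>\<forall>\<^bsub>T0\<^esub> v0 0 \<le>\<^sub>N v0 2 \<^bold>\<longrightarrow>
          ((\<^bold>\<exists>\<^bsub>T0\<^esub> v0 0 <\<^sub>N v0 2 \<^bold>\<and> binary (w \<cdot> v0 0) \<^bold>\<and> Eq (Y \<cdot> (w \<cdot> v0 0) \<cdot> v0 1) Zero)
           \<^bold>\<longleftrightarrow>
           (\<^bold>\<exists>\<^bsub>T1\<^esub> binary (v1 0) \<^bold>\<and> Eq (Y \<cdot> v1 0 \<cdot> v0 0) Zero))))"


section \<open>Functions and sets of reals\<close>

text \<open>In this section the function under consideration is the free variable \<open>ff\<close>.\<close>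

abbreviation RR :: ty where "RR \<equiv> T1 \<rightarrow> T1"
abbreviation ff :: tm where "ff \<equiv> Var RR 0"

text \<open>\<open>ff\<close> maps \<open>[0,1]\<close>, respectively \<open>\<real>\<close>, to \<open>\<real>\<close> and respects real equality.\<close>

definition fun01 :: fm where
  "fun01 =
     ((\<^bold>\<forall>\<^bsub>T1\<^esub> in01 (v1 0) \<^bold>\<longrightarrow> is_real (ff \<cdot> v1 0)) \<^bold>\<and>
      (\<^bold>\<forall>\<^bsub>T1\<^esub> \<^bold>\<forall>\<^bsub>T1\<^esub> in01 (v1 1) \<^bold>\<and> in01 (v1 0) \<^bold>\<and> v1 1 =\<^sub>R v1 0 \<^bold>\<longrightarrow>
         ff \<cdot> v1 1 =\<^sub>R ff \<cdot> v1 0))"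

definition funR :: fm where
  "funR =
     ((\<^bold>\<forall>\<^bsub>T1\<^esub> is_real (v1 0) \<^bold>\<longrightarrow> is_real (ff \<cdot> v1 0)) \<^bold>\<and>
      (\<^bold>\<forall>\<^bsub>T1\<^esub> \<^bold>\<forall>\<^bsub>T1\<^esub> is_real (v1 1) \<^bold>\<and> is_real (v1 0) \<^bold>\<and> v1 1 =\<^sub>R v1 0 \<^bold>\<longrightarrow>
         ff \<cdot> v1 1 =\<^sub>R ff \<cdot> v1 0))"

text \<open>\<open>ff\<close>, assumed to be a function on \<open>[0,1]\<close>, is an injection from \<open>[0,1]\<close> to \<open>\<rat>\<close>.\<close>

definition injQ :: fm where
  "injQ =
     ((\<^bold>\<forall>\<^bsub>T1\<^esub> in01 (v1 0) \<^bold>\<longrightarrow> (\<^bold>\<exists>\<^bsub>T0\<^esub> ff \<cdot> v1 0 =\<^sub>R of_rat (v0 0))) \<^bold>\<and>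
      (\<^bold>\<forall>\<^bsub>T1\<^esub> \<^bold>\<forall>\<^bsub>T1\<^esub> in01 (v1 1) \<^bold>\<and> in01 (v1 0) \<^bold>\<and> ff \<cdot> v1 1 =\<^sub>R ff \<cdot> v1 0 \<^bold>\<longrightarrow>
         v1 1 =\<^sub>R v1 0))"

text \<open>\<open>x\<^sub>0, \<dots>, x\<^sub>n\<close> are reals with \<open>0 = x\<^sub>0 < \<dots> < x\<^sub>n = 1\<close>.\<close>
definition partition :: "tm \<Rightarrow> tm \<Rightarrow> fm" where
  "partition x n =
     (x \<cdot> Zero =\<^sub>R r0 \<^bold>\<and> x \<cdot> n =\<^sub>R r1 \<^bold>\<and>
      (\<^bold>\<forall>\<^bsub>T0\<^esub> v0 0 \<le>\<^sub>N n\<up> \<^bold>\<longrightarrow> is_real (x\<up> \<cdot> v0 0)) \<^bold>\<and>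
      (\<^bold>\<forall>\<^bsub>T0\<^esub> v0 0 <\<^sub>N n\<up> \<^bold>\<longrightarrow> x\<up> \<cdot> v0 0 <\<^sub>R x\<up> \<cdot> suc (v0 0)))"

definition bounded_variation :: fm where
  "bounded_variation = (let x = Var (T0 \<rightarrow> T1) 0 in
     \<^bold>\<exists>\<^bsub>T0\<^esub> \<^bold>\<forall>\<^bsub>T0 \<rightarrow> T1\<^esub> \<^bold>\<forall>\<^bsub>T0\<^esub> partition x (v0 0) \<^bold>\<longrightarrow>
       rsum \<cdot> (\<^bold>\<lambda>\<^bsub>T0\<^esub> rdist (ff \<cdot> (x \<cdot> v0 0)) (ff \<cdot> (x \<cdot> suc (v0 0)))) \<cdot> v0 0 \<le>\<^sub>R of_nat0 (v0 1))"

text \<open>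
  There is a real \<open>I\<close> (\<open>v1 2\<close>) such that for all \<open>\<epsilon> > 0\<close> (\<open>v1 1\<close>) there is \<open>\<delta> > 0\<close> (\<open>v1 0\<close>) such
  that the Riemann sums of all tagged partitions \<open>(x, t)\<close> of mesh \<open>< \<delta>\<close> differ from \<open>I\<close> by less
  than \<open>\<epsilon>\<close>.
\<close>
definition riemann_integrable :: fm where
  "riemann_integrable = (let x = Var (T0 \<rightarrow> T1) 1; t = Var (T0 \<rightarrow> T1) 0 in
     \<^bold>\<exists>\<^bsub>T1\<^esub> is_real (v1 0) \<^bold>\<and>
       (\<^bold>\<forall>\<^bsub>T1\<^esub> pos_real (v1 0) \<^bold>\<longrightarrow>
       (\<^bold>\<exists>\<^bsub>T1\<^esub> pos_real (v1 0) \<^bold>\<and>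
       (\<^bold>\<forall>\<^bsub>T0 \<rightarrow> T1\<^esub> \<^bold>\<forall>\<^bsub>T0 \<rightarrow> T1\<^esub> \<^bold>\<forall>\<^bsub>T0\<^esub>
         partition x (v0 0) \<^bold>\<and>
         (\<^bold>\<forall>\<^bsub>T0\<^esub> v0 0 <\<^sub>N v0 1 \<^bold>\<longrightarrow>
            is_real (t \<cdot> v0 0) \<^bold>\<and> x \<cdot> v0 0 \<le>\<^sub>R t \<cdot> v0 0 \<^bold>\<and> t \<cdot> v0 0 \<le>\<^sub>R x \<cdot> suc (v0 0) \<^bold>\<and>
            x \<cdot> suc (v0 0) -\<^sub>R x \<cdot> v0 0 <\<^sub>R v1 0) \<^bold>\<longrightarrow>
         rdist (rsum \<cdot> (\<^bold>\<lambda>\<^bsub>T0\<^esub> ff \<cdot> (t \<cdot> v0 0) *\<^sub>R (x \<cdot> suc (v0 0) -\<^sub>R x \<cdot> v0 0)) \<cdot> v0 0) (v1 2)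
           <\<^sub>R v1 1))))"

text \<open>
  \<open>f(x\<^sub>0) \<ge> limsup f(x)\<close> as \<open>x \<rightarrow> x\<^sub>0\<close>, with \<open>limsup = inf\<^sub>\<delta> sup\<^sub>0\<^sub><\<^sub>|\<^sub>x\<^sub>-\<^sub>x\<^sub>0\<^sub>|\<^sub><\<^sub>\<delta>\<close> unfolded: for every \<open>\<epsilon> > 0\<close>
  there is \<open>\<delta> > 0\<close> with \<open>f(x) \<le> f(x\<^sub>0) + \<epsilon>\<close> whenever \<open>0 < \<bar>x - x\<^sub>0\<bar> < \<delta>\<close>. The variables \<open>x\<^sub>0\<close>, \<open>\<epsilon>\<close>,
  \<open>\<delta>\<close>, \<open>x\<close> are \<open>v1 3\<close>, \<open>v1 2\<close>, \<open>v1 1\<close>, \<open>v1 0\<close>. Dually for the liminf.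
\<close>

definition upper_semicontinuous :: fm where
  "upper_semicontinuous =
     (\<^bold>\<forall>\<^bsub>T1\<^esub> in01 (v1 0) \<^bold>\<longrightarrow>
     (\<^bold>\<forall>\<^bsub>T1\<^esub> pos_real (v1 0) \<^bold>\<longrightarrow>
     (\<^bold>\<exists>\<^bsub>T1\<^esub> pos_real (v1 0) \<^bold>\<and>
     (\<^bold>\<forall>\<^bsub>T1\<^esub> in01 (v1 0) \<^bold>\<and> r0 <\<^sub>R rdist (v1 0) (v1 3) \<^bold>\<and> rdist (v1 0) (v1 3) <\<^sub>R v1 1 \<^bold>\<longrightarrow>
        ff \<cdot> v1 0 \<le>\<^sub>R ff \<cdot> v1 3 +\<^sub>R v1 2))))"

definition lower_semicontinuous :: fm where
  "lower_semicontinuous =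
     (\<^bold>\<forall>\<^bsub>T1\<^esub> in01 (v1 0) \<^bold>\<longrightarrow>
     (\<^bold>\<forall>\<^bsub>T1\<^esub> pos_real (v1 0) \<^bold>\<longrightarrow>
     (\<^bold>\<exists>\<^bsub>T1\<^esub> pos_real (v1 0) \<^bold>\<and>
     (\<^bold>\<forall>\<^bsub>T1\<^esub> in01 (v1 0) \<^bold>\<and> r0 <\<^sub>R rdist (v1 0) (v1 3) \<^bold>\<and> rdist (v1 0) (v1 3) <\<^sub>R v1 1 \<^bold>\<longrightarrow>
        ff \<cdot> v1 3 -\<^sub>R v1 2 \<le>\<^sub>R ff \<cdot> v1 0))))"

text \<open>A set of reals is a characteristic function that respects real equality.\<close>

definition mem :: "tm \<Rightarrow> tm \<Rightarrow> fm" (infix \<open>\<in>\<^sub>R\<close> 50) where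
  "(x \<in>\<^sub>R X) = Eq (X \<cdot> x) one"

definition is_set :: "tm \<Rightarrow> fm" where
  "is_set X = (let X' = lift T1 0 X in
     (\<^bold>\<forall>\<^bsub>T1\<^esub> is_real (v1 0) \<^bold>\<longrightarrow> X' \<cdot> v1 0 \<le>\<^sub>N one) \<^bold>\<and>
     (\<^bold>\<forall>\<^bsub>T1\<^esub> \<^bold>\<forall>\<^bsub>T1\<^esub> is_real (v1 1) \<^bold>\<and> is_real (v1 0) \<^bold>\<and> v1 1 =\<^sub>R v1 0 \<^bold>\<longrightarrow>
        Eq (lift T1 0 X' \<cdot> v1 1) (lift T1 0 X' \<cdot> v1 0)))"

text \<open>For every \<open>x \<in> X\<close> there is \<open>n\<close> such that all reals \<open>y\<close> with \<open>\<bar>x - y\<bar> < 2\<^sup>-\<^sup>n\<close> are in \<open>X\<close>.\<close>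
definition is_open :: "tm \<Rightarrow> fm" where
  "is_open X = (is_set X \<^bold>\<and>
     (let X' = lift T1 0 (lift T1 0 (X\<up>)) in
      \<^bold>\<forall>\<^bsub>T1\<^esub> is_real (v1 0) \<^bold>\<and> v1 0 \<in>\<^sub>R lift T1 0 X \<^bold>\<longrightarrow>
        (\<^bold>\<exists>\<^bsub>T0\<^esub> \<^bold>\<forall>\<^bsub>T1\<^esub> is_real (v1 0) \<^bold>\<and> rdist (v1 1) (v1 0) <\<^sub>R of_rat (qeps \<cdot> v0 0) \<^bold>\<longrightarrow>
           v1 0 \<in>\<^sub>R X')))"

text \<open>
  Neighbourhoods and balls are those of the space \<open>[0,1]\<close>, so that the ball \<open>G\<close>, with centre
  \<open>c \<in> [0,1]\<close> and radius \<open>r > 0\<close>, meets \<open>[0,1]\<close>. Inside the existential quantifiers \<open>c\<close> and \<open>r\<close>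
  are \<open>v1 1\<close> and \<open>v1 0\<close>, and \<open>\<epsilon>\<close> is \<open>v1 2\<close>.
\<close>
definition cliquish :: fm where
  "cliquish =
     (\<^bold>\<forall>\<^bsub>T1\<^esub> \<^bold>\<forall>\<^bsub>T1\<^esub> \<^bold>\<forall>\<^bsub>T2\<^esub>
        in01 (v1 1) \<^bold>\<and> pos_real (v1 0) \<^bold>\<and> is_open (Var T2 0) \<^bold>\<and> v1 1 \<in>\<^sub>R Var T2 0 \<^bold>\<longrightarrow>
        (\<^bold>\<exists>\<^bsub>T1\<^esub> \<^bold>\<exists>\<^bsub>T1\<^esub> in01 (v1 1) \<^bold>\<and> pos_real (v1 0) \<^bold>\<and>
           (\<^bold>\<forall>\<^bsub>T1\<^esub> in01 (v1 0) \<^bold>\<and> rdist (v1 0) (v1 2) <\<^sub>R v1 1 \<^bold>\<longrightarrow> v1 0 \<in>\<^sub>R Var T2 0) \<^bold>\<and>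
           (\<^bold>\<forall>\<^bsub>T1\<^esub> \<^bold>\<forall>\<^bsub>T1\<^esub>
              in01 (v1 1) \<^bold>\<and> rdist (v1 1) (v1 3) <\<^sub>R v1 2 \<^bold>\<and>
              in01 (v1 0) \<^bold>\<and> rdist (v1 0) (v1 3) <\<^sub>R v1 2 \<^bold>\<longrightarrow>
              rdist (ff \<cdot> v1 0) (ff \<cdot> v1 1) <\<^sub>R v1 4)))"

text \<open>
  The type 3 object \<open>Var T3 0\<close>, read as the collection of sets of reals on which it has value 1,
  is a \<open>\<sigma>\<close>-algebra containing the open sets. The clauses quantify over every representative
  of the complement and of the union, so the collection respects equality of sets of reals.
\<close>
definition sigma_algebra :: fm where
  "sigma_algebra = (let A = (\<lambda>X. Eq (Var T3 0 \<cdot> X) one); Z = Var (T0 \<rightarrow> T2) 0 in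
     (\<^bold>\<forall>\<^bsub>T2\<^esub> is_open (Var T2 0) \<^bold>\<longrightarrow> A (Var T2 0)) \<^bold>\<and>
     (\<^bold>\<forall>\<^bsub>T2\<^esub> \<^bold>\<forall>\<^bsub>T2\<^esub> is_set (Var T2 1) \<^bold>\<and> is_set (Var T2 0) \<^bold>\<and> A (Var T2 1) \<^bold>\<and>
        (\<^bold>\<forall>\<^bsub>T1\<^esub> is_real (v1 0) \<^bold>\<longrightarrow> (v1 0 \<in>\<^sub>R Var T2 0 \<^bold>\<longleftrightarrow> \<^bold>\<not> v1 0 \<in>\<^sub>R Var T2 1)) \<^bold>\<longrightarrow>
        A (Var T2 0)) \<^bold>\<and>
     (\<^bold>\<forall>\<^bsub>T0 \<rightarrow> T2\<^esub> \<^bold>\<forall>\<^bsub>T2\<^esub> is_set (Var T2 0) \<^bold>\<and>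
        (\<^bold>\<forall>\<^bsub>T0\<^esub> is_set (Z \<cdot> v0 0) \<^bold>\<and> A (Z \<cdot> v0 0)) \<^bold>\<and>
        (\<^bold>\<forall>\<^bsub>T1\<^esub> is_real (v1 0) \<^bold>\<longrightarrow> (v1 0 \<in>\<^sub>R Var T2 0 \<^bold>\<longleftrightarrow> (\<^bold>\<exists>\<^bsub>T0\<^esub> v1 0 \<in>\<^sub>R Z \<cdot> v0 0))) \<^bold>\<longrightarrow>
        A (Var T2 0)))"

definition borel_set :: fm where
  "borel_set =
     (is_set (Var T2 0) \<^bold>\<and> (\<^bold>\<forall>\<^bsub>T3\<^esub> sigma_algebra \<^bold>\<longrightarrow> Eq (Var T3 0 \<cdot> Var T2 0) one))"

definition borel_function :: fm where
  "borel_function =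
     (\<^bold>\<forall>\<^bsub>T1\<^esub> is_real (v1 0) \<^bold>\<longrightarrow>
       (\<^bold>\<exists>\<^bsub>T2\<^esub> borel_set \<^bold>\<and>
         (\<^bold>\<forall>\<^bsub>T1\<^esub> is_real (v1 0) \<^bold>\<longrightarrow>
            (v1 0 \<in>\<^sub>R Var T2 0 \<^bold>\<longleftrightarrow> in01 (v1 0) \<^bold>\<and> v1 1 <\<^sub>R ff \<cdot> v1 0))))"


section \<open>The principles\<close>

definition NIN :: fm where
  "NIN = (\<^bold>\<not> (\<^bold>\<exists>\<^bsub>T2\<^esub> \<^bold>\<forall>\<^bsub>T1\<^esub> \<^bold>\<forall>\<^bsub>T1\<^esub> in01 (v1 1) \<^bold>\<and> in01 (v1 0) \<^bold>\<longrightarrow>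
     (v1 1 =\<^sub>R v1 0 \<^bold>\<longrightarrow> Eq (Var T2 0 \<cdot> v1 1) (Var T2 0 \<cdot> v1 0)) \<^bold>\<and>
     (Eq (Var T2 0 \<cdot> v1 1) (Var T2 0 \<cdot> v1 0) \<^bold>\<longrightarrow> v1 1 =\<^sub>R v1 0)))"

definition no_injection :: "fm \<Rightarrow> fm" where
  "no_injection P = (\<^bold>\<not> (\<^bold>\<exists>\<^bsub>RR\<^esub> fun01 \<^bold>\<and> injQ \<^bold>\<and> P))"

definition NIN_bv :: fm where "NIN_bv = no_injection bounded_variation"
definition NIN_Riemann :: fm where "NIN_Riemann = no_injection riemann_integrable"
definition NIN_Borel :: fm where "NIN_Borel = no_injection borel_function"
definition NIN_cliq :: fm where "NIN_cliq = no_injection cliquish"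
definition NIN_semi :: fm where "NIN_semi = no_injection upper_semicontinuous"
definition NIN_semi' :: fm where "NIN_semi' = no_injection lower_semicontinuous"

text \<open>
  A property of functions \<open>\<real> \<rightarrow> \<real>\<close> is a formula \<open>Y\<close> about \<open>ff\<close>; further free variables of \<open>Y\<close>
  are parameters. Since \<open>Y\<close> speaks about functions defined on all of \<open>\<real>\<close>, so does \<open>NIN_Y\<close>.
\<close>

definition NIN_Y :: "fm \<Rightarrow> fm" where
  "NIN_Y Y = no_injection (funR \<^bold>\<and> Y)"

definition bv_property :: "fm \<Rightarrow> bool" where
  "bv_property Y \<longleftrightarrow> wff Y \<and> (RCA0\<omega> \<turnstile> (\<^bold>\<forall>\<^bsub>RR\<^esub> funR \<^bold>\<and> bounded_variation \<^bold>\<longrightarrow> Y))"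

end

theory Submission
  imports Defs "HOL-Library.Countable_Set" "HOL-Computational_Algebra.Fraction_Field"
begin

text \<open>By completeness, a sentence is derivable once it is true in the term model of every maximal
  consistent Henkin set, so the equivalences can be argued for inside a model, whose objects of the
  finite types interpret \<open>ACA\<^sub>0\<^sup>\<omega>\<close>.

  There, an injection from \<open>[0,1]\<close> to \<open>\<nat>\<close> is obtained from one to \<open>\<rat>\<close> by taking the least code of the
  value, independently of any further property. Conversely, an injection \<open>Y\<close> to \<open>\<nat>\<close> gives the injection
  \<open>f(x) = 2\<^sup>-\<^sup>Y\<^sup>(\<^sup>x\<^sup>)\<close> to \<open>\<rat>\<close>. As the values of \<open>Y\<close> at distinct points are distinct, sums of values of \<open>f\<close>
  are bounded, whence \<open>f\<close> has bounded variation and Riemann integral 0. With \<open>IND0\<close>, applied to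
  Dedekind cuts as canonical binary codes of the reals, the sets \<open>{x. Y(x) \<le> k}\<close> can be enumerated as
  finite sequences. Hence each point has a punctured neighbourhood on which \<open>f\<close> is small, which makes \<open>f\<close>
  upper semi-continuous, \<open>-f\<close> lower semi-continuous and \<open>f\<close> cliquish, and the sets \<open>{x. f(x) > a}\<close>
  with \<open>a > 0\<close> finite, so Borel.\<close>


section \<open>Completeness of the calculus\<close>

text \<open>The numbers of the model may be nonstandard, so neither induction nor finite sums of the
  metatheory apply to them. Every induction over them has to go back to \<open>QF_IND\<close>, so
  its predicate has to be given by an object of the model. The rules for \<open>dfn\<close>,
  \<open>pd\<close> and \<open>rq\<close> establish this, and \<open>exists2\<close> extends them to
  number quantifiers, which makes arithmetical predicates with parameters available. Sums and lists
  have a length in the model and are handled by its own recursor. The objects become HOL types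
  (\<open>nn\<close>, \<open>fn\<close>) so that type classes, fraction fields and linear arithmetic
  serve the internal numbers. A type cannot depend on a model fixed only inside a proof; hence one
  global choice, a counterexample if there is any. The types have to exist, and \<open>nn\<close>
  has to be an ordered semidomain, even where that choice fails. Powers of two serve twice: distinct
  exponents keep sums below a geometric series, and large exponents give small values, so that
  control over finite sets of exponents is control over limits.\<close>

instance ty :: countable by countable_datatype
instance tm :: countable by countable_datatype
instance fm :: countable by countable_datatype

section \<open>Simultaneous substitution\<close>

primrec tsub :: "(ty \<Rightarrow> nat \<Rightarrow> tm) \<Rightarrow> tm \<Rightarrow> tm" where
  "tsub \<theta> (Var \<tau> i) = \<theta> \<tau> i"
| "tsub \<theta> Zero = Zero"
| "tsub \<theta> Succ = Succ"
| "tsub \<theta> (Proj \<rho> \<tau>) = Proj \<rho> \<tau>"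
| "tsub \<theta> (Comb \<delta> \<rho> \<tau>) = Comb \<delta> \<rho> \<tau>"
| "tsub \<theta> Rec = Rec"
| "tsub \<theta> (s \<cdot> t) = tsub \<theta> s \<cdot> tsub \<theta> t"

text \<open>Only the indices of type \<open>\<tau>\<close> move; those of other types stay, in line
  with the separate counting of de Bruijn indices for each type.\<close>

definition push :: "ty \<Rightarrow> 'a \<Rightarrow> (ty \<Rightarrow> nat \<Rightarrow> 'a) \<Rightarrow> ty \<Rightarrow> nat \<Rightarrow> 'a" where
  "push \<tau> x e = (\<lambda>\<sigma> i. if \<sigma> = \<tau> then (case i of 0 \<Rightarrow> x | Suc j \<Rightarrow> e \<tau> j) else e \<sigma> i)"

lemma push_simps [simp]:
  "push \<tau> x e \<tau> 0 = x"
  "push \<tau> x e \<tau> (Suc j) = e \<tau> j"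
  "push \<tau> x e \<tau> (numeral k) = e \<tau> (pred_numeral k)"
  "\<sigma> \<noteq> \<tau> \<Longrightarrow> push \<tau> x e \<sigma> i = e \<sigma> i"
  by (simp_all add: push_def numeral_eq_Suc)

definition ups :: "ty \<Rightarrow> (ty \<Rightarrow> nat \<Rightarrow> tm) \<Rightarrow> ty \<Rightarrow> nat \<Rightarrow> tm" where
  "ups \<tau> \<theta> = push \<tau> (Var \<tau> 0) (\<lambda>\<sigma> i. lift \<tau> 0 (\<theta> \<sigma> i))"

primrec fsub :: "(ty \<Rightarrow> nat \<Rightarrow> tm) \<Rightarrow> fm \<Rightarrow> fm" where
  "fsub \<theta> (Eq s t) = Eq (tsub \<theta> s) (tsub \<theta> t)"
| "fsub \<theta> Falsum = Falsum"
| "fsub \<theta> (\<phi> \<^bold>\<longrightarrow> \<psi>) = (fsub \<theta> \<phi> \<^bold>\<longrightarrow> fsub \<theta> \<psi>)"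
| "fsub \<theta> (\<^bold>\<forall>\<^bsub>\<tau>\<^esub> \<phi>) = (\<^bold>\<forall>\<^bsub>\<tau>\<^esub> fsub (ups \<tau> \<theta>) \<phi>)"

lemma tsub_tsub: "tsub \<theta> (tsub \<eta> t) = tsub (\<lambda>\<sigma> i. tsub \<theta> (\<eta> \<sigma> i)) t"
  by (induction t) auto

lemma tsub_Var [simp]: "tsub Var t = t"
  by (induction t) auto

lemma tsub_ups_lift: "tsub (ups \<tau> \<theta>) (lift \<tau> 0 t) = lift \<tau> 0 (tsub \<theta> t)"
  by (induction t) (auto simp: ups_def push_def)

lemma ups_tsub: "ups \<tau> (\<lambda>\<sigma> i. tsub \<theta> (\<eta> \<sigma> i)) = (\<lambda>\<sigma> i. tsub (ups \<tau> \<theta>) (ups \<tau> \<eta> \<sigma> i))"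
  by (intro ext) (auto simp: ups_def push_def tsub_ups_lift[unfolded ups_def push_def] split: nat.split)

lemma fsub_fsub: "fsub \<theta> (fsub \<eta> \<phi>) = fsub (\<lambda>\<sigma> i. tsub \<theta> (\<eta> \<sigma> i)) \<phi>"
  by (induction \<phi> arbitrary: \<theta> \<eta>) (auto simp: tsub_tsub ups_tsub)

lemma ups_Var [simp]: "ups \<tau> Var = Var"
  by (intro ext) (auto simp: ups_def push_def split: nat.split)

lemma fsub_Var [simp]: "fsub Var \<phi> = \<phi>"
  by (induction \<phi>) auto

definition shift :: "ty \<Rightarrow> nat \<Rightarrow> ty \<Rightarrow> nat \<Rightarrow> tm" where
  "shift \<sigma> k = (\<lambda>\<tau> i. Var \<tau> (if \<tau> = \<sigma> \<and> k \<le> i then Suc i else i))"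

definition single :: "ty \<Rightarrow> nat \<Rightarrow> tm \<Rightarrow> ty \<Rightarrow> nat \<Rightarrow> tm" where
  "single \<sigma> k s = (\<lambda>\<tau> i. if \<tau> \<noteq> \<sigma> \<or> i < k then Var \<tau> i else if i = k then s else Var \<tau> (i - 1))"

lemma lift_tsub: "lift \<sigma> k t = tsub (shift \<sigma> k) t"
  by (induction t) (auto simp: shift_def)

lemma subst_tsub: "subst \<sigma> k s t = tsub (single \<sigma> k s) t"
  by (induction t) (auto simp: single_def)

lemma ups_shift: "ups \<tau> (shift \<sigma> k) = shift \<sigma> (if \<tau> = \<sigma> then Suc k else k)"
  by (intro ext) (auto simp: ups_def push_def shift_def split: nat.split)

lemma ups_single: "ups \<tau> (single \<sigma> k s) = single \<sigma> (if \<tau> = \<sigma> then Suc k else k) (lift \<tau> 0 s)"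
  by (intro ext) (auto simp: ups_def push_def single_def split: nat.split)

lemma liftf_fsub: "liftf \<sigma> k \<phi> = fsub (shift \<sigma> k) \<phi>"
  by (induction \<phi> arbitrary: k) (auto simp: lift_tsub ups_shift)

lemma substf_fsub: "substf \<sigma> k s \<phi> = fsub (single \<sigma> k s) \<phi>"
  by (induction \<phi> arbitrary: k s) (auto simp: subst_tsub ups_single)

text \<open>Instantiating a binder after a substitution has passed under it amounts to extending the
  environment. This is what turns membership of universal formulas into a quantifier over
  environments in \<open>sat_All\<close>.\<close>

lemma substf_fsub_ups: "substf \<tau> 0 t (fsub (ups \<tau> e) \<phi>) = fsub (push \<tau> t e) \<phi>"
proof -
  have "tsub (single \<tau> 0 t) (lift \<tau> 0 s) = s" for s
  proof -
    have "(\<lambda>\<sigma> i. tsub (single \<tau> 0 t) (shift \<tau> 0 \<sigma> i)) = Var"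
      by (intro ext) (auto simp: shift_def single_def)
    then show ?thesis by (simp add: lift_tsub tsub_tsub)
  qed
  then have "(\<lambda>\<sigma> i. tsub (single \<tau> 0 t) (ups \<tau> e \<sigma> i)) = push \<tau> t e"
    by (intro ext) (auto simp: ups_def push_def single_def split: nat.split)
  then show ?thesis by (simp add: substf_fsub fsub_fsub)
qed

definition wenv :: "(ty \<Rightarrow> nat \<Rightarrow> tm) \<Rightarrow> bool" where
  "wenv e \<longleftrightarrow> (\<forall>\<tau> i. wt (e \<tau> i) \<and> tyof (e \<tau> i) = \<tau>)"

lemma wenv_Var [simp]: "wenv Var"
  by (simp add: wenv_def)

lemma wenv_push [simp]: "wenv e \<Longrightarrow> wt x \<Longrightarrow> tyof x = \<tau> \<Longrightarrow> wenv (push \<tau> x e)"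
  by (auto simp: wenv_def push_def split: nat.split)

lemma tyof_tsub [simp]: "wenv e \<Longrightarrow> tyof (tsub e t) = tyof t"
  by (induction t) (auto simp: wenv_def)

lemma wt_tsub [simp]: "wenv e \<Longrightarrow> wt t \<Longrightarrow> wt (tsub e t)"
  by (induction t) (auto simp: wenv_def)

lemma tyof_lift [simp]: "tyof (lift \<sigma> k t) = tyof t"
  by (induction t) auto

lemma wt_lift [simp]: "wt (lift \<sigma> k t) = wt t"
  by (induction t) auto

lemma wenv_ups [simp]: "wenv e \<Longrightarrow> wenv (ups \<tau> e)"
  by (auto simp: wenv_def ups_def push_def split: nat.split)

lemma wff_fsub [simp]: "wenv e \<Longrightarrow> wff \<phi> \<Longrightarrow> wff (fsub e \<phi>)"
  by (induction \<phi> arbitrary: e) auto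

lemma wenv_single [simp]: "wt s \<Longrightarrow> tyof s = \<sigma> \<Longrightarrow> wenv (single \<sigma> k s)"
  by (auto simp: wenv_def single_def)

lemma wff_substf [simp]: "wt s \<Longrightarrow> tyof s = \<sigma> \<Longrightarrow> wff \<phi> \<Longrightarrow> wff (substf \<sigma> k s \<phi>)"
  by (simp add: substf_fsub)

section \<open>Weakening, renaming of theorems, fresh variables\<close>

lemma deriv_mono: "deriv T \<Gamma> \<phi> \<Longrightarrow> set \<Gamma> \<subseteq> set \<Delta> \<Longrightarrow> deriv T \<Delta> \<phi>"
proof (induction arbitrary: \<Delta> rule: deriv.induct)
  case (ImpI \<phi> \<Gamma> \<psi>)
  have "deriv T (\<phi> # \<Delta>) \<psi>" using ImpI.prems by (intro ImpI.IH) auto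
  with ImpI.hyps(1) show ?case by (rule deriv.ImpI)
next
  case (RAA \<phi> \<Gamma>)
  have "deriv T ((\<phi> \<^bold>\<longrightarrow> Falsum) # \<Delta>) Falsum" using RAA.prems by (intro RAA.IH) auto
  with RAA.hyps(1) show ?case by (rule deriv.RAA)
next
  case (AllI \<tau> \<Gamma> \<phi>)
  have "deriv T (map (liftf \<tau> 0) \<Delta>) \<phi>" using AllI.prems by (intro AllI.IH) auto
  then show ?case by (rule deriv.AllI)
qed (blast intro: deriv.intros)+

primrec imps :: "fm list \<Rightarrow> fm \<Rightarrow> fm" where
  "imps [] \<phi> = \<phi>"
| "imps (\<gamma> # \<Gamma>) \<phi> = imps \<Gamma> (\<gamma> \<^bold>\<longrightarrow> \<phi>)"

lemma deriv_imps: "\<forall>\<gamma>\<in>set \<Gamma>. wff \<gamma> \<Longrightarrow> deriv T \<Gamma> \<phi> \<longleftrightarrow> deriv T [] (imps \<Gamma> \<phi>)"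
proof (induction \<Gamma> arbitrary: \<phi>)
  case (Cons \<gamma> \<Gamma>)
  have "deriv T (\<gamma> # \<Gamma>) \<phi> \<longleftrightarrow> deriv T \<Gamma> (\<gamma> \<^bold>\<longrightarrow> \<phi>)"
  proof
    assume "deriv T \<Gamma> (\<gamma> \<^bold>\<longrightarrow> \<phi>)"
    then have "deriv T (\<gamma> # \<Gamma>) (\<gamma> \<^bold>\<longrightarrow> \<phi>)" by (rule deriv_mono) auto
    then show "deriv T (\<gamma> # \<Gamma>) \<phi>" by (rule deriv.ImpE) (simp add: deriv.Hyp)
  qed (use Cons.prems in \<open>auto intro: deriv.ImpI\<close>)
  then show ?case using Cons by simp
qed simp

lemma fsub_imps: "fsub \<theta> (imps \<Gamma> \<phi>) = imps (map (fsub \<theta>) \<Gamma>) (fsub \<theta> \<phi>)"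
  by (induction \<Gamma> arbitrary: \<phi>) auto

text \<open>Axioms are not lifted by \<open>AllI\<close>, so a renaming of a theorem is obtained by repeatedly
  generalizing and instantiating the variable with index 0.\<close>

lemma deriv_rename:
  assumes "deriv T [] \<chi>"
  shows "deriv T [] (fsub (\<lambda>\<sigma> i. Var \<sigma> (if \<sigma> = \<tau> then (if i < n then \<rho> i else i - n) else i)) \<chi>)"
proof -
  \<comment> \<open>Each round generalizes index 0 and lowers all other indices by one. The offset
    \<open>n - j\<close> compensates for the rounds still to come, so that the variables already
    treated end up at \<open>\<rho> i\<close>.\<close>
  have "deriv T [] (fsub (\<lambda>\<sigma> i. Var \<sigma> (if \<sigma> = \<tau> then (if i < j then \<rho> i + (n - j) else i - j) else i)) \<chi>)"
    if "j \<le> n" for j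
    using that
  proof (induction j)
    case 0
    have "(\<lambda>\<sigma> i. Var \<sigma> (if \<sigma> = \<tau> then (if i < 0 then \<rho> i + (n - 0) else i - 0) else i)) = Var"
      by (intro ext) auto
    then show ?case using assms by (simp only: fsub_Var)
  next
    case (Suc j)
    let ?\<theta> = "\<lambda>j \<sigma> i. Var \<sigma> (if \<sigma> = \<tau> then (if i < j then \<rho> i + (n - j) else i - j) else i)"
    have "deriv T [] (\<^bold>\<forall>\<^bsub>\<tau>\<^esub> fsub (?\<theta> j) \<chi>)" using Suc by (intro deriv.AllI) simp
    from deriv.AllE[OF this, of "Var \<tau> (\<rho> j + (n - Suc j))"]
    have "deriv T [] (fsub (\<lambda>\<sigma> i. tsub (single \<tau> 0 (Var \<tau> (\<rho> j + (n - Suc j)))) (?\<theta> j \<sigma> i)) \<chi>)"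
      by (simp only: substf_fsub fsub_fsub wt.simps tyof.simps)
    also have "(\<lambda>\<sigma> i. tsub (single \<tau> 0 (Var \<tau> (\<rho> j + (n - Suc j)))) (?\<theta> j \<sigma> i)) = ?\<theta> (Suc j)"
      using Suc.prems by (intro ext) (auto simp: single_def)
    finally show ?case .
  qed
  from this[of n] show ?thesis by (simp cong: if_cong)
qed

text \<open>Finiteness of the set of free variables, expressed through agreement of substitutions
  instead of a syntactic count; this is the form in which \<open>deriv_fresh\<close> and
  \<open>sat_theorem\<close> use it.\<close>

definition tbounded :: "ty set \<Rightarrow> nat \<Rightarrow> tm \<Rightarrow> bool" where
  "tbounded S n t \<longleftrightarrow> (\<forall>\<theta> \<theta>'. (\<forall>\<sigma>\<in>S. \<forall>i<n. \<theta> \<sigma> i = \<theta>' \<sigma> i) \<longrightarrow> tsub \<theta> t = tsub \<theta>' t)"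

definition bounded :: "ty set \<Rightarrow> nat \<Rightarrow> fm \<Rightarrow> bool" where
  "bounded S n \<phi> \<longleftrightarrow> (\<forall>\<theta> \<theta>'. (\<forall>\<sigma>\<in>S. \<forall>i<n. \<theta> \<sigma> i = \<theta>' \<sigma> i) \<longrightarrow> fsub \<theta> \<phi> = fsub \<theta>' \<phi>)"

lemma boundedD:
  "bounded S n \<phi> \<Longrightarrow> (\<And>\<sigma> i. \<sigma> \<in> S \<Longrightarrow> i < n \<Longrightarrow> \<theta> \<sigma> i = \<theta>' \<sigma> i) \<Longrightarrow> fsub \<theta> \<phi> = fsub \<theta>' \<phi>"
  by (auto simp: bounded_def)

lemma tbounded_mono: "tbounded S n t \<Longrightarrow> S \<subseteq> S' \<Longrightarrow> n \<le> m \<Longrightarrow> tbounded S' m t"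
  unfolding tbounded_def by (meson less_le_trans subsetD)

lemma bounded_mono: "bounded S n \<phi> \<Longrightarrow> S \<subseteq> S' \<Longrightarrow> n \<le> m \<Longrightarrow> bounded S' m \<phi>"
  unfolding bounded_def by (meson less_le_trans subsetD)

lemma ex_tbounded: "\<exists>S n. finite S \<and> tbounded S n t"
proof (induction t)
  case (Var \<tau> i)
  show ?case by (intro exI[of _ "{\<tau>}"] exI[of _ "Suc i"]) (auto simp: tbounded_def)
next
  case (App s t)
  then obtain S n S' m where "finite S" "tbounded S n s" "finite S'" "tbounded S' m t" by auto
  then have "tbounded (S \<union> S') (max n m) s" "tbounded (S \<union> S') (max n m) t" "finite (S \<union> S')"
    by (auto elim: tbounded_mono)
  then show ?case by (intro exI[of _ "S \<union> S'"] exI[of _ "max n m"]) (auto simp: tbounded_def)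
qed (auto simp: tbounded_def)

lemma ex_bounded: "\<exists>S n. finite S \<and> bounded S n \<phi>"
proof (induction \<phi>)
  case (Eq s t)
  obtain S n S' m where "finite S" "tbounded S n s" "finite S'" "tbounded S' m t"
    using ex_tbounded by metis
  then have "tbounded (S \<union> S') (max n m) s" "tbounded (S \<union> S') (max n m) t" "finite (S \<union> S')"
    by (auto elim: tbounded_mono)
  then show ?case
    by (intro exI[of _ "S \<union> S'"] exI[of _ "max n m"]) (auto simp: tbounded_def bounded_def)
next
  case (Imp \<phi> \<psi>)
  then obtain S n S' m where "finite S" "bounded S n \<phi>" "finite S'" "bounded S' m \<psi>" by auto
  then have "bounded (S \<union> S') (max n m) \<phi>" "bounded (S \<union> S') (max n m) \<psi>" "finite (S \<union> S')"
    by (auto elim: bounded_mono)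
  then show ?case by (intro exI[of _ "S \<union> S'"] exI[of _ "max n m"]) (auto simp: bounded_def)
next
  case (All \<tau> \<phi>)
  then obtain S n where n: "finite S" "bounded S n \<phi>" by auto
  have "bounded S n (\<^bold>\<forall>\<^bsub>\<tau>\<^esub> \<phi>)"
    unfolding bounded_def
  proof (intro allI impI)
    fix \<theta> \<theta>' :: "ty \<Rightarrow> nat \<Rightarrow> tm"
    assume *: "\<forall>\<sigma>\<in>S. \<forall>i<n. \<theta> \<sigma> i = \<theta>' \<sigma> i"
    have "\<forall>\<sigma>\<in>S. \<forall>i<n. ups \<tau> \<theta> \<sigma> i = ups \<tau> \<theta>' \<sigma> i"
      using * by (auto simp: ups_def push_def split: nat.split)
    then show "fsub \<theta> (\<^bold>\<forall>\<^bsub>\<tau>\<^esub> \<phi>) = fsub \<theta>' (\<^bold>\<forall>\<^bsub>\<tau>\<^esub> \<phi>)" using n by (auto simp: bounded_def)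
  qed
  then show ?case using n by blast
qed (auto simp: bounded_def)

lemma ex_bounded_list: "\<exists>n. \<forall>\<phi>\<in>set \<Gamma>. bounded UNIV n \<phi>"
proof (induction \<Gamma>)
  case (Cons \<gamma> \<Gamma>)
  then obtain n where "\<forall>\<phi>\<in>set \<Gamma>. bounded UNIV n \<phi>" by blast
  moreover obtain m where "bounded UNIV m \<gamma>" using ex_bounded bounded_mono by blast
  ultimately show ?case by (intro exI[of _ "max n m"]) (auto intro: bounded_mono)
qed simp

text \<open>\<open>AllI\<close> asks for a derivation from lifted assumptions. The assumptions are
  moved into the formula by \<open>imps\<close>, the resulting theorem is renamed so that
  \<open>c\<close> becomes index 0, and the assumptions are moved back, now lifted.\<close>

lemma deriv_fresh:
  assumes "deriv T \<Gamma> (substf \<tau> 0 (Var \<tau> c) \<psi>)" "\<forall>\<gamma>\<in>set \<Gamma>. wff \<gamma> \<and> bounded UNIV c \<gamma>" "bounded UNIV c \<psi>"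
  shows "deriv T \<Gamma> (\<^bold>\<forall>\<^bsub>\<tau>\<^esub> \<psi>)"
proof (rule deriv.AllI)
  \<comment> \<open>On the indices below \<open>c\<close>, the only ones that occur in \<Gamma> and
    \<psi>, this is the lift; sending \<open>c\<close> itself to 0 undoes the substitution of the
    fresh variable in \<psi>.\<close>
  define \<theta> where "\<theta> = (\<lambda>\<sigma> i. Var \<sigma> (if \<sigma> = \<tau> then
    (if i < Suc c then (if i = c then 0 else Suc i) else i - Suc c) else i))"
  have "deriv T [] (fsub \<theta> (imps \<Gamma> (substf \<tau> 0 (Var \<tau> c) \<psi>)))"
    unfolding \<theta>_def using assms deriv_imps by (intro deriv_rename) blast
  then have *: "deriv T [] (imps (map (fsub \<theta>) \<Gamma>) (fsub \<theta> (substf \<tau> 0 (Var \<tau> c) \<psi>)))"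
    by (simp only: fsub_imps)
  have "fsub \<theta> \<gamma> = liftf \<tau> 0 \<gamma>" if "\<gamma> \<in> set \<Gamma>" for \<gamma>
  proof -
    have "\<forall>\<sigma>. \<forall>i<c. \<theta> \<sigma> i = shift \<tau> 0 \<sigma> i" by (auto simp: \<theta>_def shift_def)
    then show ?thesis using assms(2) that
      unfolding liftf_fsub by (intro boundedD[of UNIV c]) auto
  qed
  then have 1: "map (fsub \<theta>) \<Gamma> = map (liftf \<tau> 0) \<Gamma>" by simp
  have "\<forall>\<sigma>. \<forall>i<c. tsub \<theta> (single \<tau> 0 (Var \<tau> c) \<sigma> i) = Var \<sigma> i"
    by (auto simp: \<theta>_def single_def)
  then have "fsub (\<lambda>\<sigma> i. tsub \<theta> (single \<tau> 0 (Var \<tau> c) \<sigma> i)) \<psi> = fsub Var \<psi>"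
    by (intro boundedD[OF assms(3)]) simp
  then have 2: "fsub \<theta> (substf \<tau> 0 (Var \<tau> c) \<psi>) = \<psi>" by (simp add: substf_fsub fsub_fsub)
  have "wenv (shift \<tau> 0)" by (simp add: wenv_def shift_def)
  then have "\<forall>\<gamma>\<in>set (map (liftf \<tau> 0) \<Gamma>). wff \<gamma>"
    using assms(2) by (simp add: liftf_fsub)
  then show "deriv T (map (liftf \<tau> 0) \<Gamma>) \<psi>" using * deriv_imps[of "map (liftf \<tau> 0) \<Gamma>" T \<psi>]
    unfolding 1 2 by blast
qed

section \<open>Maximal consistent sets with variables as Henkin witnesses\<close>

definition mcs :: "fm set \<Rightarrow> fm set \<Rightarrow> bool" where
  "mcs T H \<longleftrightarrow> (\<forall>\<Gamma> \<phi>. set \<Gamma> \<subseteq> H \<longrightarrow> deriv T \<Gamma> \<phi> \<longrightarrow> wff \<phi> \<longrightarrow> \<phi> \<in> H) \<and> Falsum \<notin> H \<and>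
     (\<forall>\<phi>. wff \<phi> \<longrightarrow> \<phi> \<in> H \<or> Neg \<phi> \<in> H) \<and>
     (\<forall>\<tau> \<phi>. wff \<phi> \<longrightarrow> (\<^bold>\<forall>\<^bsub>\<tau>\<^esub> \<phi>) \<notin> H \<longrightarrow> (\<exists>c. substf \<tau> 0 (Var \<tau> c) \<phi> \<notin> H))"

definition cons :: "fm set \<Rightarrow> fm list \<Rightarrow> bool" where
  "cons T \<Gamma> \<longleftrightarrow> (\<forall>\<gamma>\<in>set \<Gamma>. wff \<gamma>) \<and> \<not> deriv T \<Gamma> Falsum"

lemma deriv_cut: "deriv T (\<phi> # \<Gamma>) \<psi> \<Longrightarrow> wff \<phi> \<Longrightarrow> deriv T \<Gamma> \<phi> \<Longrightarrow> deriv T \<Gamma> \<psi>"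
  by (blast intro: deriv.ImpE deriv.ImpI)

text \<open>If \<chi> is refutable, its negation is derivable and can be added. For a rejected
  universal formula a variable beyond all indices in the finite list serves as counterexample:
  otherwise \<open>RAA\<close> would derive the instance, and \<open>deriv_fresh\<close> the
  universal formula itself.\<close>

lemma cons_step:
  assumes "cons T \<Gamma>" "wff \<chi>"
  shows "\<exists>\<Delta>. cons T \<Delta> \<and> set \<Gamma> \<subseteq> set \<Delta> \<and> (\<chi> \<in> set \<Delta> \<or> Neg \<chi> \<in> set \<Delta> \<and>
    (\<forall>\<tau> \<phi>. \<chi> = (\<^bold>\<forall>\<^bsub>\<tau>\<^esub> \<phi>) \<longrightarrow> (\<exists>c. Neg (substf \<tau> 0 (Var \<tau> c) \<phi>) \<in> set \<Delta>)))"
proof (cases "deriv T (\<chi> # \<Gamma>) Falsum")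
  case False
  then show ?thesis using assms by (intro exI[of _ "\<chi> # \<Gamma>"]) (auto simp: cons_def)
next
  case True
  have neg: "deriv T \<Gamma> (Neg \<chi>)" unfolding Neg_def using assms(2) True by (rule deriv.ImpI)
  have c1: "cons T (Neg \<chi> # \<Gamma>)"
    using assms neg deriv_cut[of T "Neg \<chi>" \<Gamma> Falsum] by (auto simp: cons_def Neg_def)
  show ?thesis
  proof (cases "\<exists>\<tau> \<phi>. \<chi> = (\<^bold>\<forall>\<^bsub>\<tau>\<^esub> \<phi>)")
    case False
    then show ?thesis using c1 by (intro exI[of _ "Neg \<chi> # \<Gamma>"]) auto
  next
    case all: True
    then obtain \<tau> \<phi> where \<chi>: "\<chi> = (\<^bold>\<forall>\<^bsub>\<tau>\<^esub> \<phi>)" by blast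
    obtain c where c: "\<forall>\<gamma>\<in>set (\<phi> # (Neg \<chi>) # \<Gamma>). bounded UNIV c \<gamma>" using ex_bounded_list by blast
    let ?\<phi> = "substf \<tau> 0 (Var \<tau> c) \<phi>"
    have wff: "wff ?\<phi>" using assms(2) by (simp add: \<chi>)
    have "\<not> deriv T ((?\<phi> \<^bold>\<longrightarrow> Falsum) # (Neg \<chi>) # \<Gamma>) Falsum"
    proof
      assume "deriv T ((?\<phi> \<^bold>\<longrightarrow> Falsum) # (Neg \<chi>) # \<Gamma>) Falsum"
      with wff have "deriv T ((Neg \<chi>) # \<Gamma>) ?\<phi>" by (rule deriv.RAA)
      then have "deriv T ((Neg \<chi>) # \<Gamma>) \<chi>" unfolding \<chi>
        using c c1 by (intro deriv_fresh) (auto simp: cons_def \<chi>)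
      moreover have "deriv T ((Neg \<chi>) # \<Gamma>) (\<chi> \<^bold>\<longrightarrow> Falsum)"
        by (rule deriv.Hyp) (simp add: Neg_def)
      ultimately have "deriv T ((Neg \<chi>) # \<Gamma>) Falsum" by (blast intro: deriv.ImpE)
      then show False using c1 by (simp add: cons_def)
    qed
    then have "cons T (Neg ?\<phi> # (Neg \<chi>) # \<Gamma>)" using c1 wff by (auto simp: cons_def Neg_def)
    then show ?thesis
      by (intro exI[of _ "Neg ?\<phi> # (Neg \<chi>) # \<Gamma>"]) (auto simp: \<chi>)
  qed
qed

text \<open>Lindenbaum construction along the enumeration of the formulas. All stages are finite
  lists, and a derivation uses finitely many assumptions, so an inconsistency of the union would
  show at some stage.\<close>

theorem completeness:
  assumes "wff \<phi>" "\<not> (T \<turnstile> \<phi>)"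
  shows "\<exists>H. mcs T H \<and> \<phi> \<notin> H"
proof -
  \<comment> \<open>Stage \<open>n\<close> has decided all well-formed formulas with code below
    \<open>n\<close>, including the witnesses for the rejected universal ones.\<close>
  define P where "P = (\<lambda>n \<Delta>. \<forall>\<chi>. wff \<chi> \<longrightarrow> to_nat \<chi> < n \<longrightarrow> (\<chi> \<in> set \<Delta> \<or> Neg \<chi> \<in> set \<Delta> \<and>
    (\<forall>\<tau> \<phi>. \<chi> = (\<^bold>\<forall>\<^bsub>\<tau>\<^esub> \<phi>) \<longrightarrow> (\<exists>c. Neg (substf \<tau> 0 (Var \<tau> c) \<phi>) \<in> set \<Delta>))))"
  have c0: "cons T [\<phi> \<^bold>\<longrightarrow> Falsum]"
    using assms by (auto simp: cons_def proves_def intro: deriv.RAA)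
  have "\<exists>f. \<forall>n. (cons T (f n) \<and> P n (f n) \<and> Neg \<phi> \<in> set (f n)) \<and> set (f n) \<subseteq> set (f (Suc n))"
  proof (rule dependent_nat_choice)
    show "\<exists>\<Delta>. cons T \<Delta> \<and> P 0 \<Delta> \<and> Neg \<phi> \<in> set \<Delta>"
      using c0 by (intro exI[of _ "[\<phi> \<^bold>\<longrightarrow> Falsum]"]) (simp add: P_def Neg_def)
    fix \<Gamma> n
    assume \<Gamma>: "cons T \<Gamma> \<and> P n \<Gamma> \<and> Neg \<phi> \<in> set \<Gamma>"
    show "\<exists>\<Delta>. (cons T \<Delta> \<and> P (Suc n) \<Delta> \<and> Neg \<phi> \<in> set \<Delta>) \<and> set \<Gamma> \<subseteq> set \<Delta>"
    proof (cases "\<exists>\<chi>. wff \<chi> \<and> to_nat \<chi> = n")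
      case True
      then obtain \<chi> where \<chi>: "wff \<chi>" "to_nat \<chi> = n" by blast
      obtain \<Delta> where \<Delta>: "cons T \<Delta>" "set \<Gamma> \<subseteq> set \<Delta>" "\<chi> \<in> set \<Delta> \<or> Neg \<chi> \<in> set \<Delta> \<and>
          (\<forall>\<tau> \<phi>. \<chi> = (\<^bold>\<forall>\<^bsub>\<tau>\<^esub> \<phi>) \<longrightarrow> (\<exists>c. Neg (substf \<tau> 0 (Var \<tau> c) \<phi>) \<in> set \<Delta>))"
        using cons_step[of T \<Gamma> \<chi>] \<Gamma> \<chi> by auto
      have "P (Suc n) \<Delta>"
        unfolding P_def
      proof (intro allI impI)
        fix \<xi> assume \<xi>: "wff \<xi>" "to_nat \<xi> < Suc n"
        show "\<xi> \<in> set \<Delta> \<or> Neg \<xi> \<in> set \<Delta> \<and>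
          (\<forall>\<tau> \<phi>. \<xi> = (\<^bold>\<forall>\<^bsub>\<tau>\<^esub> \<phi>) \<longrightarrow> (\<exists>c. Neg (substf \<tau> 0 (Var \<tau> c) \<phi>) \<in> set \<Delta>))"
        proof (cases "\<xi> = \<chi>")
          case False
          then have "to_nat \<xi> \<noteq> n" using \<chi> by auto
          then show ?thesis using \<Gamma> \<xi> \<Delta>(2) unfolding P_def
            by (metis (lifting) less_antisym subsetD)
        qed (use \<Delta> in auto)
      qed
      then show ?thesis using \<Delta> \<Gamma> by blast
    next
      case False
      then have "P (Suc n) \<Gamma>" using \<Gamma> unfolding P_def by (metis less_antisym)
      then show ?thesis using \<Gamma> by blast
    qed
  qed
  then obtain f where f: "\<And>n. cons T (f n)" "\<And>n. P n (f n)" "\<And>n. Neg \<phi> \<in> set (f n)"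
    "\<And>n. set (f n) \<subseteq> set (f (Suc n))" by auto
  have mono: "set (f n) \<subseteq> set (f m)" if "n \<le> m" for n m
    using that f(4) by (rule lift_Suc_mono_le[rotated])
  define H where "H = (\<Union>n. set (f n))"
  have fin: "\<exists>n. set \<Gamma> \<subseteq> set (f n)" if "set \<Gamma> \<subseteq> H" for \<Gamma>
    using that
  proof (induction \<Gamma>)
    case (Cons \<gamma> \<Gamma>)
    then obtain n m where "set \<Gamma> \<subseteq> set (f n)" "\<gamma> \<in> set (f m)" by (auto simp: H_def)
    then show ?case using mono[of n "max n m"] mono[of m "max n m"]
      by (intro exI[of _ "max n m"]) auto
  qed simp
  have consH: False if "set \<Gamma> \<subseteq> H" "deriv T \<Gamma> Falsum" for \<Gamma>
    using fin[OF that(1)] deriv_mono[OF that(2)] f(1) by (auto simp: cons_def)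
  have not_both: False if "\<psi> \<in> H" "Neg \<psi> \<in> H" for \<psi>
  proof (rule consH)
    show "set [\<psi>, Neg \<psi>] \<subseteq> H" using that by simp
    show "deriv T [\<psi>, Neg \<psi>] Falsum"
      by (rule deriv.ImpE[of _ _ \<psi>]; rule deriv.Hyp) (auto simp: Neg_def)
  qed
  have cpl: "\<chi> \<in> H \<or> Neg \<chi> \<in> H \<and>
      (\<forall>\<tau> \<phi>. \<chi> = (\<^bold>\<forall>\<^bsub>\<tau>\<^esub> \<phi>) \<longrightarrow> (\<exists>c. Neg (substf \<tau> 0 (Var \<tau> c) \<phi>) \<in> H))" if "wff \<chi>" for \<chi>
  proof -
    have "\<chi> \<in> set (f (Suc (to_nat \<chi>))) \<or> Neg \<chi> \<in> set (f (Suc (to_nat \<chi>))) \<and> (\<forall>\<tau> \<phi>. \<chi> = (\<^bold>\<forall>\<^bsub>\<tau>\<^esub> \<phi>) \<longrightarrow>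
        (\<exists>c. Neg (substf \<tau> 0 (Var \<tau> c) \<phi>) \<in> set (f (Suc (to_nat \<chi>)))))"
      using f(2)[of "Suc (to_nat \<chi>)"] that unfolding P_def by blast
    moreover have "set (f (Suc (to_nat \<chi>))) \<subseteq> H" by (auto simp: H_def)
    ultimately show ?thesis by (cases \<chi>) auto
  qed
  have closed: "\<psi> \<in> H" if "set \<Gamma> \<subseteq> H" "deriv T \<Gamma> \<psi>" "wff \<psi>" for \<Gamma> \<psi>
  proof (rule ccontr)
    assume "\<psi> \<notin> H"
    then have n: "Neg \<psi> \<in> H" using cpl that by blast
    have "deriv T (Neg \<psi> # \<Gamma>) \<psi>" using that(2) by (rule deriv_mono) auto
    moreover have "deriv T (Neg \<psi> # \<Gamma>) (\<psi> \<^bold>\<longrightarrow> Falsum)" by (rule deriv.Hyp) (simp add: Neg_def)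
    ultimately have "deriv T (Neg \<psi> # \<Gamma>) Falsum" by (blast intro: deriv.ImpE)
    then show False using consH[of "Neg \<psi> # \<Gamma>"] n that by simp
  qed
  have "Falsum \<notin> H"
    using consH[of "[Falsum]"] deriv.Hyp[of Falsum "[Falsum]" T] by auto
  moreover have "\<exists>c. substf \<tau> 0 (Var \<tau> c) \<psi> \<notin> H" if "wff \<psi>" "(\<^bold>\<forall>\<^bsub>\<tau>\<^esub> \<psi>) \<notin> H" for \<tau> \<psi>
    using cpl[of "\<^bold>\<forall>\<^bsub>\<tau>\<^esub> \<psi>"] that not_both by auto
  ultimately have "mcs T H" unfolding mcs_def using closed cpl by blast
  moreover have "\<phi> \<notin> H" using f(3)[of 0] not_both by (auto simp: H_def)
  ultimately show ?thesis by blast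
qed

section \<open>Truth in a maximal consistent set\<close>

lemma mcs_closed: "mcs T H \<Longrightarrow> T \<turnstile> \<phi> \<Longrightarrow> wff \<phi> \<Longrightarrow> \<phi> \<in> H"
  unfolding mcs_def proves_def by (metis empty_set empty_subsetI)

lemma mcs_Imp:
  assumes "mcs T H" "wff \<phi>" "wff \<psi>"
  shows "(\<phi> \<^bold>\<longrightarrow> \<psi>) \<in> H \<longleftrightarrow> (\<phi> \<in> H \<longrightarrow> \<psi> \<in> H)"
proof
  assume *: "(\<phi> \<^bold>\<longrightarrow> \<psi>) \<in> H"
  show "\<phi> \<in> H \<longrightarrow> \<psi> \<in> H"
  proof
    assume "\<phi> \<in> H"
    with * have "set [\<phi> \<^bold>\<longrightarrow> \<psi>, \<phi>] \<subseteq> H" by simp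
    moreover have "deriv T [\<phi> \<^bold>\<longrightarrow> \<psi>, \<phi>] \<psi>" by (rule deriv.ImpE[of _ _ \<phi>]; rule deriv.Hyp) auto
    ultimately show "\<psi> \<in> H" using assms unfolding mcs_def by blast
  qed
next
  assume *: "\<phi> \<in> H \<longrightarrow> \<psi> \<in> H"
  show "(\<phi> \<^bold>\<longrightarrow> \<psi>) \<in> H"
  proof (cases "\<phi> \<in> H")
    case True
    then have "set [\<psi>] \<subseteq> H" using * by simp
    moreover have "deriv T [\<psi>] (\<phi> \<^bold>\<longrightarrow> \<psi>)" using assms by (intro deriv.ImpI deriv.Hyp) auto
    moreover have "wff (\<phi> \<^bold>\<longrightarrow> \<psi>)" using assms by simp
    ultimately show ?thesis using assms(1) unfolding mcs_def by blast
  next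
    case False
    then have "set [Neg \<phi>] \<subseteq> H" using assms unfolding mcs_def by auto
    moreover have "deriv T [Neg \<phi>] (\<phi> \<^bold>\<longrightarrow> \<psi>)"
    proof (rule deriv.ImpI[OF assms(2)], rule deriv.RAA[OF assms(3)])
      show "deriv T [\<psi> \<^bold>\<longrightarrow> Falsum, \<phi>, Neg \<phi>] Falsum"
        by (rule deriv.ImpE[of _ _ \<phi>]; rule deriv.Hyp) (auto simp: Neg_def)
    qed
    moreover have "wff (\<phi> \<^bold>\<longrightarrow> \<psi>)" using assms by simp
    ultimately show ?thesis using assms(1) unfolding mcs_def by blast
  qed
qed

text \<open>\<open>AllE\<close> gives all term instances; conversely, the Henkin clause of
  \<open>mcs\<close> inspects only instances with variables, which are among them.\<close>

lemma mcs_All: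
  assumes "mcs T H" "wff \<phi>"
  shows "(\<^bold>\<forall>\<^bsub>\<tau>\<^esub> \<phi>) \<in> H \<longleftrightarrow> (\<forall>t. wt t \<longrightarrow> tyof t = \<tau> \<longrightarrow> substf \<tau> 0 t \<phi> \<in> H)"
proof
  assume *: "(\<^bold>\<forall>\<^bsub>\<tau>\<^esub> \<phi>) \<in> H"
  show "\<forall>t. wt t \<longrightarrow> tyof t = \<tau> \<longrightarrow> substf \<tau> 0 t \<phi> \<in> H"
  proof (intro allI impI)
    fix t assume t: "wt t" "tyof t = \<tau>"
    then have "deriv T [\<^bold>\<forall>\<^bsub>\<tau>\<^esub> \<phi>] (substf \<tau> 0 t \<phi>)" by (intro deriv.AllE deriv.Hyp) auto
    moreover have "wff (substf \<tau> 0 t \<phi>)" "set [\<^bold>\<forall>\<^bsub>\<tau>\<^esub> \<phi>] \<subseteq> H" using * assms t by auto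
    ultimately show "substf \<tau> 0 t \<phi> \<in> H" using assms(1) unfolding mcs_def by blast
  qed
next
  assume *: "\<forall>t. wt t \<longrightarrow> tyof t = \<tau> \<longrightarrow> substf \<tau> 0 t \<phi> \<in> H"
  then have "\<forall>c. substf \<tau> 0 (Var \<tau> c) \<phi> \<in> H" by simp
  then show "(\<^bold>\<forall>\<^bsub>\<tau>\<^esub> \<phi>) \<in> H" using assms unfolding mcs_def by blast
qed

definition sat :: "fm set \<Rightarrow> (ty \<Rightarrow> nat \<Rightarrow> tm) \<Rightarrow> fm \<Rightarrow> bool" where
  "sat H e \<phi> \<longleftrightarrow> fsub e \<phi> \<in> H"

lemma wff_connectives [simp]:
  "wff (Neg \<phi>) = wff \<phi>"
  "wff (\<phi> \<^bold>\<and> \<psi>) = (wff \<phi> \<and> wff \<psi>)"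
  "wff (\<phi> \<^bold>\<longleftrightarrow> \<psi>) = (wff \<phi> \<and> wff \<psi>)"
  "wff (\<^bold>\<exists>\<^bsub>\<tau>\<^esub> \<phi>) = wff \<phi>"
  by (auto simp: Neg_def Conj_def Iff_def Ex_def)

lemma sat_simps [simp]:
  assumes "mcs T H" "wenv e"
  shows "\<not> sat H e Falsum"
    "wff \<phi> \<Longrightarrow> wff \<psi> \<Longrightarrow> sat H e (\<phi> \<^bold>\<longrightarrow> \<psi>) \<longleftrightarrow> (sat H e \<phi> \<longrightarrow> sat H e \<psi>)"
    "wff \<phi> \<Longrightarrow> sat H e (Neg \<phi>) \<longleftrightarrow> \<not> sat H e \<phi>"
    "wff \<phi> \<Longrightarrow> wff \<psi> \<Longrightarrow> sat H e (\<phi> \<^bold>\<and> \<psi>) \<longleftrightarrow> (sat H e \<phi> \<and> sat H e \<psi>)"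
    "wff \<phi> \<Longrightarrow> wff \<psi> \<Longrightarrow> sat H e (\<phi> \<^bold>\<longleftrightarrow> \<psi>) \<longleftrightarrow> (sat H e \<phi> \<longleftrightarrow> sat H e \<psi>)"
proof -
  have "Falsum \<notin> H" using assms(1) by (simp add: mcs_def)
  then show "\<not> sat H e Falsum"
    "wff \<phi> \<Longrightarrow> wff \<psi> \<Longrightarrow> sat H e (\<phi> \<^bold>\<longrightarrow> \<psi>) \<longleftrightarrow> (sat H e \<phi> \<longrightarrow> sat H e \<psi>)"
    "wff \<phi> \<Longrightarrow> sat H e (Neg \<phi>) \<longleftrightarrow> \<not> sat H e \<phi>"
    "wff \<phi> \<Longrightarrow> wff \<psi> \<Longrightarrow> sat H e (\<phi> \<^bold>\<and> \<psi>) \<longleftrightarrow> (sat H e \<phi> \<and> sat H e \<psi>)"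
    "wff \<phi> \<Longrightarrow> wff \<psi> \<Longrightarrow> sat H e (\<phi> \<^bold>\<longleftrightarrow> \<psi>) \<longleftrightarrow> (sat H e \<phi> \<longleftrightarrow> sat H e \<psi>)"
    using assms(2) by (auto simp: sat_def mcs_Imp[OF assms(1)] Neg_def Conj_def Iff_def)
qed

lemma sat_All:
  assumes "mcs T H" "wenv e" "wff \<phi>"
  shows "sat H e (\<^bold>\<forall>\<^bsub>\<tau>\<^esub> \<phi>) \<longleftrightarrow> (\<forall>t. wt t \<longrightarrow> tyof t = \<tau> \<longrightarrow> sat H (push \<tau> t e) \<phi>)"
  using assms by (simp add: sat_def mcs_All substf_fsub_ups)

lemma sat_Ex:
  assumes "mcs T H" "wenv e" "wff \<phi>"
  shows "sat H e (\<^bold>\<exists>\<^bsub>\<tau>\<^esub> \<phi>) \<longleftrightarrow> (\<exists>t. wt t \<and> tyof t = \<tau> \<and> sat H (push \<tau> t e) \<phi>)"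
proof -
  have "wenv (push \<tau> t e)" if "wt t" "tyof t = \<tau>" for t using assms that by simp
  then show ?thesis using assms by (auto simp: Ex_def sat_All cong: conj_cong imp_cong)
qed

text \<open>The free variables of a theorem can be generalized, so it holds in every environment and
  not only under \<open>Var\<close>. Since an environment is infinite, it is replaced by finitely
  many uses of \<open>push\<close> that agree with it on the variables of the formula.\<close>

lemma sat_theorem:
  assumes "mcs T H" "wenv e" "T \<turnstile> \<phi>" "wff \<phi>"
  shows "sat H e \<phi>"
proof -
  let ?f = "\<lambda>L e. foldr (\<lambda>(\<tau>, t). push \<tau> t) L e"
  have wf: "wenv (?f L Var)" if "\<forall>(\<tau>, t)\<in>set L. wt t \<and> tyof t = \<tau>" for L
    using that by (induction L) auto
  have *: "sat H (?f L Var) \<psi>"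
    if "\<forall>(\<tau>, t)\<in>set L. wt t \<and> tyof t = \<tau>" "T \<turnstile> \<psi>" "wff \<psi>" for L \<psi>
    using that
  proof (induction L arbitrary: \<psi>)
    case Nil
    then show ?case using mcs_closed[OF assms(1)] by (simp add: sat_def)
  next
    case (Cons p L)
    obtain \<tau> t where p: "p = (\<tau>, t)" by fastforce
    have "T \<turnstile> (\<^bold>\<forall>\<^bsub>\<tau>\<^esub> \<psi>)" using Cons.prems by (auto simp: proves_def intro: deriv.AllI)
    then have "sat H (?f L Var) (\<^bold>\<forall>\<^bsub>\<tau>\<^esub> \<psi>)" using Cons by auto
    then show ?case using Cons.prems sat_All[OF assms(1)] wf[of L] by (auto simp: p)
  qed
  obtain S n where S: "finite S" "bounded S n \<phi>" using ex_bounded by blast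
  \<comment> \<open>Pushing a block of values of one type puts them at its first indices and moves
    the former ones up, so blocks for different types do not disturb each other.\<close>
  have blk: "?f (map (\<lambda>i. (\<sigma>, e \<sigma> i)) [0..<m]) e' =
      (\<lambda>\<tau> i. if \<tau> = \<sigma> then if i < m then e \<sigma> i else e' \<sigma> (i - m) else e' \<tau> i)" for m \<sigma> e'
  proof (induction m arbitrary: e')
    case 0
    show ?case by (intro ext) simp
  next
    case (Suc m)
    show ?case by (simp add: Suc) (intro ext, auto simp: push_def less_Suc_eq Suc_diff_Suc split: nat.split,
      metis Suc_diff_Suc diff_Suc_1 linorder_neqE_nat)
  qed
  have "\<exists>L. (\<forall>(\<tau>, t)\<in>set L. wt t \<and> tyof t = \<tau>) \<and> (\<forall>\<sigma>\<in>S. \<forall>i<n. ?f L Var \<sigma> i = e \<sigma> i)"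
    using S(1)
  proof (induction S)
    case (insert \<sigma> S)
    then obtain L where L: "\<forall>(\<tau>, t)\<in>set L. wt t \<and> tyof t = \<tau>" "\<forall>\<sigma>\<in>S. \<forall>i<n. ?f L Var \<sigma> i = e \<sigma> i"
      by blast
    then show ?case using assms(2)
      by (intro exI[of _ "map (\<lambda>i. (\<sigma>, e \<sigma> i)) [0..<n] @ L"]) (auto simp: wenv_def blk)
  qed (intro exI[of _ "[]"], simp)
  then obtain L where L: "\<forall>(\<tau>, t)\<in>set L. wt t \<and> tyof t = \<tau>" "\<forall>\<sigma>\<in>S. \<forall>i<n. ?f L Var \<sigma> i = e \<sigma> i"
    by blast
  have "fsub (?f L Var) \<phi> = fsub e \<phi>" using L(2) by (intro boundedD[OF S(2)]) auto
  then show ?thesis using *[OF L(1) assms(3,4)] by (simp add: sat_def)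
qed


section \<open>The term model\<close>

text \<open>The first formula has a trivially true property, so it lets \<open>NIN\<close> exclude
  every injection into the rationals and thereby settles one direction of all items. The second is
  the common source for (1) and (2), whose properties both follow from \<open>funR\<close> with
  \<open>bounded_variation\<close>.\<close>

definition claims :: "fm set" where
  "claims = {NIN \<^bold>\<longrightarrow> no_injection (Falsum \<^bold>\<longrightarrow> Falsum),
     no_injection (funR \<^bold>\<and> bounded_variation) \<^bold>\<longrightarrow> NIN,
     NIN_Riemann \<^bold>\<longrightarrow> NIN,
     IND0 \<^bold>\<longrightarrow> NIN_Borel \<^bold>\<longrightarrow> NIN,
     IND0 \<^bold>\<longrightarrow> NIN_cliq \<^bold>\<longrightarrow> NIN,
     IND0 \<^bold>\<longrightarrow> NIN_semi \<^bold>\<longrightarrow> NIN,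
     IND0 \<^bold>\<longrightarrow> NIN_semi' \<^bold>\<longrightarrow> NIN}"

text \<open>A fixed counterexample, so that its objects can be made into types. Everything below
  holds for it under the assumption \<open>good\<close>, in the locale \<open>model\<close>; in particular the claims do,
  so that there is no counterexample.\<close>

definition H0 :: "fm set" where
  "H0 = (SOME H. mcs ACA0\<omega> H \<and> \<not> claims \<subseteq> H)"

definition good :: bool where
  "good \<longleftrightarrow> mcs ACA0\<omega> H0"

text \<open>Extensional equality as in \<open>eqt\<close>, but with a metatheoretic quantifier over
  terms at each function type; \<open>Sat_eqt0\<close> shows that the two agree.\<close>

primrec eqv :: "ty \<Rightarrow> tm \<Rightarrow> tm \<Rightarrow> bool" where
  "eqv T0 s t \<longleftrightarrow> Eq s t \<in> H0"
| "eqv (\<rho> \<rightarrow> \<tau>) s t \<longleftrightarrow> (\<forall>u. wt u \<longrightarrow> tyof u = \<rho> \<longrightarrow> eqv \<tau> (s \<cdot> u) (t \<cdot> u))"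

text \<open>A chosen representative of the class of extensionally equal terms, so that equality of
  objects is equality in HOL. Without \<open>good\<close> it is the identity, which keeps
  \<open>dom\<close> inhabited by variables outside the locale.\<close>

definition nf :: "tm \<Rightarrow> tm" where
  "nf t = (if good \<and> wt t then SOME u. wt u \<and> tyof u = tyof t \<and> eqv (tyof t) u t else t)"

definition dom :: "ty \<Rightarrow> tm set" where
  "dom \<tau> = {t. wt t \<and> tyof t = \<tau> \<and> nf t = t}"

definition ap :: "tm \<Rightarrow> tm \<Rightarrow> tm" where
  "ap s t = nf (s \<cdot> t)"

definition val :: "(ty \<Rightarrow> nat \<Rightarrow> tm) \<Rightarrow> tm \<Rightarrow> tm" where
  "val e t = nf (tsub e t)"

definition Sat :: "(ty \<Rightarrow> nat \<Rightarrow> tm) \<Rightarrow> fm \<Rightarrow> bool" where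
  "Sat e \<phi> \<longleftrightarrow> sat H0 e \<phi>"

definition denv :: "(ty \<Rightarrow> nat \<Rightarrow> tm) \<Rightarrow> bool" where
  "denv e \<longleftrightarrow> (\<forall>\<tau> i. e \<tau> i \<in> dom \<tau>)"

definition e0 :: "ty \<Rightarrow> nat \<Rightarrow> tm" where
  "e0 \<tau> i = nf (Var \<tau> i)"

lemma denv_wenv: "denv e \<Longrightarrow> wenv e"
  by (simp add: denv_def wenv_def dom_def)

lemma denv_push [simp]: "denv e \<Longrightarrow> x \<in> dom \<tau> \<Longrightarrow> denv (push \<tau> x e)"
  by (auto simp: denv_def push_def split: nat.split)

lemma tsub_push_lift [simp]: "tsub (push \<rho> u e) (lift \<rho> 0 t) = tsub e t"
proof -
  have "(\<lambda>\<sigma> i. tsub (push \<rho> u e) (shift \<rho> 0 \<sigma> i)) = e"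
    by (intro ext) (auto simp: shift_def push_def)
  then show ?thesis by (simp add: lift_tsub tsub_tsub)
qed

lemma val_push_lift [simp]: "val (push \<rho> u e) (lift \<rho> 0 t) = val e t"
  by (simp add: val_def)

lemma wff_eqt [simp]: "wt s \<Longrightarrow> wt t \<Longrightarrow> tyof s = \<tau> \<Longrightarrow> tyof t = \<tau> \<Longrightarrow> wff (eqt \<tau> s t)"
  by (induction \<tau> arbitrary: s t) auto

lemma wt_tyof_lam [simp]: "wt t \<Longrightarrow> wt (lam \<sigma> t) \<and> tyof (lam \<sigma> t) = (\<sigma> \<rightarrow> tyof t)"
  by (induction t) auto

section \<open>The quotient of the terms by extensional equality\<close>

locale model =
  assumes good: good
begin

lemma mcs0: "mcs ACA0\<omega> H0"
  using good by (simp add: good_def)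

lemma Sat_simps [simp]:
  assumes "wenv e"
  shows "\<not> Sat e Falsum"
    "wff \<phi> \<Longrightarrow> wff \<psi> \<Longrightarrow> Sat e (\<phi> \<^bold>\<longrightarrow> \<psi>) \<longleftrightarrow> (Sat e \<phi> \<longrightarrow> Sat e \<psi>)"
    "wff \<phi> \<Longrightarrow> Sat e (Neg \<phi>) \<longleftrightarrow> \<not> Sat e \<phi>"
    "wff \<phi> \<Longrightarrow> wff \<psi> \<Longrightarrow> Sat e (\<phi> \<^bold>\<and> \<psi>) \<longleftrightarrow> (Sat e \<phi> \<and> Sat e \<psi>)"
    "wff \<phi> \<Longrightarrow> wff \<psi> \<Longrightarrow> Sat e (\<phi> \<^bold>\<longleftrightarrow> \<psi>) \<longleftrightarrow> (Sat e \<phi> \<longleftrightarrow> Sat e \<psi>)"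
  using assms by (simp_all add: Sat_def sat_simps[OF mcs0])

lemma Sat_axiom: "\<phi> \<in> ACA0\<omega> \<Longrightarrow> wenv e \<Longrightarrow> wff \<phi> \<Longrightarrow> Sat e \<phi>"
  unfolding Sat_def by (intro sat_theorem[OF mcs0]) (auto simp: proves_def intro: deriv.Ax)

lemma Sat_rca: "\<phi> \<in> RCA0\<omega> \<Longrightarrow> wenv e \<Longrightarrow> wff \<phi> \<Longrightarrow> Sat e \<phi>"
  by (rule Sat_axiom) (auto simp: ACA0\<omega>_def)

lemma Sat_Eq: "Sat e (Eq s t) \<longleftrightarrow> eqv T0 (tsub e s) (tsub e t)"
  by (simp add: Sat_def sat_def)

lemma Sat_All0:
  "wenv e \<Longrightarrow> wff \<phi> \<Longrightarrow> Sat e (\<^bold>\<forall>\<^bsub>\<tau>\<^esub> \<phi>) \<longleftrightarrow> (\<forall>t. wt t \<longrightarrow> tyof t = \<tau> \<longrightarrow> Sat (push \<tau> t e) \<phi>)"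
  by (simp add: Sat_def sat_All[OF mcs0])

lemma Sat_eqt0:
  "wenv e \<Longrightarrow> wt s \<Longrightarrow> wt t \<Longrightarrow> tyof s = \<tau> \<Longrightarrow> tyof t = \<tau> \<Longrightarrow>
   Sat e (eqt \<tau> s t) \<longleftrightarrow> eqv \<tau> (tsub e s) (tsub e t)"
  by (induction \<tau> arbitrary: e s t) (simp_all add: Sat_Eq Sat_All0)

lemma eqv_T0_refl: "wt t \<Longrightarrow> tyof t = T0 \<Longrightarrow> eqv T0 t t"
  using Sat_rca[OF RCA0\<omega>.Eq_refl, of "push T0 t Var"] by (simp add: Sat_Eq)

lemma eqv_T0_sym:
  "wt s \<Longrightarrow> tyof s = T0 \<Longrightarrow> wt t \<Longrightarrow> tyof t = T0 \<Longrightarrow> eqv T0 s t \<Longrightarrow> eqv T0 t s"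
  using Sat_rca[OF RCA0\<omega>.Eq_sym, of "push T0 s (push T0 t Var)"] by (simp add: Sat_Eq)

lemma eqv_T0_trans:
  "wt s \<Longrightarrow> tyof s = T0 \<Longrightarrow> wt t \<Longrightarrow> tyof t = T0 \<Longrightarrow> wt u \<Longrightarrow> tyof u = T0 \<Longrightarrow>
   eqv T0 s t \<Longrightarrow> eqv T0 t u \<Longrightarrow> eqv T0 s u"
  using Sat_rca[OF RCA0\<omega>.Eq_trans, of "push T0 s (push T0 t (push T0 u Var))"]
  by (simp add: Sat_Eq)

lemma eqv_refl: "wt t \<Longrightarrow> tyof t = \<tau> \<Longrightarrow> eqv \<tau> t t"
  by (induction \<tau> arbitrary: t) (simp_all add: eqv_T0_refl del: eqv.simps(1))

lemma eqv_sym: "wt s \<Longrightarrow> tyof s = \<tau> \<Longrightarrow> wt t \<Longrightarrow> tyof t = \<tau> \<Longrightarrow> eqv \<tau> s t \<Longrightarrow> eqv \<tau> t s"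
proof (induction \<tau> arbitrary: s t)
  case T0
  then show ?case using eqv_T0_sym by blast
qed simp

lemma eqv_trans:
  "wt s \<Longrightarrow> tyof s = \<tau> \<Longrightarrow> wt t \<Longrightarrow> tyof t = \<tau> \<Longrightarrow> wt u \<Longrightarrow> tyof u = \<tau> \<Longrightarrow>
   eqv \<tau> s t \<Longrightarrow> eqv \<tau> t u \<Longrightarrow> eqv \<tau> s u"
proof (induction \<tau> arbitrary: s t u)
  case T0
  then show ?case using eqv_T0_trans by blast
next
  case (Fun \<rho> \<tau>)
  show ?case
    unfolding eqv.simps
  proof (intro allI impI)
    fix v assume "wt v" "tyof v = \<rho>"
    then show "eqv \<tau> (s \<cdot> v) (u \<cdot> v)"
      using Fun.prems by (auto intro!: Fun.IH(2)[of "s \<cdot> v" "t \<cdot> v" "u \<cdot> v"])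
  qed
qed

text \<open>A change of the function is harmless by the definition of \<open>eqv\<close>; a change
  of the argument is the axiom \<open>Ext\<close>.\<close>

lemma eqv_app:
  assumes "wt f" "tyof f = (\<rho> \<rightarrow> \<tau>)" "wt g" "tyof g = (\<rho> \<rightarrow> \<tau>)"
    "wt s" "tyof s = \<rho>" "wt t" "tyof t = \<rho>" "eqv (\<rho> \<rightarrow> \<tau>) f g" "eqv \<rho> s t"
  shows "eqv \<tau> (f \<cdot> s) (g \<cdot> t)"
proof -
  define e where "e = (\<lambda>\<sigma> i. if \<sigma> = (\<rho> \<rightarrow> \<tau>) \<and> i = 0 then g else if \<sigma> = \<rho> \<and> i = 1 then s
    else if \<sigma> = \<rho> \<and> i = 2 then t else Var \<sigma> i)"
  \<comment> \<open>No type contains itself properly, so the values assigned to the function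
    variable and to the two argument variables do not clash.\<close>
  have "(\<rho> \<rightarrow> \<tau>) \<noteq> \<rho>" by (induction \<rho> arbitrary: \<tau>) auto
  then have e: "e (\<rho> \<rightarrow> \<tau>) 0 = g" "e \<rho> 1 = s" "e \<rho> 2 = t" "wenv e"
    using assms by (auto simp: e_def wenv_def)
  have "Sat e (eqt \<rho> (Var \<rho> 1) (Var \<rho> 2) \<^bold>\<longrightarrow>
     eqt \<tau> (Var (\<rho> \<rightarrow> \<tau>) 0 \<cdot> Var \<rho> 1) (Var (\<rho> \<rightarrow> \<tau>) 0 \<cdot> Var \<rho> 2))"
    using e by (intro Sat_rca[OF RCA0\<omega>.Ext]) auto
  then have "eqv \<tau> (g \<cdot> s) (g \<cdot> t)" using e assms by (simp add: Sat_eqt0 del: One_nat_def)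
  moreover have "eqv \<tau> (f \<cdot> s) (g \<cdot> s)" using assms by simp
  ultimately show ?thesis using assms eqv_trans[of "f \<cdot> s" \<tau> "g \<cdot> s" "g \<cdot> t"] by simp
qed

lemma nf_props:
  assumes "wt t"
  shows "wt (nf t)" "tyof (nf t) = tyof t" "eqv (tyof t) (nf t) t"
proof -
  have "\<exists>u. wt u \<and> tyof u = tyof t \<and> eqv (tyof t) u t" using assms eqv_refl by blast
  from someI_ex[OF this] show "wt (nf t)" "tyof (nf t) = tyof t" "eqv (tyof t) (nf t) t"
    using assms good by (simp_all add: nf_def)
qed

lemma nf_eq_iff:
  assumes "wt s" "wt t" "tyof s = tyof t"
  shows "nf s = nf t \<longleftrightarrow> eqv (tyof t) s t"
proof
  assume "nf s = nf t"
  then show "eqv (tyof t) s t"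
    using nf_props[of s] nf_props[of t] assms
    by (metis eqv_sym eqv_trans)
next
  assume *: "eqv (tyof t) s t"
  have "(\<lambda>u. wt u \<and> tyof u = tyof s \<and> eqv (tyof s) u s) = (\<lambda>u. wt u \<and> tyof u = tyof t \<and> eqv (tyof t) u t)"
    using * assms by (intro ext) (metis eqv_sym eqv_trans)
  then show "nf s = nf t" using assms good by (simp add: nf_def)
qed

lemma nf_nf [simp]: "wt t \<Longrightarrow> nf (nf t) = nf t"
  by (simp add: nf_eq_iff nf_props)

lemma nf_dom [simp]: "wt t \<Longrightarrow> tyof t = \<tau> \<Longrightarrow> nf t \<in> dom \<tau>"
  by (simp add: dom_def nf_props)

lemma denv_e0 [simp]: "denv e0"
  by (simp add: denv_def e0_def)

lemma eqv_tsub: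
  assumes "wenv e" "wenv e'" "\<And>\<sigma> i. eqv \<sigma> (e \<sigma> i) (e' \<sigma> i)" "wt t"
  shows "eqv (tyof t) (tsub e t) (tsub e' t)"
  using assms(4)
proof (induction t)
  case (App s t)
  then show ?case using assms(1,2)
    by (auto intro: eqv_app simp del: eqv.simps(2))
qed (use assms in \<open>auto intro: eqv_refl simp del: eqv.simps\<close>)

lemma eqv_push:
  "(\<And>\<sigma> i. eqv \<sigma> (e \<sigma> i) (e' \<sigma> i)) \<Longrightarrow> eqv \<tau> s t \<Longrightarrow> eqv \<sigma> (push \<tau> s e \<sigma> i) (push \<tau> t e' \<sigma> i)"
  by (auto simp: push_def simp del: eqv.simps split: nat.split)

lemma Sat_eqv:
  "wenv e \<Longrightarrow> wenv e' \<Longrightarrow> (\<And>\<sigma> i. eqv \<sigma> (e \<sigma> i) (e' \<sigma> i)) \<Longrightarrow> wff \<phi> \<Longrightarrow> Sat e \<phi> \<longleftrightarrow> Sat e' \<phi>"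
proof (induction \<phi> arbitrary: e e')
  case (Eq s t)
  then have "eqv T0 (tsub e s) (tsub e' s)" "eqv T0 (tsub e t) (tsub e' t)"
    using eqv_tsub[of e e' s] eqv_tsub[of e e' t] by auto
  moreover have "wt (tsub e s)" "wt (tsub e t)" "wt (tsub e' s)" "wt (tsub e' t)"
    "tyof (tsub e s) = T0" "tyof (tsub e t) = T0" "tyof (tsub e' s) = T0" "tyof (tsub e' t) = T0"
    using Eq by auto
  ultimately show ?case unfolding Sat_Eq using eqv_T0_sym eqv_T0_trans by meson
next
  case (All \<tau> \<phi>)
  have "Sat (push \<tau> t e) \<phi> \<longleftrightarrow> Sat (push \<tau> t e') \<phi>" if "wt t" "tyof t = \<tau>" for t
    using All.prems that by (intro All.IH) (auto intro!: wenv_push eqv_push eqv_refl)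
  then show ?case using All.prems by (simp add: Sat_All0)
qed auto

lemma Sat_nf:
  assumes "wenv e" "wff \<phi>"
  shows "Sat (\<lambda>\<sigma> i. nf (e \<sigma> i)) \<phi> \<longleftrightarrow> Sat e \<phi>"
  using assms nf_props unfolding wenv_def by (intro Sat_eqv) (auto simp: wenv_def, metis)

text \<open>Every term is extensionally equal to its normal form, and truth respects this equality;
  hence quantifiers may range over normal forms alone.\<close>

lemma Sat_All:
  assumes "denv e" "wff \<phi>"
  shows "Sat e (\<^bold>\<forall>\<^bsub>\<tau>\<^esub> \<phi>) \<longleftrightarrow> (\<forall>x\<in>dom \<tau>. Sat (push \<tau> x e) \<phi>)"
proof -
  have "Sat (push \<tau> t e) \<phi> \<longleftrightarrow> Sat (push \<tau> (nf t) e) \<phi>" if "wt t" "tyof t = \<tau>" for t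
    using that assms nf_props[of t]
    by (intro Sat_eqv) (auto simp: denv_wenv push_def intro: eqv_refl eqv_sym
      dest!: denv_wenv simp: wenv_def split: nat.split)
  then have "(\<forall>t. wt t \<longrightarrow> tyof t = \<tau> \<longrightarrow> Sat (push \<tau> t e) \<phi>) \<longleftrightarrow> (\<forall>x\<in>dom \<tau>. Sat (push \<tau> x e) \<phi>)"
    by (metis (mono_tags, lifting) dom_def mem_Collect_eq nf_dom)
  then show ?thesis using assms by (simp add: Sat_All0 denv_wenv)
qed

lemma denv_simps [simp]:
  assumes "denv e"
  shows "\<not> Sat e Falsum"
    "wff \<phi> \<Longrightarrow> wff \<psi> \<Longrightarrow> Sat e (\<phi> \<^bold>\<longrightarrow> \<psi>) \<longleftrightarrow> (Sat e \<phi> \<longrightarrow> Sat e \<psi>)"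
    "wff \<phi> \<Longrightarrow> Sat e (Neg \<phi>) \<longleftrightarrow> \<not> Sat e \<phi>"
    "wff \<phi> \<Longrightarrow> wff \<psi> \<Longrightarrow> Sat e (\<phi> \<^bold>\<and> \<psi>) \<longleftrightarrow> (Sat e \<phi> \<and> Sat e \<psi>)"
    "wff \<phi> \<Longrightarrow> wff \<psi> \<Longrightarrow> Sat e (\<phi> \<^bold>\<longleftrightarrow> \<psi>) \<longleftrightarrow> (Sat e \<phi> \<longleftrightarrow> Sat e \<psi>)"
  using assms by (simp_all add: denv_wenv)

lemma Sat_eqt:
  assumes "denv e" "wt s" "wt t" "tyof s = \<tau>" "tyof t = \<tau>"
  shows "Sat e (eqt \<tau> s t) \<longleftrightarrow> val e s = val e t"
  using assms by (simp add: Sat_eqt0 denv_wenv val_def nf_eq_iff)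

lemma Sat_Eq_val [simp]:
  assumes "denv e" "wt s" "wt t" "tyof s = T0" "tyof t = T0"
  shows "Sat e (Eq s t) \<longleftrightarrow> val e s = val e t"
  using Sat_eqt[of e s t T0] assms by simp

lemma val_Var [simp]: "denv e \<Longrightarrow> val e (Var \<tau> i) = e \<tau> i"
  by (simp add: val_def denv_def dom_def)

lemma val_App [simp]:
  assumes "denv e" "wt (s \<cdot> t)"
  shows "val e (s \<cdot> t) = ap (val e s) (val e t)"
proof -
  let ?s = "tsub e s" and ?t = "tsub e t"
  obtain \<rho> \<tau> where w: "wt ?s" "wt ?t" "tyof ?s = (\<rho> \<rightarrow> \<tau>)" "tyof ?t = \<rho>"
    using assms denv_wenv[OF assms(1)] by (cases "tyof s") auto
  note n = nf_props[OF w(1), unfolded w] nf_props[OF w(2), unfolded w]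
  have "eqv (\<rho> \<rightarrow> \<tau>) ?s (nf ?s)" "eqv \<rho> ?t (nf ?t)"
    by (rule eqv_sym[OF n(1,2) w(1,3) n(3)], rule eqv_sym[OF n(4,5) w(2,4) n(6)])
  with w n have "eqv \<tau> (?s \<cdot> ?t) (nf ?s \<cdot> nf ?t)"
    by (intro eqv_app[of _ \<rho> \<tau>])
  then have "nf (?s \<cdot> ?t) = nf (nf ?s \<cdot> nf ?t)" using w n by (subst nf_eq_iff) simp_all
  then show ?thesis by (simp add: val_def ap_def)
qed

lemma val_dom [simp]: "denv e \<Longrightarrow> wt t \<Longrightarrow> tyof t = \<tau> \<Longrightarrow> val e t \<in> dom \<tau>"
  by (simp add: val_def denv_wenv)

lemma ap_dom: "f \<in> dom (\<rho> \<rightarrow> \<tau>) \<Longrightarrow> x \<in> dom \<rho> \<Longrightarrow> ap f x \<in> dom \<tau>"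
  unfolding ap_def by (rule nf_dom) (auto simp: dom_def)

text \<open>Agreement on normal forms extends to all arguments by \<open>eqv_app\<close>, and
  extensionally equal normal forms coincide.\<close>

lemma dom_ext:
  assumes "f \<in> dom (\<rho> \<rightarrow> \<tau>)" "g \<in> dom (\<rho> \<rightarrow> \<tau>)" "\<And>x. x \<in> dom \<rho> \<Longrightarrow> ap f x = ap g x"
  shows "f = g"
proof -
  have w: "wt f" "wt g" "tyof f = (\<rho> \<rightarrow> \<tau>)" "tyof g = (\<rho> \<rightarrow> \<tau>)" using assms by (auto simp: dom_def)
  have "eqv \<tau> (f \<cdot> u) (g \<cdot> u)" if u: "wt u" "tyof u = \<rho>" for u
  proof -
    have n: "wt (nf u)" "tyof (nf u) = \<rho>" "eqv \<rho> (nf u) u" "eqv \<rho> u (nf u)"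
      using u nf_props[of u] eqv_sym[of "nf u" \<rho> u] by simp_all
    have "nf (f \<cdot> nf u) = nf (g \<cdot> nf u)" using assms(3)[of "nf u"] u by (simp add: ap_def)
    then have "eqv \<tau> (f \<cdot> nf u) (g \<cdot> nf u)" using w n by (simp add: nf_eq_iff)
    moreover have "eqv \<tau> (f \<cdot> u) (f \<cdot> nf u)" "eqv \<tau> (g \<cdot> nf u) (g \<cdot> u)"
      using w n u eqv_refl[OF w(1,3)] eqv_refl[OF w(2,4)] by (blast intro: eqv_app)+
    ultimately show ?thesis using w n u eqv_trans[of "f \<cdot> u" \<tau> "f \<cdot> nf u" "g \<cdot> u"]
        eqv_trans[of "f \<cdot> nf u" \<tau> "g \<cdot> nf u" "g \<cdot> u"] by simp
  qed
  then have "nf f = nf g" using w by (simp add: nf_eq_iff)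
  then show ?thesis using assms by (simp add: dom_def)
qed

lemma val_Proj:
  assumes "x \<in> dom \<rho>" "y \<in> dom \<tau>" "denv e"
  shows "ap (ap (val e (Proj \<rho> \<tau>)) x) y = x"
proof -
  define e' where "e' = (\<lambda>\<sigma> i. if \<sigma> = \<rho> \<and> i = 0 then x else if \<sigma> = \<tau> \<and> i = 1 then y else e0 \<sigma> i)"
  have e: "denv e'" "e' \<rho> 0 = x" "e' \<tau> 1 = y"
    using assms denv_e0 by (auto simp: e'_def denv_def simp del: denv_e0)
  have "Sat e' (eqt \<rho> (Proj \<rho> \<tau> \<cdot> Var \<rho> 0 \<cdot> Var \<tau> 1) (Var \<rho> 0))"
    using e by (intro Sat_rca[OF RCA0\<omega>.Proj]) (auto simp: denv_wenv)
  then show ?thesis using e assms by (simp add: Sat_eqt del: One_nat_def) (simp add: val_def)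
qed

lemma val_Comb:
  assumes "f \<in> dom (\<delta> \<rightarrow> \<rho> \<rightarrow> \<tau>)" "g \<in> dom (\<delta> \<rightarrow> \<rho>)" "x \<in> dom \<delta>" "denv e"
  shows "ap (ap (ap (val e (Comb \<delta> \<rho> \<tau>)) f) g) x = ap (ap f x) (ap g x)"
proof -
  define e' where "e' = (\<lambda>\<sigma> i. if \<sigma> = (\<delta> \<rightarrow> \<rho> \<rightarrow> \<tau>) \<and> i = 0 then f else
    if \<sigma> = (\<delta> \<rightarrow> \<rho>) \<and> i = 1 then g else if \<sigma> = \<delta> \<and> i = 2 then x else e0 \<sigma> i)"
  have e: "denv e'" "e' (\<delta> \<rightarrow> \<rho> \<rightarrow> \<tau>) 0 = f" "e' (\<delta> \<rightarrow> \<rho>) 1 = g" "e' \<delta> 2 = x"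
    using assms denv_e0 by (auto simp: e'_def denv_def simp del: denv_e0)
  have "Sat e' (eqt \<tau>
     (Comb \<delta> \<rho> \<tau> \<cdot> Var (\<delta> \<rightarrow> \<rho> \<rightarrow> \<tau>) 0 \<cdot> Var (\<delta> \<rightarrow> \<rho>) 1 \<cdot> Var \<delta> 2)
     (Var (\<delta> \<rightarrow> \<rho> \<rightarrow> \<tau>) 0 \<cdot> Var \<delta> 2 \<cdot> (Var (\<delta> \<rightarrow> \<rho>) 1 \<cdot> Var \<delta> 2)))"
    using e by (intro Sat_rca[OF RCA0\<omega>.Comb]) (auto simp: denv_wenv)
  then show ?thesis using e assms by (simp add: Sat_eqt del: One_nat_def) (simp add: val_def)
qed

text \<open>Beta reduction for bracket abstraction, by induction on the body: \<open>Proj\<close>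
  discards the argument, \<open>Comb\<close> distributes it over an application, and the identity is
  the combination S K K.\<close>

lemma val_lam:
  assumes "denv e" "x \<in> dom \<sigma>" "wt t"
  shows "ap (val e (lam \<sigma> t)) x = val (push \<sigma> x e) t"
proof -
  have K: "ap (val e (Proj (tyof c) \<sigma> \<cdot> c)) x = val e c" if "wt c" for c
    using that assms by (simp add: val_Proj)
  show ?thesis
    using assms(3)
  proof (induction t)
    case (Var \<tau> i)
    show ?case
    proof (cases "\<tau> = \<sigma> \<and> i = 0")
      case True
      have I: "val e (Proj \<sigma> (\<sigma> \<rightarrow> \<sigma>)) \<in> dom (\<sigma> \<rightarrow> (\<sigma> \<rightarrow> \<sigma>) \<rightarrow> \<sigma>)" "val e (Proj \<sigma> \<sigma>) \<in> dom (\<sigma> \<rightarrow> \<sigma> \<rightarrow> \<sigma>)"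
        using assms by auto
      show ?thesis using True assms I
        by (simp add: val_Comb val_Proj ap_dom[of _ \<sigma> "\<sigma> \<rightarrow> \<sigma>"])
    next
      case False
      have "val (push \<sigma> x e) (Var \<tau> i) = val e (Var \<tau> (if \<tau> = \<sigma> then i - 1 else i))"
        unfolding val_Var[OF denv_push[OF assms(1,2)]] val_Var[OF assms(1)]
        using False by (auto simp: push_def split: nat.split)
      then show ?thesis using False K[of "Var \<tau> (if \<tau> = \<sigma> then i - 1 else i)"] by auto
    qed
  next
    case (App s t)
    have w: "wt (lam \<sigma> s)" "wt (lam \<sigma> t)" "tyof (lam \<sigma> s) = (\<sigma> \<rightarrow> tyof s)" "tyof (lam \<sigma> t) = (\<sigma> \<rightarrow> tyof t)"
      using App.prems by auto
    obtain \<tau> where \<tau>: "tyof s = (tyof t \<rightarrow> \<tau>)" using App.prems by (cases "tyof s") auto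
    have "ap (ap (ap (val e (Comb \<sigma> (tyof t) (cod (tyof s)))) (val e (lam \<sigma> s))) (val e (lam \<sigma> t))) x =
      ap (ap (val e (lam \<sigma> s)) x) (ap (val e (lam \<sigma> t)) x)"
      using w \<tau> assms by (intro val_Comb) auto
    then show ?case using App.IH App.prems assms w \<tau> by auto
  qed (use K[of Zero] K[of Succ] K[of "Proj _ _"] K[of "Comb _ _ _"] K[of Rec] in
      \<open>simp_all add: val_def del: val_App\<close>)
qed

end


section \<open>Typed objects of the model\<close>

lemma Var_dom: "\<not> good \<Longrightarrow> wt t \<Longrightarrow> tyof t = \<tau> \<Longrightarrow> t \<in> dom \<tau>"
  by (simp add: dom_def nf_def)

lemma dom_nonempty: "\<exists>x. x \<in> dom \<tau>"
proof (cases good)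
  case True
  then interpret model by unfold_locales
  have "nf (Var \<tau> 0) \<in> dom \<tau>" by simp
  then show ?thesis by blast
next
  case False
  then have "Var \<tau> 0 \<in> dom \<tau>" by (intro Var_dom) auto
  then show ?thesis by blast
qed

text \<open>A HOL type that copies the objects of one finite type. As a class it allows
  \<open>fn\<close> to be formed over any two such types, hence for all finite types at
  once.\<close>

class obj =
  fixes ty_of :: "'a itself \<Rightarrow> ty" and rep :: "'a \<Rightarrow> tm"
  assumes rep_inject [simp]: "rep x = rep y \<longleftrightarrow> x = y"
    and range_rep: "range rep = dom (ty_of TYPE('a))"

definition un :: "tm \<Rightarrow> 'a::obj" where
  "un t = (SOME x. rep x = t)"

lemma un_rep [simp]: "un (rep x) = x"
  by (simp add: un_def)

lemma rep_un: "t \<in> dom (ty_of TYPE('a)) \<Longrightarrow> rep (un t :: 'a::obj) = t"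
  using range_rep[where 'a = 'a] unfolding un_def by (metis (mono_tags, lifting) imageE someI)

lemma rep_dom [simp]: "ty_of TYPE('a) = \<tau> \<Longrightarrow> rep (x :: 'a::obj) \<in> dom \<tau>"
  using range_rep by blast

typedef nn = "dom T0"
  using dom_nonempty .

instantiation nn :: obj
begin
definition ty_of_nn :: "nn itself \<Rightarrow> ty" where [simp]: "ty_of_nn _ = T0"
definition rep_nn :: "nn \<Rightarrow> tm" where "rep_nn = Rep_nn"
instance
  by standard (auto simp: rep_nn_def Rep_nn_inject type_definition.Rep_range[OF type_definition_nn])
end

typedef (overloaded) ('a, 'b) fn = "dom (ty_of TYPE('a::obj) \<rightarrow> ty_of TYPE('b::obj))"
  using dom_nonempty .

instantiation fn :: (obj, obj) obj
begin
definition ty_of_fn :: "('a, 'b) fn itself \<Rightarrow> ty" where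
  [simp]: "ty_of_fn _ = (ty_of TYPE('a) \<rightarrow> ty_of TYPE('b))"
definition rep_fn :: "('a, 'b) fn \<Rightarrow> tm" where "rep_fn = Rep_fn"
instance
  by standard (auto simp: rep_fn_def Rep_fn_inject type_definition.Rep_range[OF type_definition_fn])
end

type_synonym N1 = "(nn, nn) fn"
type_synonym N2 = "(N1, nn) fn"

definition app :: "('a::obj, 'b::obj) fn \<Rightarrow> 'a \<Rightarrow> 'b" (infixl \<open>\<bullet>\<close> 100) where
  "f \<bullet> x = un (ap (rep f) (rep x))"

text \<open>Meaningful only if some object of the model has the values of \<open>F\<close>;
  \<open>dfn_LAM0\<close> supplies it for definable \<open>F\<close>.\<close>

definition LAM :: "('a::obj \<Rightarrow> 'b::obj) \<Rightarrow> ('a, 'b) fn" where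
  "LAM F = (SOME f. \<forall>x. f \<bullet> x = F x)"

definition tc :: "tm \<Rightarrow> 'a::obj" where
  "tc t = un (val e0 t)"

text \<open>\<open>vb B t\<close>: the indices of the variables of type \<open>\<tau>\<close> in \<open>t\<close> are below \<open>B \<tau>\<close>.\<close>

primrec vb :: "(ty \<Rightarrow> nat) \<Rightarrow> tm \<Rightarrow> bool" where
  "vb B (Var \<tau> i) \<longleftrightarrow> i < B \<tau>"
| "vb B Zero \<longleftrightarrow> True"
| "vb B Succ \<longleftrightarrow> True"
| "vb B (Proj \<rho> \<tau>) \<longleftrightarrow> True"
| "vb B (Comb \<delta> \<rho> \<tau>) \<longleftrightarrow> True"
| "vb B Rec \<longleftrightarrow> True"
| "vb B (s \<cdot> t) \<longleftrightarrow> vb B s \<and> vb B t"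

lemma vb_lam [simp]: "vb B (lam \<sigma> t) \<longleftrightarrow> vb (B(\<sigma> := Suc (B \<sigma>))) t"
  by (induction t) auto

lemma tsub_closed: "vb (\<lambda>_. 0) t \<Longrightarrow> tsub e t = t"
  by (induction t) auto

lemma val_closed: "vb (\<lambda>_. 0) t \<Longrightarrow> val e t = val e' t"
  by (simp add: val_def tsub_closed)

lemma wt_defs [simp]:
  "wt add" "wt pred" "wt monus" "wt mult" "wt pow2" "wt isqrt" "wt pair" "wt left" "wt right"
  "tyof add = (T0 \<rightarrow> T0 \<rightarrow> T0)" "tyof pred = T1" "tyof monus = (T0 \<rightarrow> T0 \<rightarrow> T0)"
  "tyof mult = (T0 \<rightarrow> T0 \<rightarrow> T0)" "tyof pow2 = T1" "tyof isqrt = T1" "tyof pair = (T0 \<rightarrow> T0 \<rightarrow> T0)"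
  "tyof left = T1" "tyof right = T1"
proof -
  show a [simp]: "wt add" "tyof add = (T0 \<rightarrow> T0 \<rightarrow> T0)" by (simp_all add: add_def)
  show b [simp]: "wt pred" "tyof pred = T1" by (simp_all add: pred_def)
  show c [simp]: "wt monus" "tyof monus = (T0 \<rightarrow> T0 \<rightarrow> T0)" by (simp_all add: monus_def)
  show d [simp]: "wt mult" "tyof mult = (T0 \<rightarrow> T0 \<rightarrow> T0)" by (simp_all add: mult_def)
  show "wt pow2" "tyof pow2 = T1" by (simp_all add: pow2_def)
  show e [simp]: "wt isqrt" "tyof isqrt = T1" by (simp_all add: isqrt_def)
  show "wt pair" "tyof pair = (T0 \<rightarrow> T0 \<rightarrow> T0)" by (simp_all add: pair_def)
  show f [simp]: "wt left" "tyof left = T1" by (simp_all add: left_def)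
  show "wt right" "tyof right = T1" by (simp_all add: right_def)
qed

lemma wt_defs_q [simp]:
  "wt qadd" "wt qsub" "wt qmul" "wt qabs" "wt qnat" "wt qeps"
  "tyof qadd = (T0 \<rightarrow> T0 \<rightarrow> T0)" "tyof qsub = (T0 \<rightarrow> T0 \<rightarrow> T0)" "tyof qmul = (T0 \<rightarrow> T0 \<rightarrow> T0)"
  "tyof qabs = T1" "tyof qnat = T1" "tyof qeps = T1"
proof -
  show a [simp]: "wt qadd" "tyof qadd = (T0 \<rightarrow> T0 \<rightarrow> T0)" by (simp_all add: qadd_def)
  show "wt qsub" "tyof qsub = (T0 \<rightarrow> T0 \<rightarrow> T0)" by (simp_all add: qsub_def)
  show "wt qmul" "tyof qmul = (T0 \<rightarrow> T0 \<rightarrow> T0)" by (simp_all add: qmul_def)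
  show "wt qabs" "tyof qabs = T1" by (simp_all add: qabs_def)
  show "wt qnat" "tyof qnat = T1" by (simp_all add: qnat_def)
  show "wt qeps" "tyof qeps = T1" by (simp_all add: qeps_def)
qed

lemma wt_defs_r [simp]:
  "wt radd" "wt rsub" "wt rabs" "wt rmul" "wt rsum"
  "tyof radd = (T1 \<rightarrow> T1 \<rightarrow> T1)" "tyof rsub = (T1 \<rightarrow> T1 \<rightarrow> T1)" "tyof rabs = (T1 \<rightarrow> T1)"
  "tyof rmul = (T1 \<rightarrow> T1 \<rightarrow> T1)" "tyof rsum = ((T0 \<rightarrow> T1) \<rightarrow> T0 \<rightarrow> T1)"
  by (simp_all add: radd_def rsub_def rabs_def rmul_def rsum_def Let_def)

lemma vb_defs [simp]:
  "vb B add" "vb B pred" "vb B monus" "vb B mult" "vb B pow2" "vb B isqrt" "vb B pair" "vb B left"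
  "vb B right" "vb B qadd" "vb B qsub" "vb B qmul" "vb B qabs" "vb B qnat" "vb B qeps" "vb B radd"
  "vb B rsub" "vb B rabs" "vb B rmul" "vb B rsum"
proof -
  show a [simp]: "vb B add" for B by (simp add: add_def)
  show b [simp]: "vb B pred" for B by (simp add: pred_def)
  show c [simp]: "vb B monus" for B by (simp add: monus_def)
  show d [simp]: "vb B mult" for B by (simp add: mult_def)
  show e [simp]: "vb B pow2" for B by (simp add: pow2_def)
  show f [simp]: "vb B isqrt" for B by (simp add: isqrt_def)
  show g [simp]: "vb B pair" for B by (simp add: pair_def)
  show h [simp]: "vb B left" for B by (simp add: left_def)
  show i [simp]: "vb B right" for B by (simp add: right_def)
  show j [simp]: "vb B qadd" for B by (simp add: qadd_def)
  show k [simp]: "vb B qsub" for B by (simp add: qsub_def)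
  show l [simp]: "vb B qmul" for B by (simp add: qmul_def)
  show m [simp]: "vb B qabs" for B by (simp add: qabs_def)
  show n [simp]: "vb B qnat" for B by (simp add: qnat_def)
  show o [simp]: "vb B qeps" for B by (simp add: qeps_def)
  show "vb B radd" "vb B rsub" "vb B rabs" "vb B rmul" "vb B rsum"
    by (simp_all add: radd_def rsub_def rabs_def rmul_def rsum_def Let_def)
qed

text \<open>A context is an iterated product \<open>unit \<times> 'a\<^sub>1 \<times> \<dots> \<times> 'a\<^sub>n\<close> of types of objects; \<open>dfnc\<close>
  describes the functions on it that are given by an object of the model.\<close>

class ctx =
  fixes dfnc :: "('a \<Rightarrow> tm) \<Rightarrow> ty \<Rightarrow> bool"
  assumes dfnc_const: "good \<Longrightarrow> x \<in> dom \<tau> \<Longrightarrow> dfnc (\<lambda>_. x) \<tau>"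
    and dfnc_app: "good \<Longrightarrow> dfnc F (\<sigma> \<rightarrow> \<tau>) \<Longrightarrow> dfnc G \<sigma> \<Longrightarrow> dfnc (\<lambda>p. ap (F p) (G p)) \<tau>"
    and dfnc_dom: "good \<Longrightarrow> dfnc F \<tau> \<Longrightarrow> F p \<in> dom \<tau>"

instantiation unit :: ctx
begin
definition dfnc_unit :: "(unit \<Rightarrow> tm) \<Rightarrow> ty \<Rightarrow> bool" where "dfnc_unit F \<tau> \<longleftrightarrow> F () \<in> dom \<tau>"
instance
proof
  fix F G :: "unit \<Rightarrow> tm" and \<sigma> \<tau>
  assume "good"
  then interpret model by unfold_locales
  assume "dfnc F (\<sigma> \<rightarrow> \<tau>)" "dfnc G \<sigma>"
  then show "dfnc (\<lambda>p. ap (F p) (G p)) \<tau>" by (auto simp: dfnc_unit_def intro: ap_dom)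
qed (auto simp: dfnc_unit_def)
end

instantiation prod :: (ctx, obj) ctx
begin
text \<open>Currying the last variable: for each value of the context there has to be an object that
  takes the last component to the value of \<open>F\<close>. Closure under application is then the
  combinator \<open>Comb\<close>, and constants come from \<open>Proj\<close>.\<close>

definition dfnc_prod :: "('a \<times> 'b \<Rightarrow> tm) \<Rightarrow> ty \<Rightarrow> bool" where
  "dfnc_prod F \<tau> \<longleftrightarrow> (\<exists>G. dfnc G (ty_of TYPE('b) \<rightarrow> \<tau>) \<and> (\<forall>p. F p = ap (G (fst p)) (rep (snd p))))"
instance
proof
  assume "good"
  then interpret model by unfold_locales
  let ?b = "ty_of TYPE('b)"
  show "dfnc (\<lambda>_::'a \<times> 'b. x) \<tau>" if "x \<in> dom \<tau>" for x \<tau>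
  proof -
    have "ap (val e0 (Proj \<tau> ?b)) x \<in> dom (?b \<rightarrow> \<tau>)"
      using that by (intro ap_dom[of _ \<tau>]) auto
    then have "dfnc (\<lambda>_::'a. ap (val e0 (Proj \<tau> ?b)) x) (?b \<rightarrow> \<tau>)"
      using dfnc_const[OF good] by blast
    moreover have "x = ap (ap (val e0 (Proj \<tau> ?b)) x) (rep y)" for y :: 'b
      using that by (simp add: val_Proj)
    ultimately show ?thesis unfolding dfnc_prod_def
      by (intro exI[of _ "\<lambda>_. ap (val e0 (Proj \<tau> ?b)) x"]) auto
  qed
  show d: "F p \<in> dom \<tau>" if f: "dfnc F \<tau>" for F :: "'a \<times> 'b \<Rightarrow> tm" and p \<tau>
  proof -
    obtain G where G: "dfnc G (?b \<rightarrow> \<tau>)" "F p = ap (G (fst p)) (rep (snd p))"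
      using f unfolding dfnc_prod_def by blast
    show ?thesis unfolding G(2) by (rule ap_dom[OF dfnc_dom[OF good G(1)]]) simp
  qed
  show "dfnc (\<lambda>p. ap (F p) (G p)) \<tau>" if fg: "dfnc F (\<sigma> \<rightarrow> \<tau>)" "dfnc G \<sigma>" for F G :: "'a \<times> 'b \<Rightarrow> tm" and \<sigma> \<tau>
  proof -
    let ?S = "val e0 (Comb ?b \<sigma> \<tau>)"
    obtain F' where F': "dfnc F' (?b \<rightarrow> \<sigma> \<rightarrow> \<tau>)" "\<forall>p. F p = ap (F' (fst p)) (rep (snd p))"
      using fg unfolding dfnc_prod_def by blast
    obtain G' where G': "dfnc G' (?b \<rightarrow> \<sigma>)" "\<forall>p. G p = ap (G' (fst p)) (rep (snd p))"
      using fg unfolding dfnc_prod_def by blast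
    have "dfnc (\<lambda>p. ap (ap ?S (F' p)) (G' p)) (?b \<rightarrow> \<tau>)"
      using F' G' by (intro dfnc_app[OF good, of _ "?b \<rightarrow> \<sigma>"] dfnc_app[OF good, of _ "?b \<rightarrow> \<sigma> \<rightarrow> \<tau>"]
        dfnc_const[OF good]) auto
    moreover have "ap (F p) (G p) = ap (ap (ap ?S (F' (fst p))) (G' (fst p))) (rep (snd p))" for p
      using F'(2) G'(2) dfnc_dom[OF good F'(1)] dfnc_dom[OF good G'(1)] by (cases p) (simp add: val_Comb)
    ultimately show ?thesis unfolding dfnc_prod_def by blast
  qed
qed
end

definition dfn :: "('c::ctx \<Rightarrow> 'a::obj) \<Rightarrow> bool" where
  "dfn F \<longleftrightarrow> dfnc (\<lambda>p. rep (F p)) (ty_of TYPE('a))"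

named_theorems dfns

context model
begin

lemma rep_app [simp]: "ap (rep f) (rep x) = rep (f \<bullet> x)"
  for f :: "('a::obj, 'b::obj) fn"
  unfolding app_def by (rule rep_un[symmetric]) (rule ap_dom[of _ "ty_of TYPE('a)"], auto)

lemma fn_ext: "(\<And>x. f \<bullet> x = g \<bullet> x) \<Longrightarrow> f = g"
  for f :: "('a::obj, 'b::obj) fn"
proof -
  assume *: "\<And>x. f \<bullet> x = g \<bullet> x"
  have "rep f = rep g"
  proof (rule dom_ext[of _ "ty_of TYPE('a)" "ty_of TYPE('b)"])
    fix t assume "t \<in> dom (ty_of TYPE('a))"
    then have "t = rep (un t :: 'a)" by (simp add: rep_un)
    then show "ap (rep f) t = ap (rep g) t" using * rep_app by metis
  qed auto
  then show ?thesis by simp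
qed

lemma Sat_All_obj:
  assumes "denv e" "wff \<phi>" "ty_of TYPE('a::obj) = \<tau>"
  shows "Sat e (\<^bold>\<forall>\<^bsub>\<tau>\<^esub> \<phi>) \<longleftrightarrow> (\<forall>x::'a. Sat (push \<tau> (rep x) e) \<phi>)"
  unfolding Sat_All[OF assms(1,2)] assms(3)[symmetric] range_rep[where 'a = 'a, symmetric] by simp

lemma Sat_Ex_obj:
  assumes "denv e" "wff \<phi>" "ty_of TYPE('a::obj) = \<tau>"
  shows "Sat e (\<^bold>\<exists>\<^bsub>\<tau>\<^esub> \<phi>) \<longleftrightarrow> (\<exists>x::'a. Sat (push \<tau> (rep x) e) \<phi>)"
  using assms by (simp add: Ex_def Sat_All_obj[where 'a = 'a])

lemma Sat_quant [simp]:
  assumes "denv e" "wff \<phi>"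
  shows
    "Sat e (\<^bold>\<forall>\<^bsub>T0\<^esub> \<phi>) \<longleftrightarrow> (\<forall>x::nn. Sat (push T0 (rep x) e) \<phi>)"
    "Sat e (\<^bold>\<forall>\<^bsub>T1\<^esub> \<phi>) \<longleftrightarrow> (\<forall>x::N1. Sat (push T1 (rep x) e) \<phi>)"
    "Sat e (\<^bold>\<forall>\<^bsub>T2\<^esub> \<phi>) \<longleftrightarrow> (\<forall>x::N2. Sat (push T2 (rep x) e) \<phi>)"
    "Sat e (\<^bold>\<forall>\<^bsub>T3\<^esub> \<phi>) \<longleftrightarrow> (\<forall>x::(N2, nn) fn. Sat (push T3 (rep x) e) \<phi>)"
    "Sat e (\<^bold>\<forall>\<^bsub>T0 \<rightarrow> T1\<^esub> \<phi>) \<longleftrightarrow> (\<forall>x::(nn, N1) fn. Sat (push (T0 \<rightarrow> T1) (rep x) e) \<phi>)"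
    "Sat e (\<^bold>\<forall>\<^bsub>T1 \<rightarrow> T1\<^esub> \<phi>) \<longleftrightarrow> (\<forall>x::(N1, N1) fn. Sat (push (T1 \<rightarrow> T1) (rep x) e) \<phi>)"
    "Sat e (\<^bold>\<forall>\<^bsub>T0 \<rightarrow> T2\<^esub> \<phi>) \<longleftrightarrow> (\<forall>x::(nn, N2) fn. Sat (push (T0 \<rightarrow> T2) (rep x) e) \<phi>)"
    "Sat e (\<^bold>\<forall>\<^bsub>T1 \<rightarrow> T0 \<rightarrow> T0\<^esub> \<phi>) \<longleftrightarrow> (\<forall>x::(N1, N1) fn. Sat (push (T1 \<rightarrow> T0 \<rightarrow> T0) (rep x) e) \<phi>)"
    "Sat e (\<^bold>\<exists>\<^bsub>T0\<^esub> \<phi>) \<longleftrightarrow> (\<exists>x::nn. Sat (push T0 (rep x) e) \<phi>)"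
    "Sat e (\<^bold>\<exists>\<^bsub>T1\<^esub> \<phi>) \<longleftrightarrow> (\<exists>x::N1. Sat (push T1 (rep x) e) \<phi>)"
    "Sat e (\<^bold>\<exists>\<^bsub>T2\<^esub> \<phi>) \<longleftrightarrow> (\<exists>x::N2. Sat (push T2 (rep x) e) \<phi>)"
    "Sat e (\<^bold>\<exists>\<^bsub>T0 \<rightarrow> T1\<^esub> \<phi>) \<longleftrightarrow> (\<exists>x::(nn, N1) fn. Sat (push (T0 \<rightarrow> T1) (rep x) e) \<phi>)"
    "Sat e (\<^bold>\<exists>\<^bsub>T1 \<rightarrow> T1\<^esub> \<phi>) \<longleftrightarrow> (\<exists>x::(N1, N1) fn. Sat (push (T1 \<rightarrow> T1) (rep x) e) \<phi>)"
  using assms by (auto simp: Sat_All_obj[where 'a = nn] Sat_All_obj[where 'a = N1] Sat_All_obj[where 'a = N2]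
      Sat_All_obj[where 'a = "(N2, nn) fn"] Sat_All_obj[where 'a = "(nn, N1) fn"]
      Sat_All_obj[where 'a = "(N1, N1) fn"] Sat_All_obj[where 'a = "(nn, N2) fn"]
      Sat_Ex_obj[where 'a = nn] Sat_Ex_obj[where 'a = N1] Sat_Ex_obj[where 'a = N2]
      Sat_Ex_obj[where 'a = "(nn, N1) fn"] Sat_Ex_obj[where 'a = "(N1, N1) fn"])

lemma rep_tc:
  assumes "wt t" "tyof t = ty_of TYPE('a)"
  shows "rep (tc t :: 'a::obj) = val e0 t"
  unfolding tc_def using assms by (intro rep_un) simp

lemma val_tc:
  assumes "vb (\<lambda>_. 0) t" "wt t" "tyof t = ty_of TYPE('a)"
  shows "val e t = rep (tc t :: 'a::obj)"
  using assms by (simp add: rep_tc val_closed[of t e e0])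

lemma rep_tc_lam:
  assumes "wt t" "ty_of TYPE('a::obj) = \<sigma>" "tyof t = ty_of TYPE('b::obj)"
  shows "rep ((tc (lam \<sigma> t) :: ('a, 'b) fn) \<bullet> x) = val (push \<sigma> (rep x) e0) t"
  using assms by (subst rep_app[symmetric], subst rep_tc) (auto simp: val_lam)

lemma rep_tc_lam2:
  assumes "wt t" "ty_of TYPE('a::obj) = \<sigma>" "ty_of TYPE('b::obj) = \<tau>" "tyof t = ty_of TYPE('c::obj)"
  shows "rep ((tc (lam \<sigma> (lam \<tau> t)) :: ('a, ('b, 'c) fn) fn) \<bullet> x \<bullet> y)
    = val (push \<tau> (rep y) (push \<sigma> (rep x) e0)) t"
  using assms by (subst rep_app[symmetric], subst rep_tc_lam) (auto simp: val_lam)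

lemma rep_tc_lam3:
  assumes "wt t" "ty_of TYPE('a::obj) = \<sigma>" "ty_of TYPE('b::obj) = \<tau>" "ty_of TYPE('d::obj) = \<rho>"
    "tyof t = ty_of TYPE('c::obj)"
  shows "rep ((tc (lam \<sigma> (lam \<tau> (lam \<rho> t))) :: ('a, ('b, ('d, 'c) fn) fn) fn) \<bullet> x \<bullet> y \<bullet> z)
    = val (push \<rho> (rep z) (push \<tau> (rep y) (push \<sigma> (rep x) e0))) t"
  using assms by (subst rep_app[symmetric], subst rep_tc_lam2) (auto simp: val_lam)

lemma lam_obj:
  assumes "denv e" "wt t" "ty_of TYPE('a::obj) = \<sigma>" "tyof t = ty_of TYPE('b::obj)"
  shows "\<exists>h::('a, 'b) fn. val e (lam \<sigma> t) = rep h \<and> (\<forall>u. rep (h \<bullet> u) = val (push \<sigma> (rep u) e) t)"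
proof (intro exI conjI allI)
  let ?h = "un (val e (lam \<sigma> t)) :: ('a, 'b) fn"
  show h: "val e (lam \<sigma> t) = rep ?h"
    using assms by (intro rep_un[symmetric]) auto
  show "rep (?h \<bullet> u) = val (push \<sigma> (rep u) e) t" for u
    using assms by (subst rep_app[symmetric], subst h[symmetric]) (simp add: val_lam)
qed

lemma lam_obj2:
  assumes "denv e" "wt t" "ty_of TYPE('a::obj) = \<sigma>" "ty_of TYPE('b::obj) = \<tau>" "tyof t = ty_of TYPE('c::obj)"
  shows "\<exists>h::('a, ('b, 'c) fn) fn. val e (lam \<sigma> (lam \<tau> t)) = rep h \<and>
    (\<forall>u m. rep (h \<bullet> u \<bullet> m) = val (push \<tau> (rep m) (push \<sigma> (rep u) e)) t)"
proof -
  obtain h :: "('a, ('b, 'c) fn) fn" where h: "val e (lam \<sigma> (lam \<tau> t)) = rep h"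
    "\<forall>u. rep (h \<bullet> u) = val (push \<sigma> (rep u) e) (lam \<tau> t)"
    using lam_obj[of e "lam \<tau> t" \<sigma>, where 'a = 'a and 'b = "('b, 'c) fn"] assms by auto
  have "rep (h \<bullet> u \<bullet> m) = val (push \<tau> (rep m) (push \<sigma> (rep u) e)) t" for u m
    using h assms by (subst rep_app[symmetric]) (simp add: val_lam)
  then show ?thesis using h by blast
qed

lemma val_const [simp]:
  "val e Zero = rep (tc Zero :: nn)"
  "val e Succ = rep (tc Succ :: N1)"
  "val e Rec = rep (tc Rec :: (nn, (nn, ((nn, N1) fn, nn) fn) fn) fn)"
  "val e (Proj T0 T0) = rep (tc (Proj T0 T0) :: (nn, N1) fn)"
  "val e add = rep (tc add :: (nn, N1) fn)"
  "val e pred = rep (tc pred :: N1)"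
  "val e monus = rep (tc monus :: (nn, N1) fn)"
  "val e mult = rep (tc mult :: (nn, N1) fn)"
  "val e pow2 = rep (tc pow2 :: N1)"
  "val e isqrt = rep (tc isqrt :: N1)"
  "val e pair = rep (tc pair :: (nn, N1) fn)"
  "val e left = rep (tc left :: N1)"
  "val e right = rep (tc right :: N1)"
  "val e qadd = rep (tc qadd :: (nn, N1) fn)"
  "val e qsub = rep (tc qsub :: (nn, N1) fn)"
  "val e qmul = rep (tc qmul :: (nn, N1) fn)"
  "val e qabs = rep (tc qabs :: N1)"
  "val e qnat = rep (tc qnat :: N1)"
  "val e qeps = rep (tc qeps :: N1)"
  "val e radd = rep (tc radd :: (N1, (N1, N1) fn) fn)"
  "val e rsub = rep (tc rsub :: (N1, (N1, N1) fn) fn)"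
  "val e rabs = rep (tc rabs :: (N1, N1) fn)"
  "val e rmul = rep (tc rmul :: (N1, (N1, N1) fn) fn)"
  "val e rsum = rep (tc rsum :: ((nn, N1) fn, (nn, N1) fn) fn)"
  by (rule val_tc; simp)+

lemma dfn_const [dfns]: "dfn (\<lambda>_. c)"
  unfolding dfn_def by (intro dfnc_const good) auto

lemma dfn_app [dfns]: "dfn F \<Longrightarrow> dfn G \<Longrightarrow> dfn (\<lambda>p. F p \<bullet> G p)"
  for F :: "'c::ctx \<Rightarrow> ('a::obj, 'b::obj) fn"
  unfolding dfn_def rep_app[symmetric]
  by (rule dfnc_app[OF good, where \<sigma> = "ty_of TYPE('a)"]) auto

lemma dfn_snd [dfns]: "dfn (snd :: 'c::ctx \<times> 'a::obj \<Rightarrow> 'a)" "dfn (\<lambda>p :: 'c::ctx \<times> 'a::obj. snd p)"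
proof -
  let ?I = "val e0 (lam (ty_of TYPE('a)) (Var (ty_of TYPE('a)) 0))"
  have "dfnc (\<lambda>_::'c. ?I) (ty_of TYPE('a) \<rightarrow> ty_of TYPE('a))" 
    by (intro dfnc_const good val_dom) (auto simp del: lam.simps)
  moreover have "ap ?I (rep x) = rep x" for x :: 'a by (subst val_lam) auto
  ultimately show *: "dfn (\<lambda>p :: 'c::ctx \<times> 'a::obj. snd p)" unfolding dfn_def dfnc_prod_def by fastforce
  then show "dfn (snd :: 'c::ctx \<times> 'a::obj \<Rightarrow> 'a)" by simp
qed

lemma dfn_fst:
  assumes "dfn (F :: 'c::ctx \<Rightarrow> 'b::obj)"
  shows "dfn (\<lambda>p :: 'c \<times> 'a::obj. F (fst p))"
proof -
  let ?K = "val e0 (Proj (ty_of TYPE('b)) (ty_of TYPE('a)))"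
  have "dfnc (\<lambda>c. ap ?K (rep (F c))) (ty_of TYPE('a) \<rightarrow> ty_of TYPE('b))"
    using assms unfolding dfn_def
    by (intro dfnc_app[OF good, of _ "ty_of TYPE('b)"] dfnc_const good) auto
  moreover have "ap (ap ?K (rep x)) (rep y) = rep x" for x :: 'b and y :: 'a by (simp add: val_Proj)
  ultimately show ?thesis unfolding dfn_def dfnc_prod_def by fastforce
qed

lemmas dfn_vars [dfns] = dfn_fst[OF dfn_snd(2)] dfn_fst[OF dfn_fst[OF dfn_snd(2)]]
  dfn_fst[OF dfn_fst[OF dfn_fst[OF dfn_snd(2)]]]
  dfn_fst[OF dfn_fst[OF dfn_fst[OF dfn_fst[OF dfn_snd(2)]]]]
  dfn_fst[OF dfn_fst[OF dfn_fst[OF dfn_fst[OF dfn_fst[OF dfn_snd(2)]]]]]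

text \<open>Definability on a product already provides, definably in \<open>c\<close>, an object
  that maps the last component to the value; \<open>LAM\<close> can only be this object, by
  extensionality.\<close>

lemma dfn_LAM0:
  assumes "dfn (\<lambda>p :: 'c::ctx \<times> 'a::obj. F (fst p) (snd p) :: 'b::obj)"
  shows "dfn (\<lambda>c. LAM (F c)) \<and> (\<forall>c x. LAM (F c) \<bullet> x = F c x)"
proof -
  obtain G where G: "dfnc G (ty_of TYPE('a) \<rightarrow> ty_of TYPE('b))"
    "\<And>c x. rep (F c x) = ap (G c) (rep x)"
    using assms unfolding dfn_def dfnc_prod_def by fastforce
  have G2: "rep (un (G c) :: ('a, 'b) fn) = G c" for c
    using dfnc_dom[OF good G(1)] by (intro rep_un) auto
  have *: "(un (G c) :: ('a, 'b) fn) \<bullet> x = F c x" for c x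
    using G(2)[of c x] G2[of c] rep_app[of "un (G c) :: ('a, 'b) fn" x] by simp
  have "\<forall>x. LAM (F c) \<bullet> x = F c x" for c
    unfolding LAM_def by (rule someI[of _ "un (G c)"]) (simp add: *)
  moreover from this have "LAM (F c) = un (G c)" for c by (intro fn_ext) (simp add: *)
  then have "dfn (\<lambda>c. LAM (F c))" unfolding dfn_def using G(1) G2 by simp
  ultimately show ?thesis by blast
qed

lemma dfn_LAM [dfns]:
  "dfn (\<lambda>p :: 'c::ctx \<times> 'a::obj. F (fst p) (snd p) :: 'b::obj) \<Longrightarrow> dfn (\<lambda>c. LAM (F c))"
  using dfn_LAM0 by blast

lemma LAM_app:
  assumes "dfn (\<lambda>p :: unit \<times> 'a::obj. F (snd p) :: 'b::obj)"
  shows "LAM F \<bullet> x = F x"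
  using dfn_LAM0[of "\<lambda>_. F"] assms by blast

end


section \<open>Arithmetic of the model\<close>

context model
begin

abbreviation zeroc :: nn where "zeroc \<equiv> tc Zero"
abbreviation succ :: "nn \<Rightarrow> nn" where "succ n \<equiv> tc Succ \<bullet> n"

lemma S_nonzero: "succ n \<noteq> zeroc"
  using Sat_rca[OF RCA0\<omega>.Succ_nonzero, of "push T0 (rep n) e0"] by (simp add: denv_wenv)

lemma S_inj [simp]: "succ m = succ n \<longleftrightarrow> m = n"
  using Sat_rca[OF RCA0\<omega>.Succ_inj, of "push T0 (rep m) (push T0 (rep n) e0)"] by (auto simp: denv_wenv)

abbreviation rec :: "nn \<Rightarrow> nn \<Rightarrow> (nn, N1) fn \<Rightarrow> nn" where
  "rec n a h \<equiv> (tc Rec :: (nn, (nn, ((nn, N1) fn, nn) fn) fn) fn) \<bullet> n \<bullet> a \<bullet> h"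

lemma rec_Z: "rec zeroc a h = a"
  using Sat_rca[OF RCA0\<omega>.Rec_0, of "push T0 (rep a) (push (T0 \<rightarrow> T0 \<rightarrow> T0) (rep h) e0)"]
  by (simp add: denv_wenv)

lemma rec_S: "rec (succ n) a h = h \<bullet> (rec n a h) \<bullet> n"
  using Sat_rca[OF RCA0\<omega>.Rec_Succ, of "push T0 (rep a) (push T0 (rep n) (push (T0 \<rightarrow> T0 \<rightarrow> T0) (rep h) e0))"]
  by (simp add: denv_wenv)

text \<open>Induction for disjunctions and implications between equations, as an instance of \<open>QF_IND\<close>
  whose formula has the parameters \<open>Var T1 0, \<dots>, Var T1 3\<close>.\<close>

lemma ind_or:
  assumes "dfn (\<lambda>p::unit \<times> nn. F (snd p))" "dfn (\<lambda>p::unit \<times> nn. G (snd p))"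
    "dfn (\<lambda>p::unit \<times> nn. H (snd p))" "dfn (\<lambda>p::unit \<times> nn. K (snd p))"
    "F zeroc = G zeroc \<or> H zeroc = K zeroc"
    "\<And>n. F n = G n \<or> H n = K n \<Longrightarrow> F (succ n) = G (succ n) \<or> H (succ n) = K (succ n)"
  shows "F n = (G n :: nn) \<or> H n = (K n :: nn)"
proof -
  define \<phi> where "\<phi> = ((Eq (v1 0 \<cdot> v0 0) (v1 1 \<cdot> v0 0) \<^bold>\<longrightarrow> Falsum) \<^bold>\<longrightarrow> Eq (v1 2 \<cdot> v0 0) (v1 3 \<cdot> v0 0))"
  define e where "e = push T1 (rep (LAM F)) (push T1 (rep (LAM G)) (push T1 (rep (LAM H)) (push T1 (rep (LAM K)) e0)))"
  have [simp]: "denv e" "e T1 0 = rep (LAM F)" "e T1 1 = rep (LAM G)" "e T1 (Suc 0) = rep (LAM G)"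
    "e T1 2 = rep (LAM H)" "e T1 3 = rep (LAM K)"
    by (auto simp: e_def)
  have "Sat e (substf T0 0 Zero \<phi> \<^bold>\<longrightarrow>
      (\<^bold>\<forall>\<^bsub>T0\<^esub> \<phi> \<^bold>\<longrightarrow> substf T0 0 (Succ \<cdot> Var T0 0) (liftf T0 1 \<phi>)) \<^bold>\<longrightarrow> (\<^bold>\<forall>\<^bsub>T0\<^esub> \<phi>))"
    by (intro Sat_rca[OF RCA0\<omega>.QF_IND]) (auto simp: \<phi>_def denv_wenv)
  then have "\<forall>n. F n = G n \<or> H n = K n"
    using assms(5,6) by (simp add: \<phi>_def LAM_app[OF assms(1)] LAM_app[OF assms(2)]
      LAM_app[OF assms(3)] LAM_app[OF assms(4)]) blast
  then show ?thesis by blast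
qed

lemma ind_imp:
  assumes "dfn (\<lambda>p::unit \<times> nn. F (snd p))" "dfn (\<lambda>p::unit \<times> nn. G (snd p))"
    "dfn (\<lambda>p::unit \<times> nn. H (snd p))" "dfn (\<lambda>p::unit \<times> nn. K (snd p))"
    "F zeroc = G zeroc \<Longrightarrow> H zeroc = K zeroc"
    "\<And>n. (F n = G n \<Longrightarrow> H n = K n) \<Longrightarrow> F (succ n) = G (succ n) \<Longrightarrow> H (succ n) = K (succ n)"
  shows "F n = (G n :: nn) \<Longrightarrow> H n = (K n :: nn)"
proof -
  define \<phi> where "\<phi> = (Eq (v1 0 \<cdot> v0 0) (v1 1 \<cdot> v0 0) \<^bold>\<longrightarrow> Eq (v1 2 \<cdot> v0 0) (v1 3 \<cdot> v0 0))"
  define e where "e = push T1 (rep (LAM F)) (push T1 (rep (LAM G)) (push T1 (rep (LAM H)) (push T1 (rep (LAM K)) e0)))"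
  have [simp]: "denv e" "e T1 0 = rep (LAM F)" "e T1 1 = rep (LAM G)" "e T1 (Suc 0) = rep (LAM G)"
    "e T1 2 = rep (LAM H)" "e T1 3 = rep (LAM K)"
    by (auto simp: e_def)
  have "Sat e (substf T0 0 Zero \<phi> \<^bold>\<longrightarrow>
      (\<^bold>\<forall>\<^bsub>T0\<^esub> \<phi> \<^bold>\<longrightarrow> substf T0 0 (Succ \<cdot> Var T0 0) (liftf T0 1 \<phi>)) \<^bold>\<longrightarrow> (\<^bold>\<forall>\<^bsub>T0\<^esub> \<phi>))"
    by (intro Sat_rca[OF RCA0\<omega>.QF_IND]) (auto simp: \<phi>_def denv_wenv)
  then have "\<forall>n. F n = G n \<longrightarrow> H n = K n"
    using assms(5,6) by (simp add: \<phi>_def LAM_app[OF assms(1)] LAM_app[OF assms(2)]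
      LAM_app[OF assms(3)] LAM_app[OF assms(4)])
  then show "F n = G n \<Longrightarrow> H n = K n" by blast
qed

lemma ind_eq:
  assumes "dfn (\<lambda>p::unit \<times> nn. F (snd p))" "dfn (\<lambda>p::unit \<times> nn. G (snd p))" "F zeroc = G zeroc"
    "\<And>n. F n = G n \<Longrightarrow> F (succ n) = G (succ n)"
  shows "F n = (G n :: nn)"
  using ind_or[of F G F G n] assms by blast

abbreviation addc :: "nn \<Rightarrow> nn \<Rightarrow> nn" where "addc a b \<equiv> (tc add :: (nn, N1) fn) \<bullet> a \<bullet> b"
abbreviation mulc :: "nn \<Rightarrow> nn \<Rightarrow> nn" where "mulc a b \<equiv> (tc mult :: (nn, N1) fn) \<bullet> a \<bullet> b"
abbreviation subc :: "nn \<Rightarrow> nn \<Rightarrow> nn" where "subc a b \<equiv> (tc monus :: (nn, N1) fn) \<bullet> a \<bullet> b"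
abbreviation predc :: "nn \<Rightarrow> nn" where "predc a \<equiv> (tc pred :: N1) \<bullet> a"

text \<open>The step function of a recursion as an object of the model; \<open>rec_val\<close>
  provides its existence from a term with these values.\<close>

definition hof :: "(nn \<Rightarrow> nn \<Rightarrow> nn) \<Rightarrow> (nn, N1) fn" where
  "hof F = (SOME h. \<forall>u m. h \<bullet> u \<bullet> m = F u m)"

text \<open>Each primitive recursive constant applies \<open>Rec\<close> to an abstracted step term,
  with the previous value as index 1 and the counter as index 0. Evaluating that term once makes the
  recursion equations follow from \<open>rec_Z\<close> and \<open>rec_S\<close>.\<close>

lemma rec_val:
  assumes "denv e" "wt n" "tyof n = T0" "wt c" "tyof c = T0" "wt t" "tyof t = T0"
    "\<And>u m. val (push T0 (rep m) (push T0 (rep u) e)) t = rep (F u m)"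
  shows "val e (Rec \<cdot> n \<cdot> c \<cdot> (lam T0 (lam T0 t))) = rep (rec (un (val e n)) (un (val e c)) (hof F))"
    "hof F \<bullet> u \<bullet> m = F u m"
proof -
  obtain h :: "(nn, N1) fn" where h: "val e (lam T0 (lam T0 t)) = rep h" "\<forall>u m. h \<bullet> u \<bullet> m = F u m"
    using lam_obj2[of e t T0 T0, where 'a = nn and 'b = nn and 'c = nn] assms by auto
  have *: "\<forall>u m. hof F \<bullet> u \<bullet> m = F u m" unfolding hof_def by (rule someI[of _ h]) (rule h)
  then have "h = hof F" using h by (intro fn_ext) simp
  moreover have "val e n = rep (un (val e n) :: nn)" "val e c = rep (un (val e c) :: nn)"
    using assms by (simp_all add: rep_un)
  moreover have "val e (Rec \<cdot> n \<cdot> c \<cdot> (lam T0 (lam T0 t)))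
      = ap (ap (ap (val e Rec) (val e n)) (val e c)) (val e (lam T0 (lam T0 t)))"
    using assms(1-7) by (simp del: lam.simps val_const)
  ultimately show "val e (Rec \<cdot> n \<cdot> c \<cdot> (lam T0 (lam T0 t))) = rep (rec (un (val e n)) (un (val e c)) (hof F))"
    using h(1) rep_app val_const(3) by (metis (no_types))
  show "hof F \<bullet> u \<bullet> m = F u m" using * by blast
qed

lemma add_rec [simp]: "addc a zeroc = a" "addc a (succ b) = succ (addc a b)"
proof -
  have *: "val (push T0 (rep m) (push T0 (rep u) (push T0 (rep b) (push T0 (rep a) e0)))) (suc (v0 1))
      = rep (succ u)" for u m b :: nn by simp
  have "rep (addc a b) = rep (rec b a (hof (\<lambda>u m. succ u)))" for b
    unfolding add_def
    by (rule trans[OF rep_tc_lam2 trans[OF rec_val(1)[OF _ _ _ _ _ _ _ *]]]) (simp_all del: lam.simps)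
  then have "addc a b = rec b a (hof (\<lambda>u m. succ u))" for b by simp
  moreover have "hof (\<lambda>u m. succ u) \<bullet> u \<bullet> m = succ u" for u m
    by (rule rec_val(2)[OF _ _ _ _ _ _ _ *[of _ _ zeroc], of Zero Zero]) simp_all
  ultimately show "addc a zeroc = a" "addc a (succ b) = succ (addc a b)" by (simp_all add: rec_Z rec_S)
qed

lemma pred_rec [simp]: "predc zeroc = zeroc" "predc (succ b) = b"
proof -
  have *: "val (push T0 (rep m) (push T0 (rep u) (push T0 (rep b) e0))) (v0 0) = rep m" for u m b :: nn by simp
  have "rep (predc b) = rep (rec b zeroc (hof (\<lambda>u m. m)))" for b
    unfolding pred_def
    by (rule trans[OF rep_tc_lam trans[OF rec_val(1)[OF _ _ _ _ _ _ _ *]]]) (simp_all del: lam.simps)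
  then have "predc b = rec b zeroc (hof (\<lambda>u m. m))" for b by simp
  moreover have "hof (\<lambda>u m. m) \<bullet> u \<bullet> m = m" for u m
    by (rule rec_val(2)[OF _ _ _ _ _ _ _ *[of _ _ zeroc], of Zero Zero]) simp_all
  ultimately show "predc zeroc = zeroc" "predc (succ b) = b" by (simp_all add: rec_Z rec_S)
qed

lemma monus_rec [simp]: "subc a zeroc = a" "subc a (succ b) = predc (subc a b)"
proof -
  have *: "val (push T0 (rep m) (push T0 (rep u) (push T0 (rep b) (push T0 (rep a) e0)))) (pred \<cdot> (v0 1))
      = rep (predc u)" for u m b :: nn by simp
  have "rep (subc a b) = rep (rec b a (hof (\<lambda>u m. predc u)))" for b
    unfolding monus_def
    by (rule trans[OF rep_tc_lam2 trans[OF rec_val(1)[OF _ _ _ _ _ _ _ *]]]) (simp_all del: lam.simps)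
  then have "subc a b = rec b a (hof (\<lambda>u m. predc u))" for b by simp
  moreover have "hof (\<lambda>u m. predc u) \<bullet> u \<bullet> m = predc u" for u m
    by (rule rec_val(2)[OF _ _ _ _ _ _ _ *[of _ _ zeroc], of Zero Zero]) simp_all
  ultimately show "subc a zeroc = a" "subc a (succ b) = predc (subc a b)" by (simp_all add: rec_Z rec_S)
qed

lemma mult_rec [simp]: "mulc a zeroc = zeroc" "mulc a (succ b) = addc (mulc a b) a"
proof -
  have *: "val (push T0 (rep m) (push T0 (rep u) (push T0 (rep b) (push T0 (rep a) e0)))) (v0 1 +\<^sub>N v0 3)
      = rep (addc u a)" for u m b :: nn by simp
  have "rep (mulc a b) = rep (rec b zeroc (hof (\<lambda>u m. addc u a)))" for b
    unfolding mult_def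
    by (rule trans[OF rep_tc_lam2 trans[OF rec_val(1)[OF _ _ _ _ _ _ _ *]]]) (simp_all del: lam.simps)
  then have "mulc a b = rec b zeroc (hof (\<lambda>u m. addc u a))" for b by simp
  moreover have "hof (\<lambda>u m. addc u a) \<bullet> u \<bullet> m = addc u a" for u m
    by (rule rec_val(2)[OF _ _ _ _ _ _ _ *[of _ _ zeroc], of Zero Zero]) simp_all
  ultimately show "mulc a zeroc = zeroc" "mulc a (succ b) = addc (mulc a b) a" by (simp_all add: rec_Z rec_S)
qed

lemma pow2_rec: "tc pow2 \<bullet> zeroc = succ zeroc" "tc pow2 \<bullet> (succ b) = addc (tc pow2 \<bullet> b) (tc pow2 \<bullet> b)"
proof -
  have *: "val (push T0 (rep m) (push T0 (rep u) (push T0 (rep b) e0))) (v0 1 +\<^sub>N v0 1) = rep (addc u u)" for u m b :: nn by simp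
  have "rep (tc pow2 \<bullet> b :: nn) = rep (rec b (succ zeroc) (hof (\<lambda>u m. addc u u)))" for b
    unfolding pow2_def
    by (rule trans[OF rep_tc_lam trans[OF rec_val(1)[OF _ _ _ _ _ _ _ *]]]) (simp_all del: lam.simps)
  then have "tc pow2 \<bullet> b = rec b (succ zeroc) (hof (\<lambda>u m. addc u u))" for b by simp
  moreover have "hof (\<lambda>u m. addc u u) \<bullet> u \<bullet> m = addc u u" for u m
    by (rule rec_val(2)[OF _ _ _ _ _ _ _ *[of _ _ zeroc], of Zero Zero]) simp_all
  ultimately show "tc pow2 \<bullet> zeroc = succ zeroc" "tc pow2 \<bullet> (succ b) = addc (tc pow2 \<bullet> b) (tc pow2 \<bullet> b)"
    by (simp_all add: rec_Z rec_S)
qed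

lemma isqrt_rec: "tc isqrt \<bullet> zeroc = zeroc"
  "tc isqrt \<bullet> (succ b) = (let u = tc isqrt \<bullet> b in if subc (mulc (succ u) (succ u)) (succ b) = zeroc then succ u else u)"
proof -
  have Z_S: "n = zeroc \<or> n = succ (predc n)" for n
    by (rule ind_or[of "\<lambda>n. n" "\<lambda>_. zeroc" "\<lambda>n. n" "\<lambda>n. succ (predc n)"]) (intro dfns | simp)+
  have i: "val (push T0 (rep m') (push T0 (rep u') (push T0 (rep m) (push T0 (rep u) (push T0 (rep b) e0))))) (v0 3)
      = rep u" for u m b m' u' :: nn by simp
  have i2: "hof (\<lambda>u' m'. u) \<bullet> u' \<bullet> m' = u" for u u' m'
    by (rule rec_val(2)[OF _ _ _ _ _ _ _ i[of _ _ zeroc u zeroc], of Zero Zero]) simp_all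
  \<comment> \<open>Recursion with a step that ignores both its arguments is a case distinction on
    zero; the integer square root uses it to decide whether to increment.\<close>
  have "rec n a (hof (\<lambda>u' m'. u)) = (if n = zeroc then a else u)" for n a u
    using Z_S[of n] by (metis i2 rec_S rec_Z S_nonzero)
  then have *: "val (push T0 (rep m) (push T0 (rep u) (push T0 (rep b) e0)))
      (Rec \<cdot> (suc (v0 1) *\<^sub>N suc (v0 1) -\<^sub>N suc (v0 0)) \<cdot> suc (v0 1) \<cdot> (lam T0 (lam T0 (v0 3))))
      = rep (if subc (mulc (succ u) (succ u)) (succ m) = zeroc then succ u else u)" for u m b :: nn
    by (subst rec_val(1)[OF _ _ _ _ _ _ _ i]) (simp_all del: lam.simps)
  let ?h = "hof (\<lambda>u m. if subc (mulc (succ u) (succ u)) (succ m) = zeroc then succ u else u)"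
  have "rep (tc isqrt \<bullet> b :: nn) = rep (rec b zeroc ?h)" for b
    unfolding isqrt_def
    by (rule trans[OF rep_tc_lam trans[OF rec_val(1)[OF _ _ _ _ _ _ _ *]]]) (simp_all del: lam.simps)
  then have "tc isqrt \<bullet> b = rec b zeroc ?h" for b by simp
  moreover have "?h \<bullet> u \<bullet> m = (if subc (mulc (succ u) (succ u)) (succ m) = zeroc then succ u else u)" for u m
    by (rule rec_val(2)[OF _ _ _ _ _ _ _ *[of _ _ zeroc], of Zero Zero]) (simp_all del: lam.simps)
  ultimately show "tc isqrt \<bullet> zeroc = zeroc"
    "tc isqrt \<bullet> (succ b) = (let u = tc isqrt \<bullet> b in if subc (mulc (succ u) (succ u)) (succ b) = zeroc then succ u else u)"
    by (simp_all add: rec_Z rec_S Let_def)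
qed

lemma A_Z_left [simp]: "addc zeroc n = n"
  by (rule ind_eq[of "addc zeroc" "\<lambda>n. n"]) (intro dfns | simp)+

lemma A_S_left [simp]: "addc (succ a) n = succ (addc a n)"
  by (rule ind_eq[of "addc (succ a)" "\<lambda>n. succ (addc a n)"]) (intro dfns | simp)+

lemma A_commute: "addc a n = addc n a"
  by (rule ind_eq[of "addc a" "\<lambda>n. addc n a"]) (intro dfns | simp)+

lemma A_assoc: "addc (addc a b) n = addc a (addc b n)"
  by (rule ind_eq[of "addc (addc a b)" "\<lambda>n. addc a (addc b n)"]) (intro dfns | simp)+

lemma A_left_commute: "addc a (addc b c) = addc b (addc a c)"
  by (metis A_commute A_assoc)

lemmas A_ac = A_assoc A_commute A_left_commute

lemma M_Z_left [simp]: "mulc zeroc n = zeroc"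
  by (rule ind_eq[of "mulc zeroc" "\<lambda>n. zeroc"]) (intro dfns | simp)+

lemma M_S_left [simp]: "mulc (succ a) n = addc (mulc a n) n"
  by (rule ind_eq[of "mulc (succ a)" "\<lambda>n. addc (mulc a n) n"]) (intro dfns | simp add: A_ac)+

lemma M_commute: "mulc a n = mulc n a"
  by (rule ind_eq[of "mulc a" "\<lambda>n. mulc n a"]) (intro dfns | simp)+

lemma M_A_distrib: "mulc a (addc b n) = addc (mulc a b) (mulc a n)"
  by (rule ind_eq[of "\<lambda>n. mulc a (addc b n)" "\<lambda>n. addc (mulc a b) (mulc a n)"]) (intro dfns | simp add: A_ac)+

lemma M_assoc: "mulc (mulc a b) n = mulc a (mulc b n)"
  by (rule ind_eq[of "mulc (mulc a b)" "\<lambda>n. mulc a (mulc b n)"]) (intro dfns | simp add: M_A_distrib)+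

lemma Z_or_S: "n = zeroc \<or> n = succ (predc n)"
  by (rule ind_or[of "\<lambda>n. n" "\<lambda>_. zeroc" "\<lambda>n. n" "\<lambda>n. succ (predc n)"]) (intro dfns | simp)+

lemma A_cancel: "addc a n = addc b n \<Longrightarrow> a = b"
  by (rule ind_imp[of "\<lambda>n. addc a n" "\<lambda>n. addc b n" "\<lambda>_. a" "\<lambda>_. b" n]) (intro dfns | simp)+

lemma D_S_S [simp]: "subc (succ a) (succ n) = subc a n"
proof -
  have "predc (subc (succ a) n) = subc a n"
    by (rule ind_eq[of "\<lambda>n. predc (subc (succ a) n)" "subc a"]) (intro dfns | simp)+
  then show ?thesis by simp
qed

lemma D_A_cancel: "subc (addc c n) n = c"
  by (rule ind_eq[of "\<lambda>n. subc (addc c n) n" "\<lambda>_. c"]) (intro dfns | simp add: D_S_S del: monus_rec(2))+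

lemma D_diag [simp]: "subc n n = zeroc"
  using D_A_cancel[of zeroc n] by simp

lemma D_A_zero: "subc a (addc a n) = zeroc"
  by (rule ind_eq[of "\<lambda>n. subc a (addc a n)" "\<lambda>_. zeroc"]) (intro dfns | simp)+

text \<open>Comparability of two numbers, written as a disjunction of equations so that it falls
  under \<open>ind_or\<close>; the linearity of the order comes from here.\<close>

lemma D_cases: "addc n (subc b n) = b \<or> addc b (subc n b) = n"
proof (rule ind_or[of "\<lambda>n. addc n (subc b n)" "\<lambda>_. b" "\<lambda>n. addc b (subc n b)" "\<lambda>n. n"])
  show "dfn (\<lambda>p::unit \<times> nn. addc (snd p) (subc b (snd p)))" "dfn (\<lambda>p::unit \<times> nn. b)"
    "dfn (\<lambda>p::unit \<times> nn. addc b (subc (snd p) b))" "dfn (\<lambda>p::unit \<times> nn. snd p)"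
    by (intro dfns)+
next
  fix n assume "addc n (subc b n) = b \<or> addc b (subc n b) = n"
  moreover have "addc (succ n) (subc b (succ n)) = b" if "addc n (subc b n) = b" "subc b n = succ (predc (subc b n))"
  proof -
    have "addc (succ n) (predc (subc b n)) = b" using that by (metis A_S_left add_rec(2))
    then show ?thesis by simp
  qed
  moreover have "addc b (subc (succ n) b) = succ n" if "n = addc b c" for c
  proof -
    have "subc (succ n) b = succ c" using D_A_cancel[of "succ c" b] that by (simp add: A_commute)
    then show ?thesis using that by simp
  qed
  ultimately show "addc (succ n) (subc b (succ n)) = b \<or> addc b (subc (succ n) b) = succ n"
    using Z_or_S[of "subc b n"] by (metis add_rec(1))
qed simp

lemma D_zero_iff: "subc a b = zeroc \<longleftrightarrow> (\<exists>c. b = addc a c)"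
  using D_cases[of a b] D_A_zero by (metis add_rec(1))

lemma D_cases': "(\<exists>c. b = addc a c) \<or> (\<exists>c. a = addc b c)"
  using D_cases[of a b] by metis

lemma A_zero_iff: "addc a b = zeroc \<longleftrightarrow> a = zeroc \<and> b = zeroc"
  using Z_or_S[of b] S_nonzero by (metis A_commute add_rec A_Z_left)

lemma M_zero_iff: "mulc a b = zeroc \<longleftrightarrow> a = zeroc \<or> b = zeroc"
  using Z_or_S[of b] by (metis A_zero_iff mult_rec M_Z_left)

lemma D_D: "subc (subc a b) n = subc a (addc b n)"
  by (rule ind_eq[of "\<lambda>n. subc (subc a b) n" "\<lambda>n. subc a (addc b n)"]) (intro dfns | simp)+

end

text \<open>If the assumption \<open>good\<close> fails, the arithmetic of \<open>nn\<close> is copied from \<open>nat\<close>.\<close>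

definition ndec :: "nn \<Rightarrow> nat" where
  "ndec = (SOME f. bij f)"

lemma bij_ndec: "\<not> good \<Longrightarrow> bij ndec"
proof -
  assume ng: "\<not> good"
  have r: "rep ` (UNIV :: nn set) = dom T0" using range_rep[where 'a = nn] by simp
  have "Var T0 i \<in> dom T0" for i using Var_dom[OF ng, of "Var T0 i"] by simp
  then have "range (\<lambda>i. Var T0 i) \<subseteq> dom T0" by blast
  moreover have "infinite (range (\<lambda>i. Var T0 i))" by (rule range_inj_infinite) (auto simp: inj_def)
  ultimately have "infinite (dom T0)" using finite_subset by blast
  then have inf: "infinite (UNIV :: nn set)" using r by (metis finite_imageI)
  have "inj (\<lambda>x::nn. to_nat (rep x))" by (rule injI) simp
  then have "countable (UNIV :: nn set)" by (rule countableI)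
  then have "\<exists>f::nn \<Rightarrow> nat. bij f" using inf to_nat_on_infinite by blast
  then show ?thesis unfolding ndec_def by (rule someI_ex)
qed

instantiation nn :: linordered_semidom
begin

definition "0 = (if good then tc Zero else inv ndec 0)"
definition "1 = (if good then tc Succ \<bullet> (tc Zero :: nn) else inv ndec 1)"
definition "a + b = (if good then (tc add :: (nn, N1) fn) \<bullet> a \<bullet> b else inv ndec (ndec a + ndec b))"
definition "a * b = (if good then (tc mult :: (nn, N1) fn) \<bullet> a \<bullet> b else inv ndec (ndec a * ndec b))"
definition "a - b = (if good then (tc monus :: (nn, N1) fn) \<bullet> a \<bullet> b else inv ndec (ndec a - ndec b))"
definition "a \<le> b \<longleftrightarrow> (if good then (tc monus :: (nn, N1) fn) \<bullet> a \<bullet> b = (tc Zero :: nn) else ndec a \<le> ndec b)"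
definition "(a::nn) < b \<longleftrightarrow> a \<le> b \<and> a \<noteq> b"

instance
proof
  fix a b c :: nn
  \<comment> \<open>All laws are collected in one conjunction, so that the case distinction on
    \<open>good\<close> is made once for the whole class instance.\<close>
  have L: "(a * b * c = a * (b * c)) \<and>
    (a * b = b * a) \<and>
    (1 * a = a) \<and>
    (a + b + c = a + (b + c)) \<and>
    (a + b = b + a) \<and>
    (0 + a = a) \<and>
    ((a + b) * c = a * c + b * c) \<and>
    (0 * a = 0) \<and>
    (a * 0 = 0) \<and>
    (a + b - a = b) \<and>
    (a - b - c = a - (b + c)) \<and>
    ((0::nn) \<noteq> 1) \<and>
    (a \<noteq> 0 \<longrightarrow> b \<noteq> 0 \<longrightarrow> a * b \<noteq> 0) \<and>
    (a \<le> b \<or> b \<le> a) \<and>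
    (a \<le> a) \<and>
    (a \<le> b \<longrightarrow> b \<le> c \<longrightarrow> a \<le> c) \<and>
    (a \<le> b \<longrightarrow> b \<le> a \<longrightarrow> a = b) \<and>
    (a < b \<longleftrightarrow> a \<le> b \<and> \<not> b \<le> a) \<and>
    (a \<le> b \<longrightarrow> c + a \<le> c + b) \<and>
    ((0::nn) < 1) \<and>
    (a < b \<longrightarrow> 0 < c \<longrightarrow> c * a < c * b) \<and>
    (b \<le> a \<longrightarrow> a - b + b = a) \<and>
    (a * (b - c) = a * b - a * c) \<and>
    (a * (b + c) = a * b + a * c)"
  proof (cases good)
    case False
    note b = bij_ndec[OF False]
    have [simp]: "ndec (inv ndec n) = n" for n using b by (simp add: bij_is_surj surj_f_inv_f)
    have [simp]: "inv ndec (ndec n) = n" for n using b by (simp add: bij_is_inj)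
    have eq: "a = b \<longleftrightarrow> ndec a = ndec b" for a b using b by (metis bij_pointE)
    show ?thesis
      by (auto simp: False zero_nn_def one_nn_def plus_nn_def times_nn_def minus_nn_def
        less_eq_nn_def less_nn_def eq algebra_simps)
  next
    case True
    then interpret model by unfold_locales
    note defs = True zero_nn_def one_nn_def plus_nn_def times_nn_def minus_nn_def less_eq_nn_def less_nn_def
    note le = less_eq_nn_def[simplified True if_True D_zero_iff]
    have lt: "a < b \<longleftrightarrow> (\<exists>c. b = addc a (succ c))" for a b :: nn
    proof
      assume "a < b"
      then obtain c where "b = addc a c" "a \<noteq> b" by (auto simp: less_nn_def le)
      then show "\<exists>c. b = addc a (succ c)" using Z_or_S[of c] by (metis add_rec(1))
    next
      assume "\<exists>c. b = addc a (succ c)"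
      then obtain c where c: "b = addc a (succ c)" by blast
      moreover have "a \<noteq> b"
      proof
        assume "a = b"
        then have "addc zeroc a = addc (succ c) a" using c by (metis A_Z_left A_commute)
        then have "zeroc = succ c" by (rule A_cancel)
        then show False using S_nonzero by metis
      qed
      ultimately show "a < b" by (auto simp: less_nn_def le simp del: add_rec)
    qed
    have l1: "a * b * c = a * (b * c)" by (simp add: defs M_assoc)
    have l2: "a * b = b * a" by (simp add: defs M_commute)
    have l3: "1 * a = a" by (simp add: defs)
    have l4: "a + b + c = a + (b + c)" by (simp add: defs A_assoc)
    have l5: "a + b = b + a" by (simp add: defs A_commute)
    have l6: "0 + a = a" by (simp add: defs)
    have l7: "(a + b) * c = a * c + b * c" by (simp add: defs M_A_distrib M_commute[of _ c])
    have l8: "0 * a = 0" "a * 0 = 0" by (simp_all add: defs)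
    have l9: "a + b - a = b" by (simp add: defs D_A_cancel A_commute[of a])
    have l10: "a - b - c = a - (b + c)" by (simp add: defs D_D)
    have l11: "(0::nn) \<noteq> 1" using S_nonzero[of zeroc] by (simp add: defs)
    have l12: "a \<noteq> 0 \<longrightarrow> b \<noteq> 0 \<longrightarrow> a * b \<noteq> 0" by (simp add: defs M_zero_iff)
    have tot: "a \<le> b \<or> b \<le> a" unfolding le by (rule D_cases')
    have l13: "a \<le> a" by (simp add: defs)
    have l14: "a \<le> b \<longrightarrow> b \<le> c \<longrightarrow> a \<le> c" unfolding le by (metis A_assoc)
    have as: "a = b" if ab: "a \<le> b" "b \<le> a" for a b :: nn
    proof (rule ccontr)
      assume "a \<noteq> b"
      then obtain c where c: "b = addc a (succ c)" using ab lt[of a b] unfolding less_nn_def by blast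
      obtain d where "a = addc b d" using ab unfolding le by blast
      then have "addc zeroc a = addc (addc (succ c) d) a" using c by (metis A_Z_left A_commute A_assoc)
      then have "zeroc = addc (succ c) d" by (rule A_cancel)
      then show False using S_nonzero by (metis A_S_left)
    qed
    have l15: "a < b \<longleftrightarrow> a \<le> b \<and> \<not> b \<le> a" using as[of a b] as[of b a] tot by (auto simp: less_nn_def)
    have l16: "a \<le> b \<longrightarrow> c + a \<le> c + b" unfolding le by (auto simp: defs A_assoc)
    have l17: "(0::nn) < 1" unfolding lt by (simp add: defs)
    have l18: "a < b \<longrightarrow> 0 < c \<longrightarrow> c * a < c * b"
    proof (intro impI)
      assume "a < b" "0 < c"
      then obtain d f where "b = addc a (succ d)" "c = succ f"
        unfolding lt by (auto simp: defs simp del: add_rec)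
      moreover have "mulc c (succ d) = succ (addc (mulc c d) f)" using calculation(2) by (subst mult_rec(2)) simp
      ultimately have "mulc c b = addc (mulc c a) (succ (addc (mulc c d) f))" by (simp only: M_A_distrib)
      then show "c * a < c * b" unfolding lt by (auto simp: defs simp del: add_rec mult_rec)
    qed
    have l19: "b \<le> a \<longrightarrow> a - b + b = a" unfolding le by (auto simp: defs D_A_cancel A_commute[of b])
    have l20: "a * (b - c) = a * b - a * c"
      using D_cases'[of b c]
    proof (elim disjE exE)
      fix d assume "c = addc b d"
      then show ?thesis by (simp add: defs M_A_distrib D_A_zero)
    next
      fix d assume "b = addc c d"
      then have "b = addc d c" by (simp add: A_commute)
      then show ?thesis by (simp add: defs M_A_distrib D_A_cancel)
    qed
    have l21: "a * (b + c) = a * b + a * c" by (simp add: defs M_A_distrib)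
    show ?thesis using tot as l1 l2 l3 l4 l5 l6 l7 l8 l9 l10 l11 l12 l13 l14 l15 l16 l17 l18 l19 l20 l21 by blast
  qed
  show "a * b * c = a * (b * c)"
    "a * b = b * a"
    "1 * a = a"
    "a + b + c = a + (b + c)"
    "a + b = b + a"
    "0 + a = a"
    "(a + b) * c = a * c + b * c"
    "0 * a = 0"
    "a * 0 = 0"
    "a + b - a = b"
    "a - b - c = a - (b + c)"
    "(0::nn) \<noteq> 1"
    "a \<noteq> 0 \<Longrightarrow> b \<noteq> 0 \<Longrightarrow> a * b \<noteq> 0"
    "a \<le> b \<or> b \<le> a"
    "a \<le> a"
    "a \<le> b \<Longrightarrow> b \<le> c \<Longrightarrow> a \<le> c"
    "a \<le> b \<Longrightarrow> b \<le> a \<Longrightarrow> a = b"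
    "a < b \<longleftrightarrow> a \<le> b \<and> \<not> b \<le> a"
    "a \<le> b \<Longrightarrow> c + a \<le> c + b"
    "(0::nn) < 1"
    "a < b \<Longrightarrow> 0 < c \<Longrightarrow> c * a < c * b"
    "b \<le> a \<Longrightarrow> a - b + b = a"
    "a * (b - c) = a * b - a * c" "a * (b + c) = a * b + a * c"
    using L by (elim conjE, iprover)+
qed
end


\<comment> \<open>Integers and rationals over the numbers of the model\<close>
quotient_type zz = "nn \<times> nn" / "\<lambda>(a, b) (c, d). a + d = c + b"
  morphisms Rep_zz Abs_zz
proof (rule equivpI)
  show "transp (\<lambda>(a, b) (c, d). a + d = c + (b::nn))"
  proof (rule transpI, clarify)
    fix a b c d e f :: nn
    assume "a + d = c + b" "c + f = e + d"
    then have "(a + d) + (c + f) = (c + b) + (e + d)" by simp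
    then have "(a + f) + (c + d) = (e + b) + (c + d)" by (simp only: ac_simps)
    then show "a + f = e + b" by simp
  qed
qed (auto simp: reflp_def symp_def)

instantiation zz :: linordered_idom
begin

lift_definition zero_zz :: zz is "(0, 0)" .
lift_definition one_zz :: zz is "(1, 0)" .
lift_definition plus_zz :: "zz \<Rightarrow> zz \<Rightarrow> zz" is "\<lambda>(a, b) (c, d). (a + c, b + d)"
  by (auto simp: algebra_simps) (metis add.assoc add.commute)
lift_definition uminus_zz :: "zz \<Rightarrow> zz" is "\<lambda>(a, b). (b, a)"
  by (auto simp: algebra_simps)
definition minus_zz :: "zz \<Rightarrow> zz \<Rightarrow> zz" where "minus_zz a b = a + - b"

lift_definition times_zz :: "zz \<Rightarrow> zz \<Rightarrow> zz" is "\<lambda>(a, b) (c, d). (a * c + b * d, a * d + b * c)"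
proof (unfold split_paired_all prod.case)
  fix a b c d a' b' c' d' :: nn
  assume "a + b' = a' + b" "c + d' = c' + d"
  then have "(a + b') * c = (a' + b) * c" "(a' + b) * d = (a + b') * d"
    "a' * (c + d') = a' * (c' + d)" "b' * (c' + d) = b' * (c + d')"
    by simp_all
  then have e: "a * c + b' * c = a' * c + b * c" "b * d + a' * d = a * d + b' * d"
    "a' * c + a' * d' = a' * c' + a' * d" "b' * c' + b' * d = b' * c + b' * d'"
    by (simp_all add: algebra_simps)
  \<comment> \<open>The four multiples of the hypotheses are added up. Both sides then exceed those
    of the goal by the same four products, which are cancelled, as \<open>nn\<close> has no negative
    elements to subtract with.\<close>
  have "(a * c + b * d + (a' * d' + b' * c')) + (b' * c + a' * d + a' * c + b' * d)
      = (a * c + b' * c) + (b * d + a' * d) + (a' * c + a' * d') + (b' * c' + b' * d)"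
    by (simp only: ac_simps)
  also have "\<dots> = (a' * c + b * c) + (a * d + b' * d) + (a' * c' + a' * d) + (b' * c + b' * d')"
    by (simp only: e)
  also have "\<dots> = (a' * c' + b' * d' + (a * d + b * c)) + (b' * c + a' * d + a' * c + b' * d)"
    by (simp only: ac_simps)
  finally have "(a * c + b * d + (a' * d' + b' * c')) + (b' * c + a' * d + a' * c + b' * d)
      = (a' * c' + b' * d' + (a * d + b * c)) + (b' * c + a' * d + a' * c + b' * d)" .
  then show "a * c + b * d + (a' * d' + b' * c') = a' * c' + b' * d' + (a * d + b * c)" by simp
qed

lift_definition less_eq_zz :: "zz \<Rightarrow> zz \<Rightarrow> bool" is "\<lambda>(a, b) (c, d). a + d \<le> c + b"
proof (unfold split_paired_all prod.case)
  fix a b c d a' b' c' d' :: nn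
  assume "a + b' = a' + b" "c + d' = c' + d"
  have le: "a + d \<le> c + b \<longleftrightarrow> (a + d) + (b' + d') \<le> (c + b) + (b' + d')"
    "a' + d' \<le> c' + b' \<longleftrightarrow> (a' + d') + (b + d) \<le> (c' + b') + (b + d)" by simp_all
  have 1: "(a + d) + (b' + d') = (a' + d') + (b + d)"
  proof -
    have "(a + d) + (b' + d') = (a + b') + (d + d')" by (simp only: ac_simps)
    also have "\<dots> = (a' + d') + (b + d)" by (simp only: \<open>a + b' = a' + b\<close> ac_simps)
    finally show ?thesis .
  qed
  have 2: "(c + b) + (b' + d') = (c' + b') + (b + d)"
  proof -
    have "(c + b) + (b' + d') = (c + d') + (b + b')" by (simp only: ac_simps)
    also have "\<dots> = (c' + b') + (b + d)" by (simp only: \<open>c + d' = c' + d\<close> ac_simps)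
    finally show ?thesis .
  qed
  show "a + d \<le> c + b \<longleftrightarrow> a' + d' \<le> c' + b'" by (simp only: le 1 2)
qed
definition less_zz :: "zz \<Rightarrow> zz \<Rightarrow> bool" where "less_zz a b \<longleftrightarrow> a \<le> b \<and> \<not> b \<le> a"
definition abs_zz :: "zz \<Rightarrow> zz" where "abs_zz a = (if a < 0 then - a else a)"
definition sgn_zz :: "zz \<Rightarrow> zz" where "sgn_zz a = (if a = 0 then 0 else if 0 < a then 1 else - 1)"

instance
proof
  fix a b c :: zz
  show "a * b * c = a * (b * c)" by transfer (auto simp: algebra_simps)
  show "a * b = b * a" by transfer (auto simp: algebra_simps)
  show "1 * a = a" by transfer auto
  show "a + b + c = a + (b + c)" by transfer (auto simp: algebra_simps)
  show "a + b = b + a" by transfer (auto simp: algebra_simps)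
  show "0 + a = a" by transfer auto
  show "- a + a = 0" by transfer (auto simp: algebra_simps)
  show "a - b = a + - b" by (simp add: minus_zz_def)
  show "a + b - a = b" "a - b - c = a - (b + c)"
    unfolding minus_zz_def by (transfer, auto simp: algebra_simps)+
  show "0 * a = 0" "a * 0 = 0" by (transfer, auto)+
  show "(a + b) * c = a * c + b * c" by transfer (auto simp: algebra_simps)
  show "(0::zz) \<noteq> 1" by transfer auto
  show "a < b \<longleftrightarrow> a \<le> b \<and> \<not> b \<le> a" by (simp add: less_zz_def)
  show "a \<le> a" by transfer auto
  show "a \<le> b \<Longrightarrow> b \<le> c \<Longrightarrow> a \<le> c"
  proof (transfer, clarify)
    fix a b c d e f :: nn
    assume "a + d \<le> c + b" "c + f \<le> e + d"
    then have "(a + d) + (c + f) \<le> (c + b) + (e + d)" by (rule add_mono)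
    then have "(a + f) + (c + d) \<le> (e + b) + (c + d)" by (simp only: add.assoc add.commute add.left_commute)
    then show "a + f \<le> e + b" by simp
  qed
  show "a \<le> b \<Longrightarrow> b \<le> a \<Longrightarrow> a = b" by transfer auto
  show "a \<le> b \<or> b \<le> a" by transfer auto
  show "a \<le> b \<Longrightarrow> c + a \<le> c + b"
  proof (transfer, clarify)
    fix a b c d e f :: nn
    assume "a + d \<le> c + b"
    then have "(a + d) + (e + f) \<le> (c + b) + (e + f)" by simp
    then show "e + a + (f + d) \<le> e + c + (f + b)" by (simp only: add.assoc add.commute add.left_commute)
  qed
  show "a < b \<Longrightarrow> 0 < c \<Longrightarrow> c * a < c * b"
    unfolding less_zz_def
  proof (transfer, clarify, unfold prod.case not_le)
    fix a b c d e f :: nn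
    assume *: "a + d \<le> c + b" "0 + f \<le> e + 0" "a + d < c + b" "0 + f < e + 0"
    \<comment> \<open>With \<open>e = f + k\<close> both sides share the summand
      \<open>f * (a + d + c + b)\<close>, and what remains is the strict inequality multiplied by
      the positive \<open>k\<close>.\<close>
    define k where "k = e - f"
    have e: "e = f + k" using * by (simp add: k_def)
    then have k: "0 < k" using *(4) by simp
    have "k * (a + d) < k * (c + b)" using *(3) k by (rule mult_strict_left_mono)
    then have "f * (a + d + c + b) + k * (a + d) < f * (a + d + c + b) + k * (c + b)" by simp
    moreover have "f * (a + d + c + b) + k * (a + d) = e * a + f * b + (e * d + f * c)"
      "f * (a + d + c + b) + k * (c + b) = e * c + f * d + (e * b + f * a)"
      by (simp_all add: e algebra_simps)
    ultimately have "e * a + f * b + (e * d + f * c) < e * c + f * d + (e * b + f * a)" by simp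
    then show "e * a + f * b + (e * d + f * c) \<le> e * c + f * d + (e * b + f * a) \<and>
      e * a + f * b + (e * d + f * c) < e * c + f * d + (e * b + f * a)" by simp
  qed
  show "\<bar>a\<bar> = (if a < 0 then - a else a)" by (simp add: abs_zz_def)
  show "sgn a = (if a = 0 then 0 else if 0 < a then 1 else - 1)" by (simp add: sgn_zz_def)
qed
end

lift_definition zn :: "nn \<Rightarrow> zz" is "\<lambda>n. (n, 0)" .

type_synonym qq = "zz fract"

definition \<iota> :: "nn \<Rightarrow> qq" where
  "\<iota> n = Fract (zn n) 1"

lemma zn_simps: "zn (a + b) = zn a + zn b" "zn (a * b) = zn a * zn b" "zn 0 = 0" "zn 1 = 1"
  "zn a \<le> zn b \<longleftrightarrow> a \<le> b" "zn a = zn b \<longleftrightarrow> a = b"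
  by (transfer; simp)+

lemma \<iota>_simps [simp]: "\<iota> (a + b) = \<iota> a + \<iota> b" "\<iota> (a * b) = \<iota> a * \<iota> b" "\<iota> 0 = 0" "\<iota> 1 = 1"
  "\<iota> a \<le> \<iota> b \<longleftrightarrow> a \<le> b" "\<iota> a = \<iota> b \<longleftrightarrow> a = b" "\<iota> a < \<iota> b \<longleftrightarrow> a < b"
proof -
  show le: "\<iota> a \<le> \<iota> b \<longleftrightarrow> a \<le> b" for a b by (simp add: \<iota>_def zn_simps)
  show "\<iota> a < \<iota> b \<longleftrightarrow> a < b" by (simp add: less_le_not_le le)
qed (simp_all add: \<iota>_def zn_simps Zero_fract_def One_fract_def eq_fract)

lemma zz_cases: "\<exists>a b. x = zn a - zn b"
proof -
  obtain a b where "x = Abs_zz (a, b)"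
    using Quotient_abs_rep[OF Quotient_zz] by (metis surj_pair)
  moreover have "Abs_zz (a, b) = zn a - zn b"
    by (simp add: minus_zz_def zn.abs_eq uminus_zz.abs_eq plus_zz.abs_eq)
  ultimately show ?thesis by blast
qed

text \<open>A positive integer is the image of a number of the model, since its negative part can be
  subtracted from the positive one. The resulting shape is that of the codes of rationals.\<close>

lemma qq_cases: "\<exists>a b c. 0 < c \<and> (x::qq) = (\<iota> a - \<iota> b) / \<iota> c"
proof -
  have "\<exists>y z. x = Fract y z \<and> 0 < z" by (induct x rule: fract_induct_pos) auto
  then obtain y z where x: "x = Fract y z" "0 < z" by blast
  obtain a b where y: "y = zn a - zn b" using zz_cases by blast
  obtain c d where z: "z = zn c - zn d" using zz_cases by blast
  then have "zn d \<le> zn c" using x(2) by simp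
  then have "d \<le> c" by (simp add: zn_simps)
  then have "c = (c - d) + d" by simp
  then have "zn c = zn (c - d) + zn d" by (metis zn_simps(1))
  then have z': "z = zn (c - d)" using z by simp
  then have "0 < c - d" using x(2) by (metis less_le_not_le zn_simps(3,5))
  moreover have "x = (\<iota> a - \<iota> b) / \<iota> (c - d)"
    using x(1) by (simp add: \<iota>_def y z')
  ultimately show ?thesis by blast
qed

section \<open>Definability\<close>

text \<open>Value 0 stands for truth, the convention of \<open>exists2\<close> and of the order
  defined by truncated subtraction.\<close>

definition pd :: "('c::ctx \<Rightarrow> bool) \<Rightarrow> bool" where
  "pd P \<longleftrightarrow> (\<exists>f :: 'c \<Rightarrow> nn. dfn f \<and> (\<forall>p. P p \<longleftrightarrow> f p = 0))"

context model
begin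

lemma arith [simp]:
  "tc Zero = (0::nn)" "succ n = n + 1" "addc a b = a + b" "mulc a b = a * b" "subc a b = a - b"
  by (simp_all add: good zero_nn_def one_nn_def plus_nn_def times_nn_def minus_nn_def del: add_rec)
    (simp_all add: good zero_nn_def one_nn_def plus_nn_def)

lemma nn_less_eq: "(a::nn) < b \<longleftrightarrow> a + 1 \<le> b"
proof
  assume "a < b"
  then have b: "b = a + (b - a)" by simp
  with \<open>a < b\<close> have "b - a \<noteq> 0" by (metis add_0_right less_irrefl)
  then obtain c where "b - a = c + 1" using Z_or_S[of "b - a"] by auto
  then have "b = a + 1 + c" using b(1) by (simp add: ac_simps)
  moreover have "0 \<le> c" using D_A_zero[of zeroc c] by (simp add: good less_eq_nn_def)
  ultimately show "a + 1 \<le> b" by simp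
next
  assume "a + 1 \<le> b"
  moreover have "a < a + 1" by simp
  ultimately show "a < b" by (rule less_le_trans[rotated])
qed

lemma nn_nonneg [simp]: "0 \<le> (n::nn)"
  using D_A_zero[of zeroc n] by (simp add: good less_eq_nn_def)

lemma nn_less_one [simp]: "n < (1::nn) \<longleftrightarrow> n = 0"
  using nn_less_eq[of n 0] nn_less_eq[of 0 n] by (auto simp: nn_less_eq not_less dest: order_antisym)

lemma nn_le_zero [simp]: "n \<le> (0::nn) \<longleftrightarrow> n = 0"
  by (simp add: order_antisym_conv)

lemma nn_not_neg [simp]: "\<not> n < (0::nn)"
  by (simp add: not_less)

lemma nn_add_zero [simp]: "m + n = (0::nn) \<longleftrightarrow> m = 0 \<and> n = 0"
  by (simp add: add_nonneg_eq_0_iff)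

lemma nn_gt_zero [simp]: "0 < n \<longleftrightarrow> n \<noteq> (0::nn)"
  by (simp add: less_le)

lemma nn_diff_zero [simp]: "m - n = (0::nn) \<longleftrightarrow> m \<le> n"
  by (simp add: good less_eq_nn_def)

lemma nn_cases: "n = 0 \<or> (\<exists>m. n = m + (1::nn))"
  using Z_or_S[of n] by auto

lemma nn_less_Suc [simp]: "m < n + 1 \<longleftrightarrow> m \<le> (n::nn)"
  by (simp add: nn_less_eq)

lemma nn_le_Suc: "m \<le> n + 1 \<longleftrightarrow> m \<le> n \<or> m = n + (1::nn)"
  using nn_less_Suc[of m n] by (auto simp: less_le)

lemma \<iota>_nonneg [simp]: "0 \<le> \<iota> n"
  using \<iota>_simps(5)[of 0 n] by simp

lemma dfn_arith [dfns]:
  assumes "dfn F" "dfn G"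
  shows "dfn (\<lambda>p. F p + G p :: nn)" "dfn (\<lambda>p. F p * G p :: nn)" "dfn (\<lambda>p. F p - G p :: nn)"
  using dfn_app[OF dfn_app[OF dfn_const assms(1)] assms(2), of "tc add :: (nn, N1) fn"]
    dfn_app[OF dfn_app[OF dfn_const assms(1)] assms(2), of "tc mult :: (nn, N1) fn"]
    dfn_app[OF dfn_app[OF dfn_const assms(1)] assms(2), of "tc monus :: (nn, N1) fn"] by simp_all

lemma pdI: "dfn f \<Longrightarrow> (\<And>p. P p \<longleftrightarrow> f p = (0::nn)) \<Longrightarrow> pd P"
  by (auto simp: pd_def)

lemma pd_le [dfns]:
  "dfn F \<Longrightarrow> dfn G \<Longrightarrow> pd (\<lambda>p. F p \<le> (G p :: nn))"
  by (rule pdI[of "\<lambda>p. F p - G p"]) (intro dfns, assumption+, simp)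

lemma pd_not [dfns]: "pd P \<Longrightarrow> pd (\<lambda>p. \<not> P p)"
proof -
  assume "pd P"
  then obtain f where f: "dfn f" "\<And>p. P p \<longleftrightarrow> f p = (0::nn)" by (auto simp: pd_def)
  have "dfn (\<lambda>p. 1 - f p)" by (intro dfns f)
  then show ?thesis by (rule pdI) (simp add: f(2) nn_less_eq[of 0, symmetric, simplified])
qed

lemma pd_conj [dfns]: "pd P \<Longrightarrow> pd Q \<Longrightarrow> pd (\<lambda>p. P p \<and> Q p)"
proof -
  assume "pd P" "pd Q"
  then obtain f g where f: "dfn f" "\<And>p. P p \<longleftrightarrow> f p = (0::nn)" and g: "dfn g" "\<And>p. Q p \<longleftrightarrow> g p = (0::nn)"
    by (auto simp: pd_def)
  have "dfn (\<lambda>p. f p + g p)" by (intro dfns f g)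
  then show ?thesis by (rule pdI) (simp add: f(2) g(2))
qed

lemma pd_disj [dfns]: "pd P \<Longrightarrow> pd Q \<Longrightarrow> pd (\<lambda>p. P p \<or> Q p)"
  using pd_not[OF pd_conj[OF pd_not pd_not], of P Q] by simp

lemma pd_imp [dfns]: "pd P \<Longrightarrow> pd Q \<Longrightarrow> pd (\<lambda>p. P p \<longrightarrow> Q p)"
  using pd_disj[OF pd_not, of P Q] by (simp only: imp_conv_disj)

lemma pd_less [dfns]: "dfn F \<Longrightarrow> dfn G \<Longrightarrow> pd (\<lambda>p. F p < (G p :: nn))"
  using pd_not[OF pd_le, of G F] by (simp add: not_le)

lemma pd_eq [dfns]: "dfn F \<Longrightarrow> dfn G \<Longrightarrow> pd (\<lambda>p. F p = (G p :: nn))"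
  using pd_conj[OF pd_le pd_le, of F G G F] by (simp add: order_eq_iff)

lemma exists2: "\<exists>E::N2. \<forall>f. E \<bullet> f = 0 \<longleftrightarrow> (\<exists>n. f \<bullet> n = 0)"
proof -
  have "Sat e0 exists2"
    by (rule Sat_axiom) (auto simp: ACA0\<omega>_def exists2_def le_def denv_wenv)
  then have "\<exists>E::N2. \<forall>f. E \<bullet> f - 1 = 0 \<and> ((\<exists>n. f \<bullet> n = 0) \<longleftrightarrow> E \<bullet> f = 0)"
    by (simp add: exists2_def le_def)
  then show ?thesis by blast
qed

text \<open>The functional from \<open>exists2\<close> is applied to the characteristic function of
  the matrix, abstracted in the number variable. Number quantifiers thus preserve
  definability.\<close>

lemma pd_ex [dfns]: "pd (\<lambda>p :: 'c::ctx \<times> nn. P (fst p) (snd p)) \<Longrightarrow> pd (\<lambda>c. \<exists>n. P c n)"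
proof -
  assume "pd (\<lambda>p :: 'c::ctx \<times> nn. P (fst p) (snd p))"
  then obtain f :: "'c \<times> nn \<Rightarrow> nn" where f: "dfn f" "\<And>p. P (fst p) (snd p) \<longleftrightarrow> f p = 0"
    by (auto simp: pd_def)
  obtain E :: N2 where E: "\<And>f. E \<bullet> f = 0 \<longleftrightarrow> (\<exists>n. f \<bullet> n = 0)" using exists2 by blast
  have 1: "dfn (\<lambda>p :: 'c \<times> nn. f (fst p, snd p))" using f by simp
  note 2 = dfn_LAM0[of "\<lambda>c n. f (c, n)", OF 1]
  show ?thesis
  proof (rule pdI[of "\<lambda>c. E \<bullet> LAM (\<lambda>n. f (c, n))"])
    show "dfn (\<lambda>c. E \<bullet> LAM (\<lambda>n. f (c, n)))" by (rule dfn_app[OF dfn_const conjunct1[OF 2]])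
    show "(\<exists>n. P c n) \<longleftrightarrow> E \<bullet> LAM (\<lambda>n. f (c, n)) = 0" for c
      unfolding E using 2 f(2)[of "(c, _)"] by simp
  qed
qed

lemma pd_all [dfns]: "pd (\<lambda>p :: 'c::ctx \<times> nn. P (fst p) (snd p)) \<Longrightarrow> pd (\<lambda>c. \<forall>n. P c n)"
  using pd_not[OF pd_ex[of "\<lambda>c n. \<not> P c n"], OF pd_not] by simp

lemma dfn_if [dfns]:
  assumes "pd P" "dfn F" "dfn G"
  shows "dfn (\<lambda>p. if P p then F p else G p :: nn)"
proof -
  obtain f where f: "dfn f" "\<And>p. P p \<longleftrightarrow> f p = (0::nn)" using assms by (auto simp: pd_def)
  \<comment> \<open>By truncation \<open>1 - f p\<close> is 1 where \<open>P\<close> holds and 0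
    elsewhere, and \<open>1 - (1 - f p)\<close> is the opposite.\<close>
  have "(if P p then F p else G p) = F p * (1 - f p) + G p * (1 - (1 - f p))" for p
    using f(2)[of p] nn_less_eq[of 0 "f p"] by (auto simp: nn_diff_zero[THEN iffD2])
  moreover have "dfn (\<lambda>p. F p * (1 - f p) + G p * (1 - (1 - f p)))" by (intro dfns assms f)
  ultimately show ?thesis by simp
qed

lemma pd_char:
  assumes "pd (\<lambda>p :: unit \<times> 'a::obj. P (snd p))"
  shows "\<exists>f::('a, nn) fn. \<forall>x. P x \<longleftrightarrow> f \<bullet> x = 0"
proof -
  obtain f :: "unit \<times> 'a \<Rightarrow> nn" where f: "dfn f" "\<And>p. P (snd p) \<longleftrightarrow> f p = 0" using assms by (auto simp: pd_def)
  have "(\<lambda>p :: unit \<times> 'a. f ((), snd p)) = f" by (intro ext) (metis prod.collapse old.unit.exhaust)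
  then have "dfn (\<lambda>p :: unit \<times> 'a. f ((), snd p))" using f(1) by simp
  from LAM_app[OF this] show ?thesis using f(2)[of "((), _)"] by (intro exI[of _ "LAM (\<lambda>x. f ((), x))"]) auto
qed

text \<open>An arithmetical predicate has a characteristic function among the objects, so induction
  for it reduces to induction for the single equation \<open>f \<bullet> n = 0\<close>.\<close>

lemma induct:
  assumes "pd (\<lambda>p :: unit \<times> nn. P (snd p))" "P 0" "\<And>n. P n \<Longrightarrow> P (n + 1)"
  shows "P n"
proof -
  obtain f :: N1 where f: "\<And>x. P x \<longleftrightarrow> f \<bullet> x = 0" using pd_char[OF assms(1)] by blast
  have "f \<bullet> n = 0"
    by (rule ind_eq[of "\<lambda>n. f \<bullet> n" "\<lambda>_. 0"]) (use assms f in \<open>intro dfns | simp\<close>)+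
  then show ?thesis by (simp add: f)
qed

lemma least:
  assumes "pd (\<lambda>p :: unit \<times> nn. P (snd p))" "P n"
  shows "\<exists>n. P n \<and> (\<forall>m<n. \<not> P m)"
proof (rule ccontr)
  assume no: "\<not> ?thesis"
  obtain f :: N1 where f: "P = (\<lambda>x. f \<bullet> x = 0)" using pd_char[OF assms(1)] by blast
  have "\<forall>m\<le>n. \<not> P m" for n
  proof (rule induct[of "\<lambda>n. \<forall>m. m \<le> n \<longrightarrow> \<not> P m"])
    show "pd (\<lambda>p :: unit \<times> nn. \<forall>m. m \<le> snd p \<longrightarrow> \<not> P m)" unfolding f by (intro dfns)
    show "\<forall>m. m \<le> 0 \<longrightarrow> \<not> P m" using no by auto
    show "\<forall>m. m \<le> n + 1 \<longrightarrow> \<not> P m" if "\<forall>m. m \<le> n \<longrightarrow> \<not> P m" for n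
      using no that by (metis nn_le_Suc nn_less_Suc)
  qed
  then show False using assms(2) by blast
qed

text \<open>\<open>QF_AC\<close>, applied to the formula \<open>E(f) = 0 \<longrightarrow> f(n) = 0\<close> with \<open>E\<close> from \<open>(\<exists>\<^sup>2)\<close>, yields Feferman's
  search operator.\<close>

lemma search: "\<exists>\<mu>::N2. \<forall>f. (\<exists>n. f \<bullet> n = 0) \<longrightarrow> f \<bullet> (\<mu> \<bullet> f) = 0"
proof -
  obtain E :: N2 where E: "\<And>f. E \<bullet> f = 0 \<longleftrightarrow> (\<exists>n. f \<bullet> n = 0)" using exists2 by blast
  define \<phi> where "\<phi> = (Eq (Var T2 0 \<cdot> v1 0) Zero \<^bold>\<longrightarrow> Eq (v1 0 \<cdot> v0 0) Zero)"
  have "Sat (push T2 (rep E) e0) ((\<^bold>\<forall>\<^bsub>T1\<^esub> \<^bold>\<exists>\<^bsub>T0\<^esub> \<phi>) \<^bold>\<longrightarrow>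
      (\<^bold>\<exists>\<^bsub>T2\<^esub> \<^bold>\<forall>\<^bsub>T1\<^esub> substf T0 0 (Var T2 0 \<cdot> Var T1 0) (liftf T2 0 \<phi>)))"
    by (intro Sat_rca[OF RCA0\<omega>.QF_AC]) (auto simp: \<phi>_def denv_wenv)
  then have "(\<forall>f::N1. \<exists>n. E \<bullet> f = 0 \<longrightarrow> f \<bullet> n = 0) \<longrightarrow> (\<exists>\<mu>::N2. \<forall>f. E \<bullet> f = 0 \<longrightarrow> f \<bullet> (\<mu> \<bullet> f) = 0)"
    by (simp add: \<phi>_def)
  then show ?thesis using E by blast
qed

text \<open>The search operator, applied to the characteristic function of \<open>P c\<close>,
  selects a number uniformly in the context; this is how functions are later defined from number
  searches.\<close>

lemma choice:
  assumes "pd (\<lambda>p :: 'c::ctx \<times> nn. P (fst p) (snd p))"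
  shows "\<exists>g. dfn g \<and> (\<forall>c. (\<exists>n. P c n) \<longrightarrow> P c (g c))"
proof -
  obtain f :: "'c \<times> nn \<Rightarrow> nn" where f: "dfn f" "\<And>p. P (fst p) (snd p) \<longleftrightarrow> f p = 0"
    using assms by (auto simp: pd_def)
  obtain \<mu> :: N2 where \<mu>: "\<forall>f. (\<exists>n. f \<bullet> n = 0) \<longrightarrow> f \<bullet> (\<mu> \<bullet> f) = 0" using search by blast
  have 1: "dfn (\<lambda>p :: 'c \<times> nn. f (fst p, snd p))" using f by simp
  note 2 = dfn_LAM0[of "\<lambda>c n. f (c, n)", OF 1]
  show ?thesis
  proof (intro exI conjI allI)
    show "dfn (\<lambda>c. \<mu> \<bullet> LAM (\<lambda>n. f (c, n)))" by (rule dfn_app[OF dfn_const conjunct1[OF 2]])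
    show "(\<exists>n. P c n) \<longrightarrow> P c (\<mu> \<bullet> LAM (\<lambda>n. f (c, n)))" for c
      using \<mu>[rule_format, of "LAM (\<lambda>n. f (c, n))"] 2 f(2)[of "(c, _)"] by simp
  qed
qed

end


section \<open>Rational and real numbers of the model\<close>

definition qv :: "nn \<Rightarrow> qq" where
  "qv c = (\<iota> (tc left \<bullet> (tc left \<bullet> c :: nn)) - \<iota> (tc right \<bullet> (tc left \<bullet> c :: nn))) / \<iota> (tc right \<bullet> c + 1)"

definition ep :: "nn \<Rightarrow> qq" where
  "ep n = qv (tc qeps \<bullet> n)"

definition sq :: "N1 \<Rightarrow> nn \<Rightarrow> qq" where
  "sq x n = qv (x \<bullet> n)"

text \<open>\<open>qq\<close> is not a type of objects, so definability of a function with rational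
  values means that codes of its values can be given definably.\<close>

definition rq :: "('c::ctx \<Rightarrow> qq) \<Rightarrow> bool" where
  "rq F \<longleftrightarrow> (\<exists>f. dfn f \<and> (\<forall>p. F p = qv (f p)))"

abbreviation cst :: "nn \<Rightarrow> N1" where
  "cst c \<equiv> (tc (Proj T0 T0) :: (nn, N1) fn) \<bullet> c"

context model
begin

lemma pow2_simps: "tc pow2 \<bullet> (0::nn) = (1::nn)" "tc pow2 \<bullet> (b + 1 :: nn) = (tc pow2 \<bullet> b + tc pow2 \<bullet> b :: nn)"
  using pow2_rec by simp_all

lemma pred_simps [simp]: "tc pred \<bullet> (0::nn) = (0::nn)" "tc pred \<bullet> (b + 1 :: nn) = b"
  using pred_rec by simp_all

lemma isqrt: "tc isqrt \<bullet> n * tc isqrt \<bullet> n \<le> n \<and> n < (tc isqrt \<bullet> n + 1) * (tc isqrt \<bullet> n + 1 :: nn)"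
proof (rule induct[of "\<lambda>n. tc isqrt \<bullet> n * tc isqrt \<bullet> n \<le> n \<and> n < (tc isqrt \<bullet> n + 1) * (tc isqrt \<bullet> n + 1)"])
  show "pd (\<lambda>p :: unit \<times> nn. tc isqrt \<bullet> snd p * tc isqrt \<bullet> snd p \<le> snd p \<and>
      snd p < (tc isqrt \<bullet> snd p + 1) * (tc isqrt \<bullet> snd p + 1))"
    by (intro dfns)
  show "tc isqrt \<bullet> (0::nn) * tc isqrt \<bullet> (0::nn) \<le> (0::nn) \<and>
      0 < (tc isqrt \<bullet> (0::nn) + 1) * (tc isqrt \<bullet> (0::nn) + 1 :: nn)"
    using isqrt_rec(1) by simp
  fix b :: nn
  define u :: nn where "u = tc isqrt \<bullet> b"
  assume "tc isqrt \<bullet> b * tc isqrt \<bullet> b \<le> b \<and> b < (tc isqrt \<bullet> b + 1) * (tc isqrt \<bullet> b + 1)"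
  then have u: "u * u \<le> b" "b + 1 \<le> (u + 1) * (u + 1)" by (auto simp: u_def nn_less_eq)
  have rec: "tc isqrt \<bullet> (b + 1) = (if (u + 1) * (u + 1) \<le> b + 1 then u + 1 else u)"
    using isqrt_rec(2)[of b] by (simp add: Let_def u_def)
  show "tc isqrt \<bullet> (b + 1) * tc isqrt \<bullet> (b + 1) \<le> b + 1 \<and>
     b + 1 < (tc isqrt \<bullet> (b + 1) + 1) * (tc isqrt \<bullet> (b + 1) + 1)"
  proof (cases "(u + 1) * (u + 1) \<le> b + 1")
    case True
    then have "(u + 1) * (u + 1) = b + 1" using u by simp
    moreover have "(u + 1) * (u + 1) < (u + 1 + 1) * (u + 1 + 1)"
      by (intro mult_strict_mono) auto
    ultimately show ?thesis using rec True by simp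
  next
    case False
    then show ?thesis using rec u by (auto simp: not_le intro: order_trans less_imp_le)
  qed
qed

lemma isqrt_eq: "r * r \<le> n \<Longrightarrow> n < (r + 1) * (r + 1) \<Longrightarrow> tc isqrt \<bullet> n = (r::nn)"
proof -
  assume r: "r * r \<le> n" "n < (r + 1) * (r + 1)"
  let ?s = "tc isqrt \<bullet> n :: nn"
  have s: "?s * ?s \<le> n" "n < (?s + 1) * (?s + 1)" using isqrt[of n] by auto
  have "\<not> r < ?s"
  proof
    assume "r < ?s"
    then have "r + 1 \<le> ?s" by (simp add: nn_less_eq)
    then have "(r + 1) * (r + 1) \<le> ?s * ?s" by (intro mult_mono) auto
    then show False using r s by simp
  qed
  moreover have "\<not> ?s < r"
  proof
    assume "?s < r"
    then have "?s + 1 \<le> r" by (simp add: nn_less_eq)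
    then have "(?s + 1) * (?s + 1) \<le> r * r" by (intro mult_mono) auto
    then show False using r s by simp
  qed
  ultimately show ?thesis by simp
qed

section \<open>Pairing and the arithmetic of rational codes\<close>

abbreviation pr :: "nn \<Rightarrow> nn \<Rightarrow> nn" where "pr a b \<equiv> (tc pair :: (nn, N1) fn) \<bullet> a \<bullet> b"
abbreviation lf :: "nn \<Rightarrow> nn" where "lf a \<equiv> (tc left :: N1) \<bullet> a"
abbreviation rg :: "nn \<Rightarrow> nn" where "rg a \<equiv> (tc right :: N1) \<bullet> a"

lemma pair_eq: "pr a b = (a + b) * (a + b) + a"
proof -
  have "rep (pr a b) = rep ((a + b) * (a + b) + a)"
    unfolding pair_def by (subst rep_tc_lam2) simp_all
  then show ?thesis by simp
qed

lemma left_eq: "lf n = n - tc isqrt \<bullet> n * tc isqrt \<bullet> n"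
proof -
  have "rep (lf n) = rep (n - tc isqrt \<bullet> n * tc isqrt \<bullet> n)"
    unfolding left_def by (subst rep_tc_lam) simp_all
  then show ?thesis by simp
qed

lemma right_eq: "rg n = tc isqrt \<bullet> n - lf n"
proof -
  have "rep (rg n) = rep (tc isqrt \<bullet> n - lf n)"
    unfolding right_def by (subst rep_tc_lam) simp_all
  then show ?thesis by simp
qed

lemma unpair [simp]: "lf (pr a b) = a" "rg (pr a b) = b"
proof -
  have "a \<le> a + b" by simp
  \<comment> \<open>Hence \<open>(a + b) * (a + b) + a\<close> stays below the next square, and its
    integer root is \<open>a + b\<close>.\<close>
  then have "a < (a + b) + (a + b) + 1" by (metis add.commute add_increasing nn_less_Suc nn_nonneg)
  then have "(a + b) * (a + b) + a < (a + b) * (a + b) + ((a + b) + (a + b) + 1)" by simp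
  also have "\<dots> = (a + b + 1) * (a + b + 1)" by (simp add: algebra_simps)
  finally have i: "tc isqrt \<bullet> pr a b = a + b"
    by (intro isqrt_eq) (auto simp: pair_eq)
  then show l: "lf (pr a b) = a" by (simp add: left_eq) (simp add: pair_eq)
  show "rg (pr a b) = b" by (simp add: right_eq i l)
qed

abbreviation rt :: "nn \<Rightarrow> nn \<Rightarrow> nn \<Rightarrow> nn" where "rt a b c \<equiv> pr (pr a b) (tc pred \<bullet> c)"

lemma qv_rt: "c \<noteq> 0 \<Longrightarrow> qv (rt a b c) = (\<iota> a - \<iota> b) / \<iota> c"
  using nn_cases[of c] by (auto simp: qv_def)

lemma qv_surj: "\<exists>c. qv c = x"
proof -
  obtain a b c where "0 < c" "x = (\<iota> a - \<iota> b) / \<iota> c" using qq_cases by blast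
  then show ?thesis using qv_rt[of c a b] by auto
qed

lemma \<iota>_eq_0 [simp]: "\<iota> n = 0 \<longleftrightarrow> n = 0"
  using \<iota>_simps(6)[of n 0] by simp

lemma \<iota>_pos [simp]: "0 < \<iota> n \<longleftrightarrow> n \<noteq> 0"
  using \<iota>_simps(7)[of 0 n] by simp

lemma \<iota>_not_neg [simp]: "\<not> \<iota> n < 0"
  by (simp add: not_less)

lemma \<iota>_Suc_pos [simp]: "0 < \<iota> n + 1" "\<iota> n + 1 \<noteq> 0"
proof -
  show "0 < \<iota> n + 1" using \<iota>_nonneg[of n] by (meson add_nonneg_pos zero_less_one)
  then show "\<iota> n + 1 \<noteq> 0" by auto
qed

lemma den_nonzero [simp]: "n + 1 \<noteq> (0::nn)" "(n + 1) * (m + 1) \<noteq> (0::nn)"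
  by simp_all

lemma qv_add [simp]: "qv (tc qadd \<bullet> a \<bullet> b) = qv a + qv b"
proof -
  have "rep (tc qadd \<bullet> a \<bullet> b :: nn) = rep (rt (lf (lf a) * (rg b + 1) + lf (lf b) * (rg a + 1))
      (rg (lf a) * (rg b + 1) + rg (lf b) * (rg a + 1)) ((rg a + 1) * (rg b + 1)))"
    unfolding qadd_def by (subst rep_tc_lam2) simp_all
  then have "qv (tc qadd \<bullet> a \<bullet> b) = (\<iota> (lf (lf a) * (rg b + 1) + lf (lf b) * (rg a + 1)) -
      \<iota> (rg (lf a) * (rg b + 1) + rg (lf b) * (rg a + 1))) / \<iota> ((rg a + 1) * (rg b + 1))"
    by (simp only: rep_inject qv_rt[OF den_nonzero(2)])
  moreover have "(p * v + p' * u - (n * v + n' * u)) / (u * v) = (p - n) / u + (p' - n') / v"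
    if "u \<noteq> 0" "v \<noteq> 0" for p p' n n' u v :: qq using that by (simp add: field_simps)
  ultimately show ?thesis by (simp add: qv_def)
qed

lemma qv_sub [simp]: "qv (tc qsub \<bullet> a \<bullet> b) = qv a - qv b"
proof -
  have "rep (tc qsub \<bullet> a \<bullet> b :: nn) = rep (tc qadd \<bullet> a \<bullet> rt (rg (lf b)) (lf (lf b)) (rg b + 1) :: nn)"
    unfolding qsub_def by (subst rep_tc_lam2) simp_all
  then have "qv (tc qsub \<bullet> a \<bullet> b) = qv a + (\<iota> (rg (lf b)) - \<iota> (lf (lf b))) / \<iota> (rg b + 1)"
    by (simp only: rep_inject qv_add qv_rt[OF den_nonzero(1)])
  also have "(\<iota> (rg (lf b)) - \<iota> (lf (lf b))) / \<iota> (rg b + 1) = - qv b"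
    by (simp add: qv_def minus_divide_left)
  finally show ?thesis by simp
qed

lemma qv_mul [simp]: "qv (tc qmul \<bullet> a \<bullet> b) = qv a * qv b"
proof -
  have "rep (tc qmul \<bullet> a \<bullet> b :: nn) = rep (rt (lf (lf a) * lf (lf b) + rg (lf a) * rg (lf b))
      (lf (lf a) * rg (lf b) + rg (lf a) * lf (lf b)) ((rg a + 1) * (rg b + 1)))"
    unfolding qmul_def by (subst rep_tc_lam2) simp_all
  then have "qv (tc qmul \<bullet> a \<bullet> b) = (\<iota> (lf (lf a) * lf (lf b) + rg (lf a) * rg (lf b)) -
      \<iota> (lf (lf a) * rg (lf b) + rg (lf a) * lf (lf b))) / \<iota> ((rg a + 1) * (rg b + 1))"
    by (simp only: rep_inject qv_rt[OF den_nonzero(2)])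
  moreover have "(p * p' + n * n' - (p * n' + n * p')) / (u * v) = (p - n) / u * ((p' - n') / v)"
    for p p' n n' u v :: qq by (simp add: field_simps)
  ultimately show ?thesis by (simp add: qv_def)
qed

lemma \<iota>_dist: "\<iota> ((a - b) + (b - a)) = \<bar>\<iota> a - \<iota> b\<bar>"
proof (cases "a \<le> b")
  case True
  then have "\<iota> b = \<iota> (b - a) + \<iota> a" by (metis \<iota>_simps(1) le_add_diff_inverse2)
  then show ?thesis using True by simp
next
  case False
  then have "\<iota> a = \<iota> (a - b) + \<iota> b" by (metis \<iota>_simps(1) le_add_diff_inverse2 linear)
  then show ?thesis using False by simp
qed

lemma qv_abs [simp]: "qv (tc qabs \<bullet> a) = \<bar>qv a\<bar>"
proof -
  have "rep (tc qabs \<bullet> a :: nn) = rep (rt ((lf (lf a) - rg (lf a)) + (rg (lf a) - lf (lf a))) 0 (rg a + 1))"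
    unfolding qabs_def by (subst rep_tc_lam) simp_all
  then have "qv (tc qabs \<bullet> a) = (\<bar>\<iota> (lf (lf a)) - \<iota> (rg (lf a))\<bar> - \<iota> 0) / \<iota> (rg a + 1)"
    by (simp only: rep_inject qv_rt[OF den_nonzero(1)] \<iota>_dist)
  then show ?thesis by (simp add: qv_def abs_of_pos)
qed

lemma qv_nat [simp]: "qv (tc qnat \<bullet> n) = \<iota> n"
proof -
  have "rep (tc qnat \<bullet> n :: nn) = rep (rt n 0 1)"
    unfolding qnat_def by (subst rep_tc_lam) simp_all
  then show ?thesis by (simp only: rep_inject) (simp add: qv_rt)
qed

lemma pow2_pos: "tc pow2 \<bullet> (n::nn) \<noteq> (0::nn)"
proof (rule induct[of "\<lambda>n. tc pow2 \<bullet> n \<noteq> (0::nn)"])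
  show "pd (\<lambda>p :: unit \<times> nn. tc pow2 \<bullet> snd p \<noteq> (0::nn))" by (intro dfns)
qed (simp_all add: pow2_simps)

lemma ep_eq: "ep n = 1 / \<iota> (tc pow2 \<bullet> n)"
proof -
  have "rep (tc qeps \<bullet> n :: nn) = rep (rt 1 0 (tc pow2 \<bullet> n))"
    unfolding qeps_def by (subst rep_tc_lam) simp_all
  then show ?thesis by (simp only: rep_inject ep_def) (simp add: qv_rt pow2_pos)
qed

lemma ep_0 [simp]: "ep 0 = 1"
  by (simp add: ep_eq pow2_simps)

lemma ep_Suc: "ep n = 2 * ep (n + 1)"
  unfolding ep_eq pow2_simps \<iota>_simps using pow2_pos[of n] by (simp add: field_simps)

lemma ep_pos [simp]: "0 < ep n"
  by (simp add: ep_eq pow2_pos)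

lemma ep_nonneg [simp]: "0 \<le> ep n" "ep n \<noteq> 0"
  using ep_pos[of n] by (simp_all add: less_imp_le less_imp_neq[THEN not_sym])

lemma pow2_gt: "(n::nn) < (tc pow2 \<bullet> n :: nn)"
proof (rule induct[of "\<lambda>n. n < (tc pow2 \<bullet> n :: nn)"])
  show "pd (\<lambda>p :: unit \<times> nn. snd p < (tc pow2 \<bullet> snd p :: nn))" by (intro dfns)
  fix n assume "n < (tc pow2 \<bullet> n :: nn)"
  then have "n + 1 \<le> tc pow2 \<bullet> n" by (simp add: nn_less_eq)
  then have "n + 1 + (0 + 1) \<le> tc pow2 \<bullet> n + tc pow2 \<bullet> n"
    using pow2_pos[of n] nn_less_eq[of 0 "tc pow2 \<bullet> n"] by (intro add_mono) auto
  then show "n + 1 < (tc pow2 \<bullet> (n + 1) :: nn)" by (simp add: pow2_simps nn_less_eq[of "n + 1"])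
qed (simp add: pow2_simps)

text \<open>The Archimedean property inside the model: a positive numerator is at least 1, and a
  denominator \<open>d\<close> is below the \<open>d\<close>-th power of two. The exponent may be
  nonstandard.\<close>

lemma ep_archimedean: "0 < c \<Longrightarrow> \<exists>n. ep n < c"
proof -
  assume c: "0 < c"
  obtain a b d where d: "0 < d" "c = (\<iota> a - \<iota> b) / \<iota> d" using qq_cases by blast
  then have "\<iota> b < \<iota> a" using c by (simp add: zero_less_divide_iff)
  then have "b + 1 \<le> a" by (simp add: nn_less_eq)
  then have "\<iota> (b + 1) \<le> \<iota> a" by (subst \<iota>_simps(5))
  then have "1 \<le> \<iota> a - \<iota> b" by simp
  then have "1 / \<iota> d \<le> c" using d by (simp add: divide_right_mono)
  moreover have "1 / \<iota> (tc pow2 \<bullet> d) < 1 / \<iota> d"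
    using pow2_gt[of d] d pow2_pos by (intro divide_strict_left_mono) auto
  ultimately show ?thesis by (metis ep_eq less_le_trans)
qed

lemma rqI: "dfn f \<Longrightarrow> (\<And>p. F p = qv (f p)) \<Longrightarrow> rq F"
  by (auto simp: rq_def)

lemma rq_qv [dfns]: "dfn F \<Longrightarrow> rq (\<lambda>p. qv (F p))"
  by (auto simp: rq_def)

lemma rq_const [dfns]: "rq (\<lambda>_. c)"
  using qv_surj[of c] by (metis dfn_const rq_def)

lemma rq_arith [dfns]:
  assumes "rq F" "rq G"
  shows "rq (\<lambda>p. F p + G p)" "rq (\<lambda>p. F p - G p)" "rq (\<lambda>p. F p * G p)"
proof -
  obtain f g where f: "dfn f" "\<And>p. F p = qv (f p)" and g: "dfn g" "\<And>p. G p = qv (g p)"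
    using assms by (auto simp: rq_def)
  show "rq (\<lambda>p. F p + G p)"
    by (rule rqI[of "\<lambda>p. tc qadd \<bullet> f p \<bullet> g p"]) (simp_all add: f g dfn_app dfn_const)
  show "rq (\<lambda>p. F p - G p)"
    by (rule rqI[of "\<lambda>p. tc qsub \<bullet> f p \<bullet> g p"]) (simp_all add: f g dfn_app dfn_const)
  show "rq (\<lambda>p. F p * G p)"
    by (rule rqI[of "\<lambda>p. tc qmul \<bullet> f p \<bullet> g p"]) (simp_all add: f g dfn_app dfn_const)
qed

lemma rq_abs [dfns]: "rq F \<Longrightarrow> rq (\<lambda>p. \<bar>F p\<bar>)"
proof -
  assume "rq F"
  then obtain f where f: "dfn f" "\<And>p. F p = qv (f p)" by (auto simp: rq_def)
  show ?thesis
    by (rule rqI[of "\<lambda>p. tc qabs \<bullet> f p"]) (simp_all add: f dfn_app dfn_const)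
qed

lemma rq_ep [dfns]: "dfn F \<Longrightarrow> rq (\<lambda>p. ep (F p))"
  by (rule rqI[of "\<lambda>p. tc qeps \<bullet> F p"]) (simp_all add: dfn_app dfn_const ep_def)

lemma rq_sq [dfns]: "dfn F \<Longrightarrow> dfn G \<Longrightarrow> rq (\<lambda>p. sq (F p) (G p))"
  unfolding sq_def by (intro dfns)

lemma qle_iff: "lf (lf a) * (rg b + 1) + rg (lf b) * (rg a + 1) \<le> lf (lf b) * (rg a + 1) + rg (lf a) * (rg b + 1)
    \<longleftrightarrow> qv a \<le> qv b"
proof -
  have "qv a \<le> qv b \<longleftrightarrow> \<iota> (lf (lf a) * (rg b + 1) + rg (lf b) * (rg a + 1))
      \<le> \<iota> (lf (lf b) * (rg a + 1) + rg (lf a) * (rg b + 1))"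
    unfolding \<iota>_simps(1-4) by (simp add: qv_def divide_le_eq le_divide_eq) (auto simp add: field_simps)
  then show ?thesis by (simp only: \<iota>_simps(5))
qed

lemma pd_q_le [dfns]: "rq F \<Longrightarrow> rq G \<Longrightarrow> pd (\<lambda>p. F p \<le> G p)"
proof -
  assume "rq F" "rq G"
  then obtain f g where f: "dfn f" "\<And>p. F p = qv (f p)" and g: "dfn g" "\<And>p. G p = qv (g p)"
    by (auto simp: rq_def)
  have "pd (\<lambda>p. lf (lf (f p)) * (rg (g p) + 1) + rg (lf (g p)) * (rg (f p) + 1)
      \<le> lf (lf (g p)) * (rg (f p) + 1) + rg (lf (f p)) * (rg (g p) + 1))"
    by (intro dfns f g)
  then show ?thesis by (simp only: qle_iff f(2) g(2))
qed

lemma pd_q_less [dfns]: "rq F \<Longrightarrow> rq G \<Longrightarrow> pd (\<lambda>p. F p < G p)"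
  using pd_not[OF pd_q_le, of G F] by (simp add: not_le)

lemma pd_q_eq [dfns]: "rq F \<Longrightarrow> rq G \<Longrightarrow> pd (\<lambda>p. F p = G p)"
  using pd_conj[OF pd_q_le pd_q_le, of F G G F] by (simp add: order_eq_iff)

lemma ep_add: "ep (m + n) = ep m * ep n"
proof (rule induct[of "\<lambda>n. ep (m + n) = ep m * ep n"])
  show "pd (\<lambda>p :: unit \<times> nn. ep (m + snd p) = ep m * ep (snd p))" by (intro dfns)
  show "ep (m + (n + 1)) = ep m * ep (n + 1)" if "ep (m + n) = ep m * ep n" for n
    using that ep_Suc[of n] ep_Suc[of "m + n"] by (simp add: ac_simps)
qed simp

lemma ep_le_1: "ep n \<le> 1"
  using pow2_gt[of n] nn_less_eq[of 0 "tc pow2 \<bullet> n"] pow2_pos[of n] \<iota>_simps(5)[of 1 "tc pow2 \<bullet> n"]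
  by (simp add: ep_eq divide_le_eq)

lemma ep_antimono: "m \<le> n \<Longrightarrow> ep n \<le> ep m"
proof -
  assume "m \<le> n"
  then have "n = m + (n - m)" by simp
  then have "ep n = ep m * ep (n - m)" by (metis ep_add)
  then show ?thesis using ep_le_1[of "n - m"] by (simp add: mult_left_le)
qed

lemma ep_strict: "m < n \<Longrightarrow> ep n < ep m"
proof -
  assume "m < n"
  then have "ep n \<le> ep (m + 1)" by (simp add: ep_antimono nn_less_eq)
  then show ?thesis using ep_Suc[of m] ep_pos[of "m + 1"] by linarith
qed

lemma ep_inj: "ep m = ep n \<longleftrightarrow> m = n"
  using ep_strict[of m n] ep_strict[of n m] by (metis less_irrefl linorder_neqE)

end


definition isR :: "N1 \<Rightarrow> bool" where
  "isR x \<longleftrightarrow> (\<forall>n m. \<bar>sq x n - sq x (n + m)\<bar> < ep n)"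

definition rleq :: "N1 \<Rightarrow> N1 \<Rightarrow> bool" where
  "rleq x y \<longleftrightarrow> (\<forall>n. sq x n \<le> sq y n + (ep n + ep n))"

definition requ :: "N1 \<Rightarrow> N1 \<Rightarrow> bool" where
  "requ x y \<longleftrightarrow> (\<forall>n. \<bar>sq x n - sq y n\<bar> \<le> ep n + ep n)"

definition I01 :: "N1 \<Rightarrow> bool" where
  "I01 x \<longleftrightarrow> isR x \<and> (\<forall>n. 0 \<le> sq x n + (ep n + ep n)) \<and> (\<forall>n. sq x n \<le> 1 + (ep n + ep n))"

definition posR :: "N1 \<Rightarrow> bool" where
  "posR x \<longleftrightarrow> isR x \<and> \<not> (\<forall>n. sq x n \<le> ep n + ep n)"

context model
begin

lemma cst_app [simp]: "cst c \<bullet> n = c"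
proof -
  have "val e0 (Proj T0 T0) = rep (tc (Proj T0 T0) :: (nn, N1) fn)" by simp
  then have "rep (cst c \<bullet> n) = rep c"
    using val_Proj[of "rep c" T0 "rep n" T0 e0] by simp
  then show ?thesis by simp
qed

lemma sq_cst [simp]: "sq (cst c) n = qv c"
  by (simp add: sq_def)

lemma sq_add [simp]: "sq (tc radd \<bullet> x \<bullet> y) n = sq x (n + 1) + sq y (n + 1)"
proof -
  have "rep ((tc radd :: (N1, (N1, N1) fn) fn) \<bullet> x \<bullet> y \<bullet> n) = rep (tc qadd \<bullet> (x \<bullet> (n + 1)) \<bullet> (y \<bullet> (n + 1)) :: nn)"
    unfolding radd_def by (subst rep_tc_lam3) simp_all
  then show ?thesis by (simp add: sq_def)
qed

lemma sq_sub [simp]: "sq (tc rsub \<bullet> x \<bullet> y) n = sq x (n + 1) - sq y (n + 1)"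
proof -
  have "rep ((tc rsub :: (N1, (N1, N1) fn) fn) \<bullet> x \<bullet> y \<bullet> n) = rep (tc qsub \<bullet> (x \<bullet> (n + 1)) \<bullet> (y \<bullet> (n + 1)) :: nn)"
    unfolding rsub_def by (subst rep_tc_lam3) simp_all
  then show ?thesis by (simp add: sq_def)
qed

lemma sq_abs [simp]: "sq (tc rabs \<bullet> x) n = \<bar>sq x n\<bar>"
proof -
  have "rep ((tc rabs :: (N1, N1) fn) \<bullet> x \<bullet> n) = rep (tc qabs \<bullet> (x \<bullet> n) :: nn)"
    unfolding rabs_def by (subst rep_tc_lam2) simp_all
  then show ?thesis by (simp add: sq_def)
qed

lemma sq_mul: "\<exists>k. sq (tc rmul \<bullet> x \<bullet> y) n = sq x (n + k) * sq y (n + k)"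
proof -
  let ?k = "lf (lf (tc qabs \<bullet> (x \<bullet> 0))) + lf (lf (tc qabs \<bullet> (y \<bullet> 0))) + (1 + 1)"
  have "rep ((tc rmul :: (N1, (N1, N1) fn) fn) \<bullet> x \<bullet> y \<bullet> n)
      = rep (tc qmul \<bullet> (x \<bullet> (n + ?k)) \<bullet> (y \<bullet> (n + ?k)) :: nn)"
    unfolding rmul_def Let_def by (subst rep_tc_lam3) simp_all
  then show ?thesis by (intro exI[of _ ?k]) (simp add: sq_def)
qed

lemma sq_sum:
  "\<exists>h::(nn, N1) fn. (\<forall>u m. qv (h \<bullet> u \<bullet> m) = qv u + sq (g \<bullet> m) (k + n)) \<and>
    sq (tc rsum \<bullet> g \<bullet> n) k = qv (rec n (tc qnat \<bullet> (0::nn)) h)"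
proof -
  let ?e = "push T0 (rep k) (push T0 (rep n) (push (T0 \<rightarrow> T1) (rep g) e0))"
  let ?t = "v0 1 +\<^sub>Q Var (T0 \<rightarrow> T1) 0 \<cdot> v0 0 \<cdot> (v0 2 +\<^sub>N v0 3)"
  have *: "val (push T0 (rep m) (push T0 (rep u) ?e)) ?t = rep (tc qadd \<bullet> u \<bullet> (g \<bullet> m \<bullet> (k + n)) :: nn)"
    for u m :: nn by simp
  let ?h = "hof (\<lambda>u m. tc qadd \<bullet> u \<bullet> (g \<bullet> m \<bullet> (k + n)))"
  have "rep ((tc rsum :: ((nn, N1) fn, (nn, N1) fn) fn) \<bullet> g \<bullet> n \<bullet> k)
      = rep (rec n (tc qnat \<bullet> (0::nn)) ?h)"
    unfolding rsum_def
    by (rule trans[OF rep_tc_lam3 trans[OF rec_val(1)[OF _ _ _ _ _ _ _ *]]]) (simp_all del: lam.simps)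
  moreover have "?h \<bullet> u \<bullet> m = tc qadd \<bullet> u \<bullet> (g \<bullet> m \<bullet> (k + n))" for u m
    by (rule rec_val(2)[OF _ _ _ _ _ _ _ *, of Zero Zero]) simp_all
  ultimately show ?thesis by (intro exI[of _ ?h]) (simp add: sq_def)
qed

lemma Sat_nat [simp]:
  assumes "denv e" "wt s" "wt t" "tyof s = T0" "tyof t = T0"
  shows "Sat e (s \<le>\<^sub>N t) \<longleftrightarrow> (un (val e s) :: nn) \<le> un (val e t)"
    "Sat e (s <\<^sub>N t) \<longleftrightarrow> (un (val e s) :: nn) < un (val e t)"
    "Sat e (s \<le>\<^sub>Q t) \<longleftrightarrow> qv (un (val e s)) \<le> qv (un (val e t))"
    "Sat e (s <\<^sub>Q t) \<longleftrightarrow> qv (un (val e s)) < qv (un (val e t))"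
proof -
  obtain x y :: nn where xy: "val e s = rep x" "val e t = rep y"
    using assms rep_un[of "val e s", where 'a = nn] rep_un[of "val e t", where 'a = nn]
    by (metis ty_of_nn_def val_dom)
  show "Sat e (s \<le>\<^sub>N t) \<longleftrightarrow> (un (val e s) :: nn) \<le> un (val e t)"
    "Sat e (s <\<^sub>N t) \<longleftrightarrow> (un (val e s) :: nn) < un (val e t)"
    using assms by (simp_all add: le_def lt_def xy nn_less_eq)
  have q: "Sat e (s \<le>\<^sub>Q t) \<longleftrightarrow> qv (un (val e s)) \<le> qv (un (val e t))"
    if st: "denv e" "wt s" "wt t" "tyof s = T0" "tyof t = T0" for s t
  proof -
    obtain x y :: nn where xy: "val e s = rep x" "val e t = rep y"
      using st rep_un[of "val e s", where 'a = nn] rep_un[of "val e t", where 'a = nn]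
      by (metis ty_of_nn_def val_dom)
    show ?thesis using st unfolding qle_def le_def by (simp add: xy qle_iff)
  qed
  show "Sat e (s \<le>\<^sub>Q t) \<longleftrightarrow> qv (un (val e s)) \<le> qv (un (val e t))" using assms by (rule q)
  show "Sat e (s <\<^sub>Q t) \<longleftrightarrow> qv (un (val e s)) < qv (un (val e t))"
  proof -
    have "wff (t \<le>\<^sub>Q s)" using assms by (simp add: qle_def le_def)
    then have "Sat e (s <\<^sub>Q t) \<longleftrightarrow> \<not> Sat e (t \<le>\<^sub>Q s)" unfolding qlt_def by (rule denv_simps(3)[OF assms(1)])
    then show ?thesis using q[of t s] assms by (simp only: not_le)
  qed
qed

end

lemma wff_basic [simp]:
  "wt s \<Longrightarrow> wt t \<Longrightarrow> tyof s = T0 \<Longrightarrow> tyof t = T0 \<Longrightarrow> wff (s \<le>\<^sub>N t)"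
  "wt s \<Longrightarrow> wt t \<Longrightarrow> tyof s = T0 \<Longrightarrow> tyof t = T0 \<Longrightarrow> wff (s <\<^sub>N t)"
  "wt s \<Longrightarrow> wt t \<Longrightarrow> tyof s = T0 \<Longrightarrow> tyof t = T0 \<Longrightarrow> wff (s \<le>\<^sub>Q t)"
  "wt s \<Longrightarrow> wt t \<Longrightarrow> tyof s = T0 \<Longrightarrow> tyof t = T0 \<Longrightarrow> wff (s <\<^sub>Q t)"
  by (simp_all add: le_def lt_def qle_def qlt_def)

lemma wff_real [simp]:
  "wt s \<Longrightarrow> tyof s = T1 \<Longrightarrow> wff (is_real s)"
  "wt s \<Longrightarrow> tyof s = T1 \<Longrightarrow> wff (in01 s)"
  "wt s \<Longrightarrow> tyof s = T1 \<Longrightarrow> wff (pos_real s)"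
  "wt s \<Longrightarrow> tyof s = T1 \<Longrightarrow> wff (binary s)"
  "wt s \<Longrightarrow> wt t \<Longrightarrow> tyof s = T1 \<Longrightarrow> tyof t = T1 \<Longrightarrow> wff (s =\<^sub>R t)"
  "wt s \<Longrightarrow> wt t \<Longrightarrow> tyof s = T1 \<Longrightarrow> tyof t = T1 \<Longrightarrow> wff (s \<le>\<^sub>R t)"
  "wt s \<Longrightarrow> wt t \<Longrightarrow> tyof s = T1 \<Longrightarrow> tyof t = T1 \<Longrightarrow> wff (s <\<^sub>R t)"
  by (simp_all add: is_real_def in01_def pos_real_def binary_def req_def rle_def rlt_def)

context model
begin

lemma val_T1:
  assumes "denv e" "wt t" "tyof t = T1"
  obtains x :: N1 where "val e t = rep x"
  using assms rep_un[of "val e t", where 'a = N1] by (metis ty_of_fn_def ty_of_nn_def val_dom)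

lemma qnat_01 [simp]: "qv (tc qnat \<bullet> (1::nn)) = 1"
  by simp_all

lemma Sat_real [simp]:
  assumes "denv e" "wt t" "tyof t = T1"
  shows "Sat e (is_real t) \<longleftrightarrow> isR (un (val e t))"
    "Sat e (in01 t) \<longleftrightarrow> I01 (un (val e t))"
    "Sat e (pos_real t) \<longleftrightarrow> posR (un (val e t))"
    "Sat e (binary t) \<longleftrightarrow> (\<forall>n. (un (val e t) :: N1) \<bullet> n \<le> (1::nn))"
proof -
  obtain x :: N1 where x: "val e t = rep x" using val_T1[OF assms] .
  show r: "Sat e (is_real t) \<longleftrightarrow> isR (un (val e t))"
    using assms by (simp add: is_real_def isR_def x sq_def ep_def)
  show "Sat e (in01 t) \<longleftrightarrow> I01 (un (val e t))"
    "Sat e (pos_real t) \<longleftrightarrow> posR (un (val e t))"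
    using assms r by (simp_all add: in01_def I01_def pos_real_def posR_def rlt_def rle_def x sq_def ep_def)
  show "Sat e (binary t) \<longleftrightarrow> (\<forall>n. (un (val e t) :: N1) \<bullet> n \<le> (1::nn))"
    using assms by (simp add: binary_def x)
qed

lemma Sat_real2 [simp]:
  assumes "denv e" "wt s" "tyof s = T1" "wt t" "tyof t = T1"
  shows "Sat e (s =\<^sub>R t) \<longleftrightarrow> requ (un (val e s)) (un (val e t))"
    "Sat e (s \<le>\<^sub>R t) \<longleftrightarrow> rleq (un (val e s)) (un (val e t))"
    "Sat e (s <\<^sub>R t) \<longleftrightarrow> \<not> rleq (un (val e t)) (un (val e s))"
proof -
  obtain x :: N1 where x: "val e s = rep x" using val_T1[OF assms(1-3)] .
  obtain y :: N1 where y: "val e t = rep y" using val_T1[OF assms(1,4,5)] .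
  show "Sat e (s =\<^sub>R t) \<longleftrightarrow> requ (un (val e s)) (un (val e t))"
    using assms by (simp add: req_def requ_def x y sq_def ep_def)
  show "Sat e (s \<le>\<^sub>R t) \<longleftrightarrow> rleq (un (val e s)) (un (val e t))"
    "Sat e (s <\<^sub>R t) \<longleftrightarrow> \<not> rleq (un (val e t)) (un (val e s))"
    using assms by (simp_all add: rlt_def rle_def rleq_def x y sq_def ep_def)
qed

lemma pd_isR [dfns]: assumes "dfn F" shows "pd (\<lambda>p. isR (F p))"
  unfolding isR_def by (intro dfns dfn_fst[OF dfn_fst[OF assms]])

lemma pd_requ [dfns]: assumes "dfn F" "dfn G" shows "pd (\<lambda>p. requ (F p) (G p))"
  unfolding requ_def by (intro dfns dfn_fst[OF assms(1)] dfn_fst[OF assms(2)])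

lemma pd_rleq [dfns]: assumes "dfn F" "dfn G" shows "pd (\<lambda>p. rleq (F p) (G p))"
  unfolding rleq_def by (intro dfns dfn_fst[OF assms(1)] dfn_fst[OF assms(2)])

lemma pd_I01 [dfns]: assumes "dfn F" shows "pd (\<lambda>p. I01 (F p))"
  unfolding I01_def by (intro dfns assms dfn_fst[OF assms(1)])

section \<open>Order and equality of reals as statements about limits\<close>

lemma isR_le: "isR x \<Longrightarrow> n \<le> m \<Longrightarrow> \<bar>sq x n - sq x m\<bar> < ep n"
  unfolding isR_def by (metis le_add_diff_inverse)

lemma eventually_ep: "0 < c \<Longrightarrow> \<forall>\<^sub>F n in at_top. ep n < c"
  using ep_archimedean[of c] ep_antimono unfolding eventually_at_top_linorder
  by (meson le_less_trans)

lemma at_top_ex: "\<forall>\<^sub>F n in at_top. R (n::nn) \<Longrightarrow> \<exists>n. R n"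
  unfolding eventually_at_top_linorder by auto

text \<open>If the bound fails at one index \<open>n\<close>, the excess over
  \<open>2 * ep n\<close> outlasts the Cauchy errors of both sequences at all later indices. The
  limit form allows errors to be split and combined without keeping track of indices.\<close>

lemma rleq_iff:
  assumes "isR x" "isR y"
  shows "rleq x y \<longleftrightarrow> (\<forall>c>0. \<forall>\<^sub>F n in at_top. sq x n < sq y n + c)"
proof (intro iffI allI impI)
  fix c :: qq
  assume "rleq x y" "0 < c"
  show "\<forall>\<^sub>F n in at_top. sq x n < sq y n + c"
    using eventually_ep[OF half_gt_zero[OF \<open>0 < c\<close>]]
  proof eventually_elim
    case (elim n)
    then show ?case using \<open>rleq x y\<close>[unfolded rleq_def, rule_format, of n] by linarith
  qed
next
  assume *: "\<forall>c>0. \<forall>\<^sub>F n in at_top. sq x n < sq y n + c"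
  show "rleq x y"
    unfolding rleq_def
  proof (intro allI, rule ccontr)
    fix n assume "\<not> sq x n \<le> sq y n + (ep n + ep n)"
    then have "0 < sq x n - sq y n - (ep n + ep n)" by linarith
    with * have "\<forall>\<^sub>F m in at_top. sq x m < sq y m + (sq x n - sq y n - (ep n + ep n))" by blast
    from at_top_ex[OF eventually_conj[OF this eventually_ge_at_top[of n]]]
    obtain m where "sq x m < sq y m + (sq x n - sq y n - (ep n + ep n))" "n \<le> m" by blast
    then show False using isR_le[OF assms(1), of n m] isR_le[OF assms(2), of n m] by linarith
  qed
qed

lemma not_rleq_iff:
  assumes "isR x" "isR y"
  shows "\<not> rleq y x \<longleftrightarrow> (\<exists>c>0. \<forall>\<^sub>F n in at_top. sq x n + c < sq y n)"
proof
  assume "\<not> rleq y x"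
  then obtain n where n: "sq x n + (ep n + ep n) < sq y n" by (auto simp: rleq_def not_le)
  have "\<forall>\<^sub>F m in at_top. sq x m + (sq y n - sq x n - (ep n + ep n)) < sq y m"
    using eventually_ge_at_top[of n]
  proof eventually_elim
    case (elim m)
    then show ?case using isR_le[OF assms(1), of n m] isR_le[OF assms(2), of n m] by linarith
  qed
  moreover have "0 < sq y n - sq x n - (ep n + ep n)" using n by linarith
  ultimately show "\<exists>c>0. \<forall>\<^sub>F n in at_top. sq x n + c < sq y n" by blast
next
  assume "\<exists>c>0. \<forall>\<^sub>F n in at_top. sq x n + c < sq y n"
  then obtain c where c: "0 < c" "\<forall>\<^sub>F n in at_top. sq x n + c < sq y n" by blast
  show "\<not> rleq y x"
  proof
    assume "rleq y x"
    then have "\<forall>\<^sub>F n in at_top. sq y n < sq x n + c" using c assms by (simp add: rleq_iff)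
    from at_top_ex[OF eventually_conj[OF this c(2)]] show False by auto
  qed
qed

lemma requ_rleq: "requ x y \<longleftrightarrow> rleq x y \<and> rleq y x"
  unfolding requ_def rleq_def abs_le_iff by (auto simp: algebra_simps)

lemma requ_iff:
  assumes "isR x" "isR y"
  shows "requ x y \<longleftrightarrow> (\<forall>c>0. \<forall>\<^sub>F n in at_top. \<bar>sq x n - sq y n\<bar> < c)"
proof
  assume *: "requ x y"
  show "\<forall>c>0. \<forall>\<^sub>F n in at_top. \<bar>sq x n - sq y n\<bar> < c"
  proof (intro allI impI)
    fix c :: qq assume "0 < c"
    with * have "\<forall>\<^sub>F n in at_top. sq x n < sq y n + c" "\<forall>\<^sub>F n in at_top. sq y n < sq x n + c"
      using assms by (auto simp: requ_rleq rleq_iff)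
    then show "\<forall>\<^sub>F n in at_top. \<bar>sq x n - sq y n\<bar> < c" by eventually_elim linarith
  qed
next
  assume *: "\<forall>c>0. \<forall>\<^sub>F n in at_top. \<bar>sq x n - sq y n\<bar> < c"
  have "\<forall>\<^sub>F n in at_top. sq x n < sq y n + c" "\<forall>\<^sub>F n in at_top. sq y n < sq x n + c" if "0 < c" for c
  proof -
    have e: "\<forall>\<^sub>F n in at_top. \<bar>sq x n - sq y n\<bar> < c" using * that by blast
    show "\<forall>\<^sub>F n in at_top. sq x n < sq y n + c" using e by eventually_elim linarith
    show "\<forall>\<^sub>F n in at_top. sq y n < sq x n + c" using e by eventually_elim linarith
  qed
  then show "requ x y" using assms by (auto simp: requ_rleq rleq_iff)
qed

lemma requ_refl: "requ x x"
  by (simp add: requ_def less_imp_le add_nonneg_nonneg)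

lemma requ_sym: "requ x y \<Longrightarrow> requ y x"
  by (simp add: requ_rleq)

lemma rleq_trans:
  assumes "isR x" "isR y" "isR z" "rleq x y" "rleq y z"
  shows "rleq x z"
  unfolding rleq_iff[OF assms(1,3)]
proof (intro allI impI)
  fix c :: qq assume "0 < c"
  then have "\<forall>\<^sub>F n in at_top. sq x n < sq y n + c / 2" "\<forall>\<^sub>F n in at_top. sq y n < sq z n + c / 2"
    using assms by (auto simp: rleq_iff)
  then show "\<forall>\<^sub>F n in at_top. sq x n < sq z n + c"
    by eventually_elim linarith
qed

lemma requ_trans:
  assumes "isR x" "isR y" "isR z" "requ x y" "requ y z"
  shows "requ x z"
  using assms rleq_trans[of x y z] rleq_trans[of z y x] by (auto simp: requ_rleq)

lemma isR_cst [simp]: "isR (cst c)"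
  by (simp add: isR_def)

lemma isR_sub: "isR x \<Longrightarrow> isR y \<Longrightarrow> isR (tc rsub \<bullet> x \<bullet> y)"
  unfolding isR_def[of "tc rsub \<bullet> x \<bullet> y"]
proof (intro allI)
  fix n m assume "isR x" "isR y"
  then have "\<bar>sq x (n + 1) - sq x (n + 1 + m)\<bar> < ep (n + 1)" "\<bar>sq y (n + 1) - sq y (n + 1 + m)\<bar> < ep (n + 1)"
    by (simp_all add: isR_def)
  then show "\<bar>sq (tc rsub \<bullet> x \<bullet> y) n - sq (tc rsub \<bullet> x \<bullet> y) (n + m)\<bar> < ep n"
    using ep_Suc[of n] by (simp add: ac_simps)
qed

abbreviation rdst :: "N1 \<Rightarrow> N1 \<Rightarrow> N1" where
  "rdst x y \<equiv> (tc rabs :: (N1, N1) fn) \<bullet> ((tc rsub :: (N1, (N1, N1) fn) fn) \<bullet> x \<bullet> y)"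

end


section \<open>Finite sums\<close>

context model
begin

text \<open>A sum whose number of terms may be nonstandard, hence formed by the recursor of the
  model on codes of rationals.\<close>

definition T :: "N1 \<Rightarrow> nn \<Rightarrow> qq" where
  "T \<alpha> n = qv (rec n (tc qnat \<bullet> (0::nn)) (LAM (\<lambda>u. LAM (\<lambda>m. tc qadd \<bullet> u \<bullet> (\<alpha> \<bullet> m)))))"

lemma T_0 [simp]: "T \<alpha> 0 = 0"
  using rec_Z by (simp add: T_def)

lemma T_Suc [simp]: "T \<alpha> (n + 1) = T \<alpha> n + qv (\<alpha> \<bullet> n)"
proof -
  have 1: "LAM (\<lambda>m. tc qadd \<bullet> u \<bullet> (\<alpha> \<bullet> m)) \<bullet> m = (tc qadd \<bullet> u \<bullet> (\<alpha> \<bullet> m) :: nn)" for u m :: nn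
    by (rule LAM_app) (intro dfns)
  have "LAM (\<lambda>u. LAM (\<lambda>m. tc qadd \<bullet> u \<bullet> (\<alpha> \<bullet> m))) \<bullet> u = (LAM (\<lambda>m. tc qadd \<bullet> u \<bullet> (\<alpha> \<bullet> m)) :: N1)" for u :: nn
    by (rule LAM_app) (intro dfns)
  then show ?thesis using rec_S by (simp add: T_def 1)
qed

lemma rq_T [dfns]: assumes "dfn F" "dfn G" shows "rq (\<lambda>p. T (F p) (G p))"
  unfolding T_def by (intro dfns assms dfn_fst[OF dfn_fst[OF assms(1)]])

text \<open>\<open>rsum\<close> reads its \<open>n\<close> summands at the index
  \<open>k + n\<close>, so it is enough that \<alpha> lists codes of the approximations at that
  index.\<close>

lemma sq_rsum:
  assumes "\<And>m. m < n \<Longrightarrow> qv (\<alpha> \<bullet> m) = sq (g \<bullet> m) (k + n)"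
  shows "sq (tc rsum \<bullet> g \<bullet> n) k = T \<alpha> n"
proof -
  obtain h :: "(nn, N1) fn" where h: "\<And>u m. qv (h \<bullet> u \<bullet> m) = qv u + sq (g \<bullet> m) (k + n)"
    "sq (tc rsum \<bullet> g \<bullet> n) k = qv (rec n (tc qnat \<bullet> (0::nn)) h)"
    using sq_sum by blast
  have "j \<le> n \<longrightarrow> qv (rec j (tc qnat \<bullet> (0::nn)) h) = T \<alpha> j" for j
  proof (rule induct[of "\<lambda>j. j \<le> n \<longrightarrow> qv (rec j (tc qnat \<bullet> (0::nn)) h) = T \<alpha> j"])
    show "pd (\<lambda>p :: unit \<times> nn. snd p \<le> n \<longrightarrow> qv (rec (snd p) (tc qnat \<bullet> (0::nn)) h) = T \<alpha> (snd p))"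
      by (intro dfns)
    show "(0::nn) \<le> n \<longrightarrow> qv (rec 0 (tc qnat \<bullet> (0::nn)) h) = T \<alpha> 0" using rec_Z by simp
    fix j assume "j \<le> n \<longrightarrow> qv (rec j (tc qnat \<bullet> (0::nn)) h) = T \<alpha> j"
    then show "j + 1 \<le> n \<longrightarrow> qv (rec (j + 1) (tc qnat \<bullet> (0::nn)) h) = T \<alpha> (j + 1)"
      using rec_S h(1) assms by (simp add: nn_less_eq[symmetric])
  qed
  then show ?thesis using h(2) by simp
qed

lemma T_abs_le:
  assumes "\<And>m. m < n \<Longrightarrow> \<bar>qv (\<alpha> \<bullet> m)\<bar> \<le> qv (\<beta> \<bullet> m)"
  shows "\<bar>T \<alpha> n\<bar> \<le> T \<beta> n"
proof -
  have "j \<le> n \<longrightarrow> \<bar>T \<alpha> j\<bar> \<le> T \<beta> j" for j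
  proof (rule induct[of "\<lambda>j. j \<le> n \<longrightarrow> \<bar>T \<alpha> j\<bar> \<le> T \<beta> j"])
    show "pd (\<lambda>p :: unit \<times> nn. snd p \<le> n \<longrightarrow> \<bar>T \<alpha> (snd p)\<bar> \<le> T \<beta> (snd p))" by (intro dfns)
    fix j assume *: "j \<le> n \<longrightarrow> \<bar>T \<alpha> j\<bar> \<le> T \<beta> j"
    show "j + 1 \<le> n \<longrightarrow> \<bar>T \<alpha> (j + 1)\<bar> \<le> T \<beta> (j + 1)"
    proof
      assume "j + 1 \<le> n"
      then have "j < n" by (simp add: nn_less_eq)
      with * have "\<bar>T \<alpha> j\<bar> \<le> T \<beta> j" "\<bar>qv (\<alpha> \<bullet> j)\<bar> \<le> qv (\<beta> \<bullet> j)" using assms by auto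
      then show "\<bar>T \<alpha> (j + 1)\<bar> \<le> T \<beta> (j + 1)" by simp
    qed
  qed simp
  then show ?thesis by blast
qed

lemma T_add:
  assumes "\<And>m. qv (\<gamma> \<bullet> m) = qv (\<alpha> \<bullet> m) + qv (\<beta> \<bullet> m)"
  shows "T \<gamma> n = T \<alpha> n + T \<beta> n"
  by (rule induct[of "\<lambda>n. T \<gamma> n = T \<alpha> n + T \<beta> n"]) (intro dfns | simp add: assms)+

lemma T_mult:
  assumes "\<And>m. qv (\<gamma> \<bullet> m) = c * qv (\<alpha> \<bullet> m)"
  shows "T \<gamma> n = c * T \<alpha> n"
  by (rule induct[of "\<lambda>n. T \<gamma> n = c * T \<alpha> n"]) (intro dfns | simp add: assms distrib_left)+

lemma rq_if [dfns]: assumes "pd P" "rq F" "rq G" shows "rq (\<lambda>p. if P p then F p else G p)"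
proof -
  obtain f g where f: "dfn f" "\<And>p. F p = qv (f p)" and g: "dfn g" "\<And>p. G p = qv (g p)"
    using assms by (auto simp: rq_def)
  show ?thesis
    by (rule rqI[of "\<lambda>p. if P p then f p else g p"]) (simp_all add: f g dfn_if assms)
qed

text \<open>The terms with \<open>y\<^sub>i = b\<close> contribute at most \<open>2 * 2\<^sup>-\<^sup>b\<close>, and \<open>\<Sum>b<B. 2 * 2\<^sup>-\<^sup>b = 4 - 4 * 2\<^sup>-\<^sup>B\<close>.\<close>

lemma sum_ep_le:
  fixes y :: N1
  assumes y: "\<And>i j. i < j \<Longrightarrow> j < n \<Longrightarrow> y \<bullet> i = y \<bullet> j \<Longrightarrow> j = i + 1"
    and \<epsilon>: "\<And>i. qv (\<epsilon> \<bullet> i) = ep (y \<bullet> i)"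
  shows "T \<epsilon> n \<le> 4"
proof -
  \<comment> \<open>The sum is sorted by exponents: \<open>C b\<close> keeps the terms with exponent
    below \<open>b\<close> and replaces the others by zero, so that the bound can be proved by
    induction on \<open>b\<close>.\<close>
  define C where "C = (\<lambda>b. LAM (\<lambda>i. if y \<bullet> i < b then \<epsilon> \<bullet> i else tc qnat \<bullet> (0::nn)))"
  have C: "qv (C b \<bullet> i) = (if y \<bullet> i < b then ep (y \<bullet> i) else 0)" for b i
  proof -
    have "C b \<bullet> i = (if y \<bullet> i < b then \<epsilon> \<bullet> i else tc qnat \<bullet> (0::nn))"
      unfolding C_def by (rule LAM_app) (intro dfns)
    then show ?thesis by (simp add: \<epsilon>)
  qed
  have dC: "dfn (\<lambda>p. C (F p))" if "dfn F" for F :: "'c::ctx \<Rightarrow> nn"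
    unfolding C_def by (intro dfns dfn_fst[OF that])
  have step: "T (C (b + 1)) n \<le> T (C b) n + 2 * ep b" for b
  proof (cases "\<exists>i. i < n \<and> y \<bullet> i = b")
    case False
    then have "y \<bullet> i \<le> b \<longleftrightarrow> y \<bullet> i < b" if "i < n" for i
      using that by (auto simp: le_less)
    then have "\<bar>T (C (b + 1)) n\<bar> \<le> T (C b) n"
      by (intro T_abs_le) (simp add: C)
    then show ?thesis using ep_pos[of b] by linarith
  next
    case True
    then obtain k where "k < n \<and> y \<bullet> k = b" by blast
    moreover have "pd (\<lambda>p :: unit \<times> nn. snd p < n \<and> y \<bullet> snd p = b)" by (intro dfns)
    ultimately obtain i where
      i: "i < n" "y \<bullet> i = b" "\<And>j. j < i \<Longrightarrow> \<not> (j < n \<and> y \<bullet> j = b)"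
      using least[of "\<lambda>i. i < n \<and> y \<bullet> i = b" k] by blast
    \<comment> \<open>An exponent may be shared only by neighbouring indices, which leaves room for
      tags of adjacent subintervals that meet in their common endpoint. With \<open>i\<close> the
      least index with exponent \<open>b\<close>, only \<open>i\<close> and \<open>i + 1\<close> can
      have it.\<close>
    have two: "y \<bullet> j = b \<Longrightarrow> j < n \<Longrightarrow> j = i \<or> j = i + 1" for j
      using y[of i j] i by (metis linorder_neqE)
    \<comment> \<open>The two conditionals count how many of the indices \<open>i\<close> and
      \<open>i + 1\<close> are among the first \<open>j\<close> terms.\<close>
    have "j \<le> n \<longrightarrow> T (C (b + 1)) j
      \<le> T (C b) j + ep b * ((if i < j then 1 else 0) + (if i + 1 < j then 1 else 0))" for j
    proof (rule induct[of "\<lambda>j. j \<le> n \<longrightarrow> T (C (b + 1)) j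
        \<le> T (C b) j + ep b * ((if i < j then 1 else 0) + (if i + 1 < j then 1 else 0))"])
      show "pd (\<lambda>p :: unit \<times> nn. snd p \<le> n \<longrightarrow> T (C (b + 1)) (snd p)
        \<le> T (C b) (snd p) + ep b * ((if i < snd p then 1 else 0) + (if i + 1 < snd p then 1 else 0)))"
        by (intro dfns)
      fix j assume IH: "j \<le> n \<longrightarrow> T (C (b + 1)) j
        \<le> T (C b) j + ep b * ((if i < j then 1 else 0) + (if i + 1 < j then 1 else 0))"
      show "j + 1 \<le> n \<longrightarrow> T (C (b + 1)) (j + 1)
        \<le> T (C b) (j + 1) + ep b * ((if i < j + 1 then 1 else 0) + (if i + 1 < j + 1 then 1 else 0))"
      proof
        assume "j + 1 \<le> n"
        then have j: "j < n" by (simp add: nn_less_eq)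
        have ii: "i < i + 1" by simp
        consider "y \<bullet> j \<noteq> b" | "y \<bullet> j = b" "j = i" | "y \<bullet> j = b" "j = i + 1"
          using two j by blast
        then show "T (C (b + 1)) (j + 1)
          \<le> T (C b) (j + 1) + ep b * ((if i < j + 1 then 1 else 0) + (if i + 1 < j + 1 then 1 else 0))"
        proof cases
          case 1
          then have "qv (C (b + 1) \<bullet> j) = qv (C b \<bullet> j)" by (simp add: C le_less)
          moreover have "(if i < j then 1 else 0) + (if i + 1 < j then 1 else 0)
            \<le> (if i \<le> j then 1 else 0) + (if i + 1 \<le> j then 1 else 0 :: qq)"
            by auto
          then have "ep b * ((if i < j then 1 else 0) + (if i + 1 < j then 1 else 0))
            \<le> ep b * ((if i \<le> j then 1 else 0) + (if i + 1 \<le> j then 1 else 0))"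
            by (rule mult_left_mono) simp
          moreover have "T (C (b + 1)) j
            \<le> T (C b) j + ep b * ((if i < j then 1 else 0) + (if i + 1 < j then 1 else 0))"
            using IH j by simp
          ultimately show ?thesis unfolding T_Suc nn_less_Suc by linarith
        next
          case 2
          then show ?thesis using IH j i ep_pos[of b] ii by (auto simp: C)
        next
          case 3
          then show ?thesis using IH j i ep_pos[of b] ii by (auto simp: C)
        qed
      qed
    qed simp
    from this[of n] have "T (C (b + 1)) n
      \<le> T (C b) n + ep b * ((if i < n then 1 else 0) + (if i + 1 < n then 1 else 0))" by simp
    moreover have "ep b * ((if i < n then 1 else 0) + (if i + 1 < n then 1 else 0)) \<le> ep b * 2"
      by (rule mult_left_mono) simp_all
    ultimately show ?thesis by linarith
  qed
  have le: "T (C b) n \<le> 4 - 4 * ep b" for b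
  proof (rule induct[of "\<lambda>b. T (C b) n \<le> 4 - 4 * ep b"])
    show "pd (\<lambda>p :: unit \<times> nn. T (C (snd p)) n \<le> 4 - 4 * ep (snd p))" by (intro dfns dC)
    have "\<bar>T (C 0) n\<bar> \<le> T (LAM (\<lambda>_. tc qnat \<bullet> (0::nn))) n"
      by (intro T_abs_le) (simp add: C LAM_app dfn_const)
    also have "T (LAM (\<lambda>_. tc qnat \<bullet> (0::nn))) n = 0 * T (C 0) n"
      by (rule T_mult) (simp add: LAM_app dfn_const)
    finally show "T (C 0) n \<le> 4 - 4 * ep 0" by simp
    fix b assume "T (C b) n \<le> 4 - 4 * ep b"
    then show "T (C (b + 1)) n \<le> 4 - 4 * ep (b + 1)" using step[of b] ep_Suc[of b] by simp
  qed
  \<comment> \<open>As \<open>n\<close> may be nonstandard, even the boundedness of the first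
    \<open>m\<close> exponents needs induction in the model.\<close>
  have "\<exists>b. \<forall>i. i < m \<longrightarrow> y \<bullet> i < b" for m
  proof (rule induct[of "\<lambda>m. \<exists>b. \<forall>i. i < m \<longrightarrow> y \<bullet> i < b"])
    show "pd (\<lambda>p :: unit \<times> nn. \<exists>b. \<forall>i. i < snd p \<longrightarrow> y \<bullet> i < b)" by (intro dfns)
    fix m assume "\<exists>b. \<forall>i. i < m \<longrightarrow> y \<bullet> i < b"
    then obtain b where b: "\<forall>i. i < m \<longrightarrow> y \<bullet> i < b" by blast
    have "y \<bullet> i < max b (y \<bullet> m + 1)" if "i < m + 1" for i
    proof (cases "i = m")
      case False
      then have "y \<bullet> i < b" using that b by (simp add: le_less)
      then show ?thesis by (simp add: less_max_iff_disj)
    qed (simp add: less_max_iff_disj)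
    then show "\<exists>b. \<forall>i. i < m + 1 \<longrightarrow> y \<bullet> i < b" by blast
  qed auto
  then obtain b where b: "\<forall>i. i < n \<longrightarrow> y \<bullet> i < b" by blast
  have "\<bar>T \<epsilon> n\<bar> \<le> T (C b) n" using b by (intro T_abs_le) (auto simp: C \<epsilon> less_imp_le)
  then show ?thesis using le[of b] ep_pos[of b] by linarith
qed

end

section \<open>Functions from injections\<close>

definition fun01P :: "(N1, N1) fn \<Rightarrow> bool" where
  "fun01P f \<longleftrightarrow> (\<forall>x. I01 x \<longrightarrow> isR (f \<bullet> x)) \<and>
     (\<forall>x y. I01 x \<and> I01 y \<and> requ x y \<longrightarrow> requ (f \<bullet> x) (f \<bullet> y))"

definition injQP :: "(N1, N1) fn \<Rightarrow> bool" where
  "injQP f \<longleftrightarrow> (\<forall>x. I01 x \<longrightarrow> (\<exists>c. requ (f \<bullet> x) (cst c))) \<and>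
     (\<forall>x y. I01 x \<and> I01 y \<and> requ (f \<bullet> x) (f \<bullet> y) \<longrightarrow> requ x y)"

definition injN :: "N2 \<Rightarrow> bool" where
  "injN Y \<longleftrightarrow> (\<forall>x y. I01 x \<and> I01 y \<longrightarrow> (requ x y \<longrightarrow> Y \<bullet> x = Y \<bullet> y) \<and> (Y \<bullet> x = Y \<bullet> y \<longrightarrow> requ x y))"

definition partP :: "(nn, N1) fn \<Rightarrow> nn \<Rightarrow> bool" where
  "partP x n \<longleftrightarrow> requ (x \<bullet> 0) (cst (tc qnat \<bullet> (0::nn))) \<and> requ (x \<bullet> n) (cst (tc qnat \<bullet> (1::nn))) \<and>
     (\<forall>i. i \<le> n \<longrightarrow> isR (x \<bullet> i)) \<and> (\<forall>i. i < n \<longrightarrow> \<not> rleq (x \<bullet> (i + 1)) (x \<bullet> i))"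

context model
begin

lemma I01_rleq: "I01 x \<longleftrightarrow> isR x \<and> rleq (cst (tc qnat \<bullet> (0::nn))) x \<and> rleq x (cst (tc qnat \<bullet> (1::nn)))"
  by (simp add: I01_def rleq_def)

lemma I01_isR: "I01 x \<Longrightarrow> isR x"
  by (simp add: I01_def)

lemma I01_cong: "I01 x \<Longrightarrow> isR y \<Longrightarrow> requ x y \<Longrightarrow> I01 y"
  unfolding I01_rleq requ_rleq
  using rleq_trans[of _ x y] rleq_trans[of y x] by (meson isR_cst)

text \<open>The number assigned to \<open>x\<close> is the least code of the rational \<open>f(x)\<close>.\<close>

lemma injQ_injN:
  assumes "fun01P f" "injQP f"
  shows "\<exists>Y. injN Y"
proof -
  let ?P = "\<lambda>x c. I01 x \<longrightarrow> requ (f \<bullet> x) (cst c) \<and> (\<forall>d. d < c \<longrightarrow> \<not> requ (f \<bullet> x) (cst d))"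
  have "pd (\<lambda>p :: (unit \<times> N1) \<times> nn. ?P (snd (fst p)) (snd p))" by (intro dfns)
  from choice[OF this] obtain g :: "unit \<times> N1 \<Rightarrow> nn"
    where g: "dfn g" "\<And>c. (\<exists>n. ?P (snd c) n) \<Longrightarrow> ?P (snd c) (g c)" by blast
  define Y where "Y = LAM (\<lambda>x. g ((), x))"
  have "(\<lambda>p :: unit \<times> N1. g ((), snd p)) = g" by (intro ext) (metis prod.collapse old.unit.exhaust)
  then have "dfn (\<lambda>p :: unit \<times> N1. g ((), snd p))" using g(1) by simp
  then have Y: "Y \<bullet> x = g ((), x)" for x unfolding Y_def by (rule LAM_app)
  have P: "requ (f \<bullet> x) (cst (Y \<bullet> x)) \<and> (\<forall>d. d < Y \<bullet> x \<longrightarrow> \<not> requ (f \<bullet> x) (cst d))" if x: "I01 x" for x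
  proof -
    obtain c where "requ (f \<bullet> x) (cst c)" using assms(2) x by (auto simp: injQP_def)
    moreover have "pd (\<lambda>p :: unit \<times> nn. requ (f \<bullet> x) (cst (snd p)))" by (intro dfns)
    ultimately have "\<exists>n. ?P x n" using least[of "\<lambda>c. requ (f \<bullet> x) (cst c)" c] by blast
    then show ?thesis using g(2)[of "((), x)"] x by (simp add: Y)
  qed
  have "injN Y"
    unfolding injN_def
  proof (intro allI impI conjI)
    fix x y assume xy: "I01 x \<and> I01 y"
    then have R: "isR (f \<bullet> x)" "isR (f \<bullet> y)" using assms(1) by (auto simp: fun01P_def)
    note tr = requ_trans[OF R(1,2) isR_cst] requ_trans[OF R(2,1) isR_cst]
    { assume "requ x y"
      then have e: "requ (f \<bullet> x) (f \<bullet> y)" "requ (f \<bullet> y) (f \<bullet> x)"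
        using assms(1) xy requ_sym by (auto simp: fun01P_def)
      \<comment> \<open>The two values have the same codes, hence the same least code.\<close>
      then have "requ (f \<bullet> x) (cst c) \<longleftrightarrow> requ (f \<bullet> y) (cst c)" for c using tr by blast
      then show "Y \<bullet> x = Y \<bullet> y" using P xy by (metis linorder_neqE) }
    { assume "Y \<bullet> x = Y \<bullet> y"
      then have "requ (f \<bullet> x) (cst (Y \<bullet> x))" "requ (cst (Y \<bullet> x)) (f \<bullet> y)"
        using P[of x] P[of y] xy requ_sym[of "f \<bullet> y"] by metis+
      then have "requ (f \<bullet> x) (f \<bullet> y)" using requ_trans[OF R(1) isR_cst R(2)] by blast
      then show "requ x y" using assms(2) xy by (auto simp: injQP_def) }
  qed
  then show ?thesis by blast
qed

lemma rless_imp_rleq: "isR x \<Longrightarrow> isR y \<Longrightarrow> \<not> rleq y x \<Longrightarrow> rleq x y"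
proof -
  assume x: "isR x" "isR y" "\<not> rleq y x"
  then obtain c where c: "0 < c" "\<forall>\<^sub>F n in at_top. sq x n + c < sq y n"
    unfolding not_rleq_iff[OF x(1,2)] by blast
  show ?thesis
    unfolding rleq_iff[OF x(1,2)]
  proof (intro allI impI)
    fix d :: qq assume "0 < d"
    show "\<forall>\<^sub>F n in at_top. sq x n < sq y n + d"
      using c(2) by eventually_elim (use \<open>0 < c\<close> \<open>0 < d\<close> in linarith)
  qed
qed

lemma partP_mono:
  assumes "partP x n" "i \<le> j" "j \<le> n"
  shows "rleq (x \<bullet> i) (x \<bullet> j)"
proof -
  have "i \<le> j \<longrightarrow> j \<le> n \<longrightarrow> rleq (x \<bullet> i) (x \<bullet> j)" for j
  proof (rule induct[of "\<lambda>j. i \<le> j \<longrightarrow> j \<le> n \<longrightarrow> rleq (x \<bullet> i) (x \<bullet> j)"])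
    show "pd (\<lambda>p :: unit \<times> nn. i \<le> snd p \<longrightarrow> snd p \<le> n \<longrightarrow> rleq (x \<bullet> i) (x \<bullet> snd p))" by (intro dfns)
    show "i \<le> 0 \<longrightarrow> 0 \<le> n \<longrightarrow> rleq (x \<bullet> i) (x \<bullet> 0)" using requ_refl requ_rleq by auto
    fix j assume IH: "i \<le> j \<longrightarrow> j \<le> n \<longrightarrow> rleq (x \<bullet> i) (x \<bullet> j)"
    show "i \<le> j + 1 \<longrightarrow> j + 1 \<le> n \<longrightarrow> rleq (x \<bullet> i) (x \<bullet> (j + 1))"
    proof (intro impI)
      assume ij: "i \<le> j + 1" "j + 1 \<le> n"
      show "rleq (x \<bullet> i) (x \<bullet> (j + 1))"
      proof (cases "i \<le> j")
        case True
        have "j < n" using ij by (simp add: nn_less_eq)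
        then have R: "isR (x \<bullet> i)" "isR (x \<bullet> j)" "isR (x \<bullet> (j + 1))" "rleq (x \<bullet> j) (x \<bullet> (j + 1))"
          using assms(1) True ij by (auto simp: partP_def intro!: rless_imp_rleq)
        show ?thesis using IH True \<open>j < n\<close> by (intro rleq_trans[OF R(1-3) _ R(4)]) auto
      next
        case False
        then have "i = j + 1" using ij by (simp add: nn_le_Suc)
        then show ?thesis using requ_refl requ_rleq by auto
      qed
    qed
  qed
  then show ?thesis using assms by blast
qed

lemma partP_I01: "partP x n \<Longrightarrow> i \<le> n \<Longrightarrow> I01 (x \<bullet> i)"
proof -
  assume p: "partP x n" and i: "i \<le> n"
  have R: "isR (x \<bullet> 0)" "isR (x \<bullet> i)" "isR (x \<bullet> n)" using p i by (auto simp: partP_def)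
  have "rleq (cst (tc qnat \<bullet> (0::nn))) (x \<bullet> i)"
    using rleq_trans[OF isR_cst R(1,2) _ partP_mono[OF p _ i]] p by (auto simp: partP_def requ_rleq)
  moreover have "rleq (x \<bullet> i) (cst (tc qnat \<bullet> (1::nn)))"
    using rleq_trans[OF R(2,3) isR_cst partP_mono[OF p i]] p by (auto simp: partP_def requ_rleq)
  ultimately show ?thesis using R by (simp add: I01_rleq)
qed

lemma partP_strict:
  assumes p: "partP x n" and ij: "i < j" "j \<le> n"
  shows "\<not> rleq (x \<bullet> j) (x \<bullet> i)"
proof
  assume *: "rleq (x \<bullet> j) (x \<bullet> i)"
  have "i + 1 \<le> j" "i < n" using ij by (auto simp: nn_less_eq)
  then have R: "isR (x \<bullet> (i + 1))" "isR (x \<bullet> j)" "isR (x \<bullet> i)" using p ij by (auto simp: partP_def)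
  have "rleq (x \<bullet> (i + 1)) (x \<bullet> i)"
    using rleq_trans[OF R partP_mono[OF p] *] \<open>i + 1 \<le> j\<close> ij by blast
  then show False using p \<open>i < n\<close> by (auto simp: partP_def)
qed

end

locale injection = model +
  fixes Y :: N2
  assumes Y: "injN Y"
begin

text \<open>The default 0 outside [0,1] makes \<open>fpos\<close> an extensional function on all
  reals, as \<open>funR\<close> demands for item (2).\<close>

definition Y' :: "N1 \<Rightarrow> nn" where
  "Y' x = (if I01 x then Y \<bullet> x else 0)"

text \<open>The values are constant sequences of rationals, so their approximations at every index
  are exact and the estimates can be made termwise.\<close>

definition fpos :: "(N1, N1) fn" where
  "fpos = LAM (\<lambda>x. cst (tc qeps \<bullet> Y' x))"

definition fneg :: "(N1, N1) fn" where
  "fneg = LAM (\<lambda>x. cst (tc qsub \<bullet> (tc qnat \<bullet> (0::nn) :: nn) \<bullet> (tc qeps \<bullet> Y' x :: nn)))"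

lemma dfn_Y' [dfns]: assumes "dfn X" shows "dfn (\<lambda>p. Y' (X p))"
  unfolding Y'_def by (intro dfns assms)

lemma fpos_app: "fpos \<bullet> x = cst (tc qeps \<bullet> Y' x)"
  unfolding fpos_def by (rule LAM_app) (intro dfns)

lemma fneg_app: "fneg \<bullet> x = cst (tc qsub \<bullet> (tc qnat \<bullet> (0::nn) :: nn) \<bullet> (tc qeps \<bullet> Y' x :: nn))"
  unfolding fneg_def by (rule LAM_app) (intro dfns)

lemma sq_fpos [simp]: "sq (fpos \<bullet> x) n = ep (Y' x)"
  by (simp add: fpos_app ep_def)

lemma sq_fneg [simp]: "sq (fneg \<bullet> x) n = - ep (Y' x)"
  by (simp add: fneg_app ep_def)

lemma isR_fpos [simp]: "isR (fpos \<bullet> x)" and isR_fneg [simp]: "isR (fneg \<bullet> x)"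
  by (simp_all add: fpos_app fneg_app)

lemma Y_iff: "I01 x \<Longrightarrow> I01 y \<Longrightarrow> requ x y \<longleftrightarrow> Y \<bullet> x = Y \<bullet> y"
  using Y unfolding injN_def by blast

lemma Y'_cong: "isR x \<Longrightarrow> isR y \<Longrightarrow> requ x y \<Longrightarrow> Y' x = Y' y"
proof -
  assume x: "isR x" "isR y" "requ x y"
  then have "I01 x \<longleftrightarrow> I01 y" using I01_cong[of x y] I01_cong[of y x] requ_sym[of x y] by blast
  then show ?thesis using Y_iff[of x y] x by (simp add: Y'_def)
qed

lemma Y'_inj: "I01 x \<Longrightarrow> I01 y \<Longrightarrow> Y' x = Y' y \<Longrightarrow> requ x y"
  using Y_iff[of x y] by (simp add: Y'_def)

lemma requ_const: "(\<And>n. sq x n = a) \<Longrightarrow> (\<And>n. sq y n = b) \<Longrightarrow> isR x \<Longrightarrow> isR y \<Longrightarrow> requ x y \<longleftrightarrow> a = b"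
proof -
  assume *: "\<And>n. sq x n = a" "\<And>n. sq y n = b" "isR x" "isR y"
  have "a = b" if "\<forall>c>0. \<forall>\<^sub>F n::nn in at_top. \<bar>a - b\<bar> < c"
  proof (rule ccontr)
    assume "a \<noteq> b"
    then have "\<forall>\<^sub>F n::nn in at_top. \<bar>a - b\<bar> < \<bar>a - b\<bar>" using that[rule_format, of "\<bar>a - b\<bar>"] by simp
    then show False using at_top_ex by blast
  qed
  then show ?thesis using * by (auto simp: requ_iff)
qed

lemma funR_fpos: "requ x y \<Longrightarrow> isR x \<Longrightarrow> isR y \<Longrightarrow> requ (fpos \<bullet> x) (fpos \<bullet> y)"
  using requ_const[of "fpos \<bullet> x" "ep (Y' x)" "fpos \<bullet> y" "ep (Y' y)"] Y'_cong by simp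

lemma fpos_fneg_props: "fun01P fpos" "injQP fpos" "fun01P fneg" "injQP fneg"
proof -
  have eF: "requ (fpos \<bullet> x) (fpos \<bullet> y) \<longleftrightarrow> Y' x = Y' y" for x y
    using requ_const[of "fpos \<bullet> x" "ep (Y' x)" "fpos \<bullet> y" "ep (Y' y)"] by (simp add: ep_inj)
  have eG: "requ (fneg \<bullet> x) (fneg \<bullet> y) \<longleftrightarrow> Y' x = Y' y" for x y
    using requ_const[of "fneg \<bullet> x" "- ep (Y' x)" "fneg \<bullet> y" "- ep (Y' y)"] by (simp add: ep_inj)
  have "\<exists>c. requ (fpos \<bullet> x) (cst c)" "\<exists>c. requ (fneg \<bullet> x) (cst c)" for x
    using requ_refl unfolding fpos_app fneg_app by blast+
  then show "fun01P fpos" "injQP fpos" "fun01P fneg" "injQP fneg"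
    unfolding fun01P_def injQP_def eF eG using Y'_cong Y'_inj I01_isR by auto
qed

text \<open>The variation over a partition is at most \<open>\<Sum>i<n. f(x\<^sub>i) + f(x\<^sub>i\<^sub>+\<^sub>1) \<le> 4 + 4\<close>.\<close>

lemma bv_fpos:
  assumes p: "partP x n" and g: "\<And>i. g \<bullet> i = rdst (fpos \<bullet> (x \<bullet> i)) (fpos \<bullet> (x \<bullet> (i + 1)))"
    and k: "\<iota> k = 8"
  shows "rleq (tc rsum \<bullet> g \<bullet> n) (cst (tc qnat \<bullet> k))"
proof -
  define \<epsilon> where "\<epsilon> = LAM (\<lambda>i. tc qeps \<bullet> Y' (x \<bullet> i) :: nn)"
  define \<epsilon>' where "\<epsilon>' = LAM (\<lambda>i. tc qeps \<bullet> Y' (x \<bullet> (i + 1)) :: nn)"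
  define y where "y = LAM (\<lambda>i. Y' (x \<bullet> i))"
  define y' where "y' = LAM (\<lambda>i. Y' (x \<bullet> (i + 1)))"
  have y: "y \<bullet> i = Y' (x \<bullet> i)" for i unfolding y_def by (rule LAM_app) (intro dfns)
  have y': "y' \<bullet> i = Y' (x \<bullet> (i + 1))" for i unfolding y'_def by (rule LAM_app) (intro dfns)
  have "\<epsilon> \<bullet> i = tc qeps \<bullet> Y' (x \<bullet> i)" for i unfolding \<epsilon>_def by (rule LAM_app) (intro dfns)
  then have \<epsilon>: "qv (\<epsilon> \<bullet> i) = ep (Y' (x \<bullet> i))" for i by (simp add: ep_def)
  have "\<epsilon>' \<bullet> i = tc qeps \<bullet> Y' (x \<bullet> (i + 1))" for i unfolding \<epsilon>'_def by (rule LAM_app) (intro dfns)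
  then have \<epsilon>': "qv (\<epsilon>' \<bullet> i) = ep (Y' (x \<bullet> (i + 1)))" for i by (simp add: ep_def)
  \<comment> \<open>Division points with different indices are different reals of [0,1], so
    injectivity separates their exponents.\<close>
  have ne: "Y' (x \<bullet> i) \<noteq> Y' (x \<bullet> j)" if "i < j" "j \<le> n" for i j
    using Y'_inj[of "x \<bullet> i" "x \<bullet> j"] partP_I01[OF p, of i] partP_I01[OF p, of j] partP_strict[OF p that] that
    by (auto simp: requ_rleq)
  have 1: "T \<epsilon> n \<le> 4"
    using ne less_imp_le by (intro sum_ep_le[of n y]) (auto simp: y \<epsilon>)
  have 2: "T \<epsilon>' n \<le> 4"
  proof (rule sum_ep_le[of n y'])
    fix i j assume "i < j" "j < n" "y' \<bullet> i = y' \<bullet> j"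
    then show "j = i + 1" using ne[of "i + 1" "j + 1"] by (simp add: y' nn_less_eq[symmetric])
  qed (simp add: y' \<epsilon>')
  define \<sigma> where "\<sigma> = LAM (\<lambda>i. tc qadd \<bullet> (\<epsilon> \<bullet> i) \<bullet> (\<epsilon>' \<bullet> i) :: nn)"
  have "\<sigma> \<bullet> i = tc qadd \<bullet> (\<epsilon> \<bullet> i) \<bullet> (\<epsilon>' \<bullet> i)" for i unfolding \<sigma>_def by (rule LAM_app) (intro dfns)
  then have \<sigma>: "qv (\<sigma> \<bullet> i) = qv (\<epsilon> \<bullet> i) + qv (\<epsilon>' \<bullet> i)" for i by simp
  \<comment> \<open>Index 0 will do for every approximation of the sum, as the distances between
    values of \<open>fpos\<close> are constant sequences.\<close>
  define \<alpha> where "\<alpha> = LAM (\<lambda>i. g \<bullet> i \<bullet> (0::nn))"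
  have "\<alpha> \<bullet> i = g \<bullet> i \<bullet> 0" for i unfolding \<alpha>_def by (rule LAM_app) (intro dfns)
  then have \<alpha>: "qv (\<alpha> \<bullet> i) = \<bar>ep (Y' (x \<bullet> i)) - ep (Y' (x \<bullet> (i + 1)))\<bar>" for i
    by (simp add: g sq_def[symmetric])
  have "sq (tc rsum \<bullet> g \<bullet> n) m \<le> 8" for m
  proof -
    have "sq (tc rsum \<bullet> g \<bullet> n) m = T \<alpha> n" by (rule sq_rsum) (simp add: \<alpha> g)
    also have "\<dots> \<le> \<bar>T \<alpha> n\<bar>" by simp
    also have "\<dots> \<le> T \<sigma> n"
    proof (rule T_abs_le)
      fix i
      show "\<bar>qv (\<alpha> \<bullet> i)\<bar> \<le> qv (\<sigma> \<bullet> i)"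
        using ep_pos[of "Y' (x \<bullet> i)"] ep_pos[of "Y' (x \<bullet> (i + 1))"]
        unfolding \<alpha> \<sigma> \<epsilon> \<epsilon>' by linarith
    qed
    also have "T \<sigma> n = T \<epsilon> n + T \<epsilon>' n" by (rule T_add) (rule \<sigma>)
    also have "\<dots> \<le> 8" using 1 2 by linarith
    finally show ?thesis .
  qed
  then have "sq (tc rsum \<bullet> g \<bullet> n) m \<le> 8 + (ep m + ep m)" for m
    using ep_pos[of m] by (meson add_increasing2 add_nonneg_nonneg less_imp_le)
  then show ?thesis by (simp add: rleq_def k)
qed

text \<open>Every subinterval is shorter than \<open>r\<close> up to approximation errors, and the
  values at the tags add up to at most 4 by \<open>sum_ep_le\<close>. So the sum is small with the
  mesh, independently of the number of subintervals.\<close>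

lemma riemann_fpos:
  assumes r: "0 < r" and \<delta>: "\<And>k. sq \<delta> k = r" "isR \<delta>" and p: "partP x n"
    and t: "\<And>i. i < n \<Longrightarrow> isR (t \<bullet> i) \<and> rleq (x \<bullet> i) (t \<bullet> i) \<and> rleq (t \<bullet> i) (x \<bullet> (i + 1)) \<and>
      \<not> rleq \<delta> (tc rsub \<bullet> (x \<bullet> (i + 1)) \<bullet> (x \<bullet> i))"
    and g: "\<And>i. g \<bullet> i = (tc rmul :: (N1, (N1, N1) fn) fn) \<bullet> (fpos \<bullet> (t \<bullet> i)) \<bullet> (tc rsub \<bullet> (x \<bullet> (i + 1)) \<bullet> (x \<bullet> i))"
  shows "\<bar>sq (tc rsum \<bullet> g \<bullet> n) k\<bar> \<le> 4 * (r + 2 * ep k)"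
proof -
  define \<epsilon> where "\<epsilon> = LAM (\<lambda>i. tc qeps \<bullet> Y' (t \<bullet> i) :: nn)"
  define y where "y = LAM (\<lambda>i. Y' (t \<bullet> i))"
  have y: "y \<bullet> i = Y' (t \<bullet> i)" for i unfolding y_def by (rule LAM_app) (intro dfns)
  have "\<epsilon> \<bullet> i = tc qeps \<bullet> Y' (t \<bullet> i)" for i unfolding \<epsilon>_def by (rule LAM_app) (intro dfns)
  then have \<epsilon>: "qv (\<epsilon> \<bullet> i) = ep (Y' (t \<bullet> i))" for i by (simp add: ep_def)
  have xR: "isR (x \<bullet> i)" "isR (x \<bullet> (i + 1))" if "i < n" for i
    using p that nn_less_eq[of i n] less_imp_le[OF that] by (auto simp: partP_def)
  have I: "I01 (t \<bullet> i)" if "i < n" for i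
  proof -
    have "I01 (x \<bullet> i)" "I01 (x \<bullet> (i + 1))" using partP_I01[OF p] that nn_less_eq[of i n] less_imp_le by blast+
    then show ?thesis using t[OF that] unfolding I01_rleq
      using rleq_trans[of _ "x \<bullet> i" "t \<bullet> i"] rleq_trans[of "t \<bullet> i" "x \<bullet> (i + 1)"] by (meson isR_cst)
  qed
  have 1: "T \<epsilon> n \<le> 4"
  proof (rule sum_ep_le[of n y])
    fix i j assume ij: "i < j" "j < n" "y \<bullet> i = y \<bullet> j"
    then have i: "i < n" by simp
    have e: "requ (t \<bullet> i) (t \<bullet> j)" using ij I[OF i] I[OF ij(2)] by (intro Y'_inj) (auto simp: y)
    \<comment> \<open>Equal exponents mean equal tags. If the subintervals were not adjacent, the
      common tag would lie at most at \<open>x \<bullet> (i + 1)\<close> and at least at the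
      strictly larger \<open>x \<bullet> j\<close>.\<close>
    show "j = i + 1"
    proof (rule ccontr)
      assume "j \<noteq> i + 1"
      then have "i + 1 < j" using ij(1) nn_less_eq[of i j] by simp
      then have "\<not> rleq (x \<bullet> j) (x \<bullet> (i + 1))" using partP_strict[OF p] ij by (simp add: less_imp_le)
      moreover have "rleq (x \<bullet> j) (t \<bullet> i)"
        using rleq_trans[of "x \<bullet> j" "t \<bullet> j" "t \<bullet> i"] e t[OF i] t[OF ij(2)] xR[OF ij(2)] by (auto simp: requ_rleq)
      then have "rleq (x \<bullet> j) (x \<bullet> (i + 1))"
        using rleq_trans[of "x \<bullet> j" "t \<bullet> i" "x \<bullet> (i + 1)"] t[OF i] xR[OF i] xR[OF ij(2)] by auto
      ultimately show False by blast
    qed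
  qed (simp add: y \<epsilon>)
  define \<alpha> where "\<alpha> = LAM (\<lambda>i. g \<bullet> i \<bullet> (k + n))"
  have "\<alpha> \<bullet> i = g \<bullet> i \<bullet> (k + n)" for i unfolding \<alpha>_def by (rule LAM_app) (intro dfns)
  then have \<alpha>: "qv (\<alpha> \<bullet> i) = sq (g \<bullet> i) (k + n)" for i by (simp add: sq_def)
  obtain c where c: "qv c = r + 2 * ep k" using qv_surj by blast
  define \<gamma> where "\<gamma> = LAM (\<lambda>i. tc qmul \<bullet> c \<bullet> (\<epsilon> \<bullet> i) :: nn)"
  have "\<gamma> \<bullet> i = tc qmul \<bullet> c \<bullet> (\<epsilon> \<bullet> i)" for i unfolding \<gamma>_def by (rule LAM_app) (intro dfns)
  then have \<gamma>: "qv (\<gamma> \<bullet> i) = (r + 2 * ep k) * qv (\<epsilon> \<bullet> i)" for i by (simp add: c)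
  have "\<bar>sq (tc rsum \<bullet> g \<bullet> n) k\<bar> = \<bar>T \<alpha> n\<bar>" by (subst sq_rsum) (simp_all add: \<alpha>)
  also have "\<dots> \<le> T \<gamma> n"
  proof (rule T_abs_le)
    fix i assume i: "i < n"
    let ?d = "(tc rsub :: (N1, (N1, N1) fn) fn) \<bullet> (x \<bullet> (i + 1)) \<bullet> (x \<bullet> i)"
    \<comment> \<open>\<open>rmul\<close> evaluates both factors at a later index. Since
      \<open>ep\<close> decreases, bounds in terms of \<open>ep k\<close> hold there for any shift
      \<open>l\<close>.\<close>
    obtain l where l: "sq (g \<bullet> i) (k + n) = ep (Y' (t \<bullet> i)) * sq ?d (k + n + l)"
      using sq_mul[of "fpos \<bullet> (t \<bullet> i)" ?d "k + n"] unfolding g sq_fpos by blast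
    have dR: "isR ?d" using xR[OF i] by (intro isR_sub)
    have "rleq ?d \<delta>" using t[OF i] dR \<delta> by (intro rless_imp_rleq) auto
    then have u: "sq ?d (k + n + l) \<le> r + 2 * ep (k + n + l)"
      unfolding rleq_def using \<delta> by (auto dest: spec[of _ "k + n + l"])
    have "rleq (x \<bullet> i) (x \<bullet> (i + 1))" using partP_mono[OF p] i by (simp add: nn_less_eq[symmetric])
    then have "sq (x \<bullet> i) (k + n + l + 1)
        \<le> sq (x \<bullet> (i + 1)) (k + n + l + 1) + (ep (k + n + l + 1) + ep (k + n + l + 1))"
      unfolding rleq_def by blast
    \<comment> \<open>A single approximation of a positive length may be negative, but only by the
      error of the comparison.\<close>
    then have "- (2 * ep (k + n + l)) \<le> sq ?d (k + n + l)"
      using ep_Suc[of "k + n + l"] ep_pos[of "k + n + l + 1"] unfolding sq_sub by linarith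
    moreover have "ep (k + n + l) \<le> ep k" by (rule ep_antimono) (simp add: add.assoc)
    ultimately have "\<bar>sq ?d (k + n + l)\<bar> \<le> r + 2 * ep k" using u r by linarith
    then have "\<bar>sq ?d (k + n + l)\<bar> * ep (Y' (t \<bullet> i)) \<le> (r + 2 * ep k) * ep (Y' (t \<bullet> i))"
      by (rule mult_right_mono) simp
    then show "\<bar>qv (\<alpha> \<bullet> i)\<bar> \<le> qv (\<gamma> \<bullet> i)" by (simp add: \<alpha> \<gamma> \<epsilon> l abs_mult mult.commute)
  qed
  also have "\<dots> = (r + 2 * ep k) * T \<epsilon> n" by (rule T_mult) (rule \<gamma>)
  also have "\<dots> \<le> (r + 2 * ep k) * 4" using 1 r ep_pos[of k] by (intro mult_left_mono) auto
  finally show ?thesis by simp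
qed

end


section \<open>Isolating the elements of the finite sets\<close>

definition bin :: "N1 \<Rightarrow> bool" where
  "bin f \<longleftrightarrow> (\<forall>n. f \<bullet> n \<le> (1::nn))"

definition IND0P :: bool where
  "IND0P \<longleftrightarrow> (\<forall>\<Phi>::(N1, N1) fn.
     (\<forall>n f g. bin f \<and> bin g \<and> \<Phi> \<bullet> f \<bullet> n = 0 \<and> \<Phi> \<bullet> g \<bullet> n = 0 \<longrightarrow> (\<forall>k. f \<bullet> k = g \<bullet> k)) \<longrightarrow>
     (\<forall>k. \<exists>w::(nn, N1) fn. \<exists>l. \<forall>m. m \<le> k \<longrightarrow>
       ((\<exists>i. i < l \<and> bin (w \<bullet> i) \<and> \<Phi> \<bullet> (w \<bullet> i) \<bullet> m = 0) \<longleftrightarrow> (\<exists>f. bin f \<and> \<Phi> \<bullet> f \<bullet> m = 0))))"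

definition setP :: "N2 \<Rightarrow> bool" where
  "setP X \<longleftrightarrow> (\<forall>x. isR x \<longrightarrow> X \<bullet> x \<le> 1) \<and> (\<forall>x y. isR x \<and> isR y \<and> requ x y \<longrightarrow> X \<bullet> x = X \<bullet> y)"

text \<open>The left Dedekind cut of \<open>x\<close>, as a binary function on the codes of rationals.\<close>

definition cut :: "N1 \<Rightarrow> N1" where
  "cut x = LAM (\<lambda>c. if \<not> rleq x (cst c) then 0 else 1)"

context model
begin

definition openP :: "N2 \<Rightarrow> bool" where
  "openP X \<longleftrightarrow> setP X \<and> (\<forall>x. isR x \<and> X \<bullet> x = 1 \<longrightarrow>
     (\<exists>n::nn. \<forall>y. isR y \<and> \<not> rleq (cst (tc qeps \<bullet> n)) (rdst x y) \<longrightarrow> X \<bullet> y = 1))"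

lemma isR_two: "isR x \<Longrightarrow> \<bar>sq x n - sq x m\<bar> < ep n + ep m"
  using isR_le[of x n m] isR_le[of x m n] ep_pos[of n] ep_pos[of m] linear[of n m] by linarith

lemma qv_qeps [simp]: "qv (tc qeps \<bullet> n) = ep n"
  by (simp add: ep_def)

lemma cut_app: "cut x \<bullet> c = (if \<not> rleq x (cst c) then 0 else 1)"
  unfolding cut_def by (rule LAM_app) (intro dfns)

lemma dfn_cut [dfns]: assumes "dfn X" shows "dfn (\<lambda>p. cut (X p))"
  unfolding cut_def by (intro dfns dfn_fst[OF assms])

lemma bin_cut: "bin (cut x)"
  by (simp add: bin_def cut_app)

lemma cut_cong: "isR x \<Longrightarrow> isR y \<Longrightarrow> requ x y \<Longrightarrow> cut x = cut y"
  by (intro fn_ext) (use rleq_trans[of x y] rleq_trans[of y x] in \<open>auto simp: cut_app requ_rleq\<close>)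

text \<open>For each \<open>n\<close> a rational in the cut is searched whose translate by
  \<open>ep (n + 1 + 1)\<close> has left the cut. The search sees only the cut, so equal reals lead
  to the same representing sequence.\<close>

lemma recover:
  "\<exists>r :: (N1, N1) fn. \<forall>x. isR x \<longrightarrow> isR (r \<bullet> cut x) \<and> requ (r \<bullet> cut x) x"
proof -
  let ?P = "\<lambda>g n c. g \<bullet> c = (0::nn) \<and> g \<bullet> (tc qadd \<bullet> c \<bullet> (tc qeps \<bullet> (n + 1 + 1 :: nn) :: nn) :: nn) \<noteq> (0::nn)"
  have "pd (\<lambda>p :: ((unit \<times> N1) \<times> nn) \<times> nn. ?P (snd (fst (fst p))) (snd (fst p)) (snd p))" by (intro dfns)
  from choice[OF this] obtain h :: "(unit \<times> N1) \<times> nn \<Rightarrow> nn"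
    where h: "dfn h" "\<And>c. (\<exists>n. ?P (snd (fst c)) (snd c) n) \<Longrightarrow> ?P (snd (fst c)) (snd c) (h c)" by blast
  have "(\<lambda>p. h (((), snd (fst p)), snd p)) = h" by (intro ext) (metis prod.collapse old.unit.exhaust)
  then have d: "dfn (\<lambda>p :: (unit \<times> N1) \<times> nn. h (((), snd (fst p)), snd p))" using h(1) by simp
  define r where "r = LAM (\<lambda>g. LAM (\<lambda>n. h (((), g), n)))"
  note L = dfn_LAM0[of "\<lambda>g n. h (((), snd g), n)", OF d]
  have "r \<bullet> g = LAM (\<lambda>n. h (((), g), n))" for g
    unfolding r_def using L by (intro LAM_app) simp
  then have r: "r \<bullet> g \<bullet> n = h (((), g), n)" for g n using L by (metis snd_conv)
  have "isR (r \<bullet> cut x) \<and> requ (r \<bullet> cut x) x" if x: "isR x" for x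
  proof -
    let ?c = "\<lambda>n. r \<bullet> cut x \<bullet> n"
    have c: "\<not> rleq x (cst (?c n)) \<and> rleq x (cst (tc qadd \<bullet> ?c n \<bullet> (tc qeps \<bullet> (n + 1 + 1 :: nn) :: nn)))" for n
    proof -
      \<comment> \<open>At this index \<open>ep (n + 1 + 1)\<close> is \<open>4 * ep ?k\<close>. The
        rational \<open>2 * ep ?k\<close> below the approximation is therefore in the cut, while its
        translate lies \<open>2 * ep ?k\<close> above the approximation and thus outside.\<close>
      let ?k = "n + 1 + 1 + 1 + 1"
      obtain c where c: "qv c = sq x ?k - 2 * ep ?k" using qv_surj by blast
      have e: "ep (n + 1 + 1) = 4 * ep ?k" using ep_Suc[of "n + 1 + 1"] ep_Suc[of "n + 1 + 1 + 1"] by simp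
      have "\<not> rleq x (cst c)"
      proof
        assume "rleq x (cst c)"
        then have "sq x (?k + 1) \<le> qv c + 2 * ep (?k + 1)"
          unfolding rleq_def sq_cst by (metis mult_2)
        then show False using isR_le[OF x, of ?k "?k + 1"] ep_Suc[of ?k] unfolding c by simp
      qed
      moreover have "rleq x (cst (tc qadd \<bullet> c \<bullet> (tc qeps \<bullet> (n + 1 + 1 :: nn) :: nn)))"
        unfolding rleq_def
      proof
        fix m
        show "sq x m \<le> sq (cst (tc qadd \<bullet> c \<bullet> (tc qeps \<bullet> (n + 1 + 1 :: nn) :: nn))) m + (ep m + ep m)"
          using isR_two[OF x, of m ?k] ep_pos[of m] ep_pos[of ?k] unfolding sq_cst qv_add qv_qeps c e by linarith
      qed
      ultimately have "?P (cut x) n c" by (simp add: cut_app)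
      then have "?P (cut x) n (?c n)" using h(2)[of "(((), cut x), n)"] unfolding r by auto
      then show ?thesis by (simp add: cut_app split: if_splits)
    qed
    \<comment> \<open>The chosen rational lies below \<open>x\<close>, and \<open>x\<close> does not
      exceed its translate by \<open>ep (n + 1 + 1)\<close>. The limit form costs another
      \<open>ep (n + 1 + 1)\<close>, in total \<open>ep (n + 1)\<close>, half of what fast
      convergence requires.\<close>
    have close: "\<forall>\<^sub>F m in at_top. \<bar>qv (?c n) - sq x m\<bar> < ep (n + 1)" for n
    proof -
      obtain d where d: "0 < d" "\<forall>\<^sub>F m in at_top. qv (?c n) + d < sq x m"
        using c[of n] not_rleq_iff[OF isR_cst x, of "?c n"] by auto
      have "\<forall>\<^sub>F m in at_top. sq x m < qv (?c n) + ep (n + 1 + 1) + ep (n + 1 + 1)"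
      proof -
        have "\<forall>\<^sub>F m in at_top. sq x m < sq (cst (tc qadd \<bullet> ?c n \<bullet> (tc qeps \<bullet> (n + 1 + 1 :: nn) :: nn))) m + ep (n + 1 + 1)"
          using c[of n] rleq_iff[OF x isR_cst] ep_pos by blast
        then show ?thesis unfolding sq_cst qv_add qv_qeps .
      qed
      with d(2) show ?thesis
        by eventually_elim (use d(1) ep_Suc[of "n + 1"] in linarith)
    qed
    have "isR (r \<bullet> cut x)"
      unfolding isR_def
    proof (intro allI)
      fix n m
      obtain k where k: "\<bar>qv (?c n) - sq x k\<bar> < ep (n + 1)" "\<bar>qv (?c (n + m)) - sq x k\<bar> < ep (n + m + 1)"
        using at_top_ex[OF eventually_conj[OF close[of n] close[of "n + m"]]] by blast
      have "ep (n + m + 1) \<le> ep (n + 1)" by (rule ep_antimono) simp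
      then show "\<bar>sq (r \<bullet> cut x) n - sq (r \<bullet> cut x) (n + m)\<bar> < ep n"
        using k ep_Suc[of n] unfolding sq_def[of "r \<bullet> cut x"] by linarith
    qed
    moreover have "requ (r \<bullet> cut x) x"
      unfolding requ_def
    proof
      fix n
      obtain k where k: "\<bar>qv (?c n) - sq x k\<bar> < ep (n + 1)" "n \<le> k"
        using at_top_ex[OF eventually_conj[OF close[of n] eventually_ge_at_top[of n]]] by blast
      show "\<bar>sq (r \<bullet> cut x) n - sq x n\<bar> \<le> ep n + ep n"
        using k(1) isR_le[OF x k(2)] ep_Suc[of n] ep_pos[of "n + 1"] unfolding sq_def[of "r \<bullet> cut x"] by linarith
    qed
    ultimately show ?thesis by blast
  qed
  then show ?thesis by blast
qed

lemma not_rleq_cst: "\<not> rleq (cst (tc qeps \<bullet> j)) (rdst x y) \<Longrightarrow>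
    \<exists>m. \<bar>sq x (m + 1) - sq y (m + 1)\<bar> + 2 * ep m < ep j"
  by (auto simp: rleq_def not_le)

lemma not_rleq_cstI: "\<bar>sq x (m + 1) - sq y (m + 1)\<bar> + 2 * ep m < ep j \<Longrightarrow>
    \<not> rleq (cst (tc qeps \<bullet> j)) (rdst x y)"
  unfolding rleq_def not_all not_le by (intro exI[of _ m]) simp

end

locale injection_IND0 = injection +
  assumes IND0P: IND0P
begin

lemma finite_list:
  "\<exists>(z :: (nn, N1) fn) l. \<forall>x. I01 x \<longrightarrow> Y \<bullet> x \<le> k \<longrightarrow> (\<exists>i. i < l \<and> I01 (z \<bullet> i) \<and> requ (z \<bullet> i) x)"
proof -
  obtain r :: "(N1, N1) fn" where r: "\<And>x. isR x \<Longrightarrow> isR (r \<bullet> cut x) \<and> requ (r \<bullet> cut x) x"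
    using recover by blast
  \<comment> \<open>Being a cut is expressed as a fixed point: \<open>g\<close> equals the cut of
    the real decoded from it. Other binary functions that decode to the same real are excluded,
    which gives the uniqueness that \<open>IND0P\<close> asks for.\<close>
  let ?B = "\<lambda>g n. I01 (r \<bullet> g) \<and> (\<forall>c. g \<bullet> c = cut (r \<bullet> g) \<bullet> c) \<and> Y \<bullet> (r \<bullet> g) = n"
  define \<Phi> where "\<Phi> = LAM (\<lambda>g. LAM (\<lambda>n. if ?B g n then 0 else 1 :: nn))"
  have d: "dfn (\<lambda>p :: (unit \<times> N1) \<times> nn. if ?B (snd (fst p)) (snd p) then 0 else 1 :: nn)" by (intro dfns)
  note L = dfn_LAM0[of "\<lambda>g n. if ?B (snd g) n then 0 else 1", OF d]
  have "\<Phi> \<bullet> g = LAM (\<lambda>n. if ?B g n then 0 else 1 :: nn)" for g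
    unfolding \<Phi>_def by (rule LAM_app, rule conjunct1[OF L])
  then have \<Phi>: "\<Phi> \<bullet> g \<bullet> n = (if ?B g n then 0 else 1)" for g n
    using conjunct2[OF L, rule_format, of "((), g)" n] by (simp only: snd_conv)
  have \<Phi>0: "\<Phi> \<bullet> g \<bullet> n = 0 \<longleftrightarrow> ?B g n" for g n by (simp add: \<Phi>)
  have "\<forall>n f g. bin f \<and> bin g \<and> \<Phi> \<bullet> f \<bullet> n = 0 \<and> \<Phi> \<bullet> g \<bullet> n = 0 \<longrightarrow> (\<forall>k. f \<bullet> k = g \<bullet> k)"
  proof (intro allI impI)
    fix n f g k
    assume "bin f \<and> bin g \<and> \<Phi> \<bullet> f \<bullet> n = 0 \<and> \<Phi> \<bullet> g \<bullet> n = 0"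
    then have fg: "?B f n" "?B g n" unfolding \<Phi>0 by blast+
    then have "requ (r \<bullet> f) (r \<bullet> g)" using Y_iff by simp
    then have "cut (r \<bullet> f) = cut (r \<bullet> g)" using fg I01_isR by (intro cut_cong) auto
    then show "f \<bullet> k = g \<bullet> k" using fg by simp
  qed
  from IND0P[unfolded IND0P_def, THEN spec, THEN mp, OF this, THEN spec, of k]
  obtain w :: "(nn, N1) fn" and l where w: "\<forall>m. m \<le> k \<longrightarrow>
      ((\<exists>i. i < l \<and> bin (w \<bullet> i) \<and> \<Phi> \<bullet> (w \<bullet> i) \<bullet> m = 0) \<longleftrightarrow> (\<exists>f. bin f \<and> \<Phi> \<bullet> f \<bullet> m = 0))"
    by (elim exE)
  define z where "z = LAM (\<lambda>i. r \<bullet> (w \<bullet> i))"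
  have z: "z \<bullet> i = r \<bullet> (w \<bullet> i)" for i unfolding z_def by (rule LAM_app) (intro dfns)
  have "\<exists>i. i < l \<and> I01 (z \<bullet> i) \<and> requ (z \<bullet> i) x" if x: "I01 x" "Y \<bullet> x \<le> k" for x
  proof -
    have rx: "isR (r \<bullet> cut x)" "requ (r \<bullet> cut x) x" "isR x" using r[of x] I01_isR[OF x(1)] by auto
    then have I: "I01 (r \<bullet> cut x)" using I01_cong[OF x(1)] requ_sym by blast
    moreover have "cut (r \<bullet> cut x) = cut x" using rx by (intro cut_cong)
    moreover have "Y \<bullet> (r \<bullet> cut x) = Y \<bullet> x" using Y_iff[OF I x(1)] rx by blast
    ultimately have "\<Phi> \<bullet> cut x \<bullet> (Y \<bullet> x) = 0" unfolding \<Phi>0 by simp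
    then obtain i where i: "i < l" "\<Phi> \<bullet> (w \<bullet> i) \<bullet> (Y \<bullet> x) = 0"
      using w[rule_format, OF x(2)] bin_cut by blast
    then have "I01 (z \<bullet> i)" "Y \<bullet> (z \<bullet> i) = Y \<bullet> x" unfolding \<Phi>0 z by blast+
    then show ?thesis using i(1) Y_iff x by blast
  qed
  then show ?thesis by blast
qed

text \<open>The points with value at most \<open>k\<close> are covered by a finite list, and those
  different from \<open>x0\<close> keep a common distance from it. The point \<open>x0\<close> may
  lie outside [0,1], or may itself have a value up to \<open>k\<close>.\<close>

lemma isolate:
  assumes x0: "isR x0"
  shows "\<exists>j::nn. \<forall>x. I01 x \<longrightarrow> \<not> requ x x0 \<longrightarrow> \<not> rleq (cst (tc qeps \<bullet> j)) (rdst x x0) \<longrightarrow> k < Y \<bullet> x"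
proof -
  obtain z :: "(nn, N1) fn" and l where
    z: "\<And>x. I01 x \<Longrightarrow> Y \<bullet> x \<le> k \<Longrightarrow> \<exists>i. i < l \<and> I01 (z \<bullet> i) \<and> requ (z \<bullet> i) x"
    using finite_list by blast
  \<comment> \<open>The summand \<open>2 * ep n\<close> absorbs the errors of both approximations,
    so that one index \<open>n\<close> certifies a distance of at least \<open>ep j\<close>. The
    guard is there because the list may have entries that are not in [0,1].\<close>
  let ?gap = "\<lambda>i j. I01 (z \<bullet> i) \<longrightarrow> \<not> requ (z \<bullet> i) x0 \<longrightarrow> (\<exists>n. 2 * ep n + ep j \<le> \<bar>sq (z \<bullet> i) n - sq x0 n\<bar>)"
  have mono: "?gap i j'" if g: "?gap i j" "j \<le> j'" for i j j'
  proof (intro impI)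
    assume "I01 (z \<bullet> i)" "\<not> requ (z \<bullet> i) x0"
    then obtain n where "2 * ep n + ep j \<le> \<bar>sq (z \<bullet> i) n - sq x0 n\<bar>" using g by blast
    then have "2 * ep n + ep j' \<le> \<bar>sq (z \<bullet> i) n - sq x0 n\<bar>" using ep_antimono[OF g(2)] by linarith
    then show "\<exists>n. 2 * ep n + ep j' \<le> \<bar>sq (z \<bullet> i) n - sq x0 n\<bar>" by blast
  qed
  have ex: "\<exists>j. ?gap i j" for i
  proof (cases "requ (z \<bullet> i) x0")
    case False
    then obtain n where "0 < \<bar>sq (z \<bullet> i) n - sq x0 n\<bar> - 2 * ep n" by (auto simp: requ_def not_le)
    from ep_archimedean[OF this] obtain j where "ep j < \<bar>sq (z \<bullet> i) n - sq x0 n\<bar> - 2 * ep n" by blast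
    then have "2 * ep n + ep j \<le> \<bar>sq (z \<bullet> i) n - sq x0 n\<bar>" by linarith
    then show ?thesis by blast
  qed blast
  \<comment> \<open>The length of the list may be nonstandard; the common gap comes from induction
    on an arithmetical statement, with \<open>max\<close> and the monotonicity of
    \<open>?gap\<close> in the step.\<close>
  have "\<exists>j. \<forall>i. i < m \<longrightarrow> ?gap i j" for m
  proof (rule induct[of "\<lambda>m. \<exists>j. \<forall>i. i < m \<longrightarrow> ?gap i j"])
    show "pd (\<lambda>p :: unit \<times> nn. \<exists>j. \<forall>i. i < snd p \<longrightarrow> ?gap i j)" by (intro dfns)
    fix m assume "\<exists>j. \<forall>i. i < m \<longrightarrow> ?gap i j"
    then obtain j where j: "\<And>i. i < m \<Longrightarrow> ?gap i j" by blast
    obtain j' where j': "?gap m j'" using ex by blast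
    have "?gap i (max j j')" if "i < m + 1" for i
    proof (cases "i = m")
      case True
      then show ?thesis using mono[OF j' max.cobounded2] by blast
    next
      case False
      then have "i < m" using that by (simp add: le_less)
      then show ?thesis using mono[OF j max.cobounded1] by blast
    qed
    then show "\<exists>j. \<forall>i. i < m + 1 \<longrightarrow> ?gap i j" by blast
  qed simp
  then obtain j where j: "\<And>i. i < l \<Longrightarrow> ?gap i j" by blast
  have "k < Y \<bullet> x" if x: "I01 x" "\<not> requ x x0" "\<not> rleq (cst (tc qeps \<bullet> j)) (rdst x x0)" for x
  proof (rule ccontr)
    assume "\<not> k < Y \<bullet> x"
    then obtain i where i: "i < l" "I01 (z \<bullet> i)" "requ (z \<bullet> i) x" using z[OF x(1)] by (auto simp: not_less)
    note R = I01_isR[OF i(2)] I01_isR[OF x(1)]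
    have "\<not> requ (z \<bullet> i) x0"
      using requ_trans[OF R(2,1) x0 requ_sym[OF i(3)]] x(2) by blast
    then obtain n where n: "2 * ep n + ep j \<le> \<bar>sq (z \<bullet> i) n - sq x0 n\<bar>" using j[OF i(1)] i(2) by blast
    obtain m where m: "\<bar>sq x (m + 1) - sq x0 (m + 1)\<bar> + 2 * ep m < ep j"
      using not_rleq_cst[OF x(3)] by blast
    have "\<bar>sq (z \<bullet> i) (m + 1) - sq x (m + 1)\<bar> \<le> 2 * ep (m + 1)"
      using i(3) by (simp add: requ_def)
    then show False using n m isR_two[OF R(1), of n "m + 1"] isR_two[OF x0, of n "m + 1"] ep_Suc[of m]
      by linarith
  qed
  then show ?thesis by blast
qed

text \<open>An index that witnesses positivity yields a positive rational \<open>d\<close> below the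
  real; at index \<open>m\<close> it is a lower bound up to \<open>ep m\<close>.\<close>

lemma posR_gap:
  assumes "posR \<epsilon>"
  obtains d n where "0 < d" "d = sq \<epsilon> n - 2 * ep n" "\<And>m. d - ep m < sq \<epsilon> m"
proof -
  obtain n where n: "2 * ep n < sq \<epsilon> n" using assms by (auto simp: posR_def not_le)
  have "sq \<epsilon> n - 2 * ep n - ep m < sq \<epsilon> m" for m
  proof -
    have "isR \<epsilon>" using assms by (simp add: posR_def)
    from isR_two[OF this, of n m] show ?thesis using ep_pos[of n] by linarith
  qed
  then show ?thesis using n that[of "sq \<epsilon> n - 2 * ep n" n] by simp
qed

lemma posR_ep: "posR (cst (tc qeps \<bullet> (j::nn)))"
  unfolding posR_def using ep_Suc[of j] ep_Suc[of "j + 1"] ep_pos[of "j + 1 + 1"]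
  by (auto intro!: exI[of _ "j + 1 + 1"] simp: not_le)

lemma Y'_gt: "I01 x \<Longrightarrow> k < Y \<bullet> x \<Longrightarrow> ep (Y' x) < ep k"
  by (simp add: Y'_def ep_strict)

text \<open>Near \<open>x\<close>, but not at it, all exponents exceed some \<open>k\<close> with
  \<open>ep k\<close> below \<epsilon>. The value at \<open>y\<close> is then smaller than
  \<epsilon>, and the value at \<open>x\<close> is positive, which proves the bound for
  \<open>fpos\<close> and, with signs reversed, the one for \<open>fneg\<close>.\<close>

lemma semicontinuous:
  assumes x: "I01 x" and \<epsilon>: "posR \<epsilon>"
  shows "\<exists>\<delta>. posR \<delta> \<and> (\<forall>y. I01 y \<and> \<not> rleq (rdst y x) (cst (tc qnat \<bullet> (0::nn))) \<and> \<not> rleq \<delta> (rdst y x) \<longrightarrow>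
    rleq (fpos \<bullet> y) (tc radd \<bullet> (fpos \<bullet> x) \<bullet> \<epsilon>) \<and> rleq (tc rsub \<bullet> (fneg \<bullet> x) \<bullet> \<epsilon>) (fneg \<bullet> y))"
proof -
  obtain d n where d: "0 < d" "\<And>m. d - ep m < sq \<epsilon> m" using posR_gap[OF \<epsilon>] by metis
  obtain k where k: "ep k < d" using ep_archimedean[OF d(1)] by blast
  obtain j :: nn where j: "\<And>y. I01 y \<Longrightarrow> \<not> requ y x \<Longrightarrow> \<not> rleq (cst (tc qeps \<bullet> j)) (rdst y x) \<Longrightarrow> k < Y \<bullet> y"
    using isolate[OF I01_isR[OF x]] by metis
  have "rleq (fpos \<bullet> y) (tc radd \<bullet> (fpos \<bullet> x) \<bullet> \<epsilon>) \<and> rleq (tc rsub \<bullet> (fneg \<bullet> x) \<bullet> \<epsilon>) (fneg \<bullet> y)"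
    if y: "I01 y" "\<not> rleq (rdst y x) (cst (tc qnat \<bullet> (0::nn)))" "\<not> rleq (cst (tc qeps \<bullet> j)) (rdst y x)" for y
  proof -
    have "\<not> requ y x"
    proof
      assume "requ y x"
      then have "\<bar>sq y (m + 1) - sq x (m + 1)\<bar> \<le> 0 + (ep m + ep m)" for m
        using ep_Suc[of m] ep_pos[of "m + 1"] by (auto simp: requ_def dest!: spec[of _ "m + 1"])
      then show False using y(2) by (simp add: rleq_def)
    qed
    then have *: "ep (Y' y) < d" using Y'_gt[OF y(1) j[OF y(1) _ y(3)]] k by simp
    have "ep (Y' y) \<le> ep (Y' x) + sq \<epsilon> (m + 1) + (ep m + ep m)" for m
      using * d(2)[of "m + 1"] ep_pos[of "Y' x"] ep_pos[of m] ep_Suc[of m] by linarith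
    moreover have "- ep (Y' x) - sq \<epsilon> (m + 1) \<le> - ep (Y' y) + (ep m + ep m)" for m
      using * d(2)[of "m + 1"] ep_pos[of "Y' x"] ep_pos[of m] ep_Suc[of m] by linarith
    ultimately show ?thesis unfolding rleq_def by simp
  qed
  then show ?thesis using posR_ep by blast
qed

text \<open>If \<open>x\<close> is in [0,1] with a value at most \<open>a\<close>,
  \<open>isolate\<close> with \<open>k = Y \<bullet> x\<close> shows that all nearby points have
  smaller values. Otherwise \<open>x\<close> has a positive distance from [0,1].\<close>

lemma fpos_open:
  assumes a: "isR a" and x: "isR x" and n: "\<not> (I01 x \<and> \<not> rleq (fpos \<bullet> x) a)"
  shows "\<exists>n::nn. \<forall>y. isR y \<and> \<not> rleq (cst (tc qeps \<bullet> n)) (rdst x y) \<longrightarrow> \<not> (I01 y \<and> \<not> rleq (fpos \<bullet> y) a)"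
proof (cases "I01 x")
  case True
  obtain j :: nn where j: "\<And>y. I01 y \<Longrightarrow> \<not> requ y x \<Longrightarrow> \<not> rleq (cst (tc qeps \<bullet> j)) (rdst y x) \<Longrightarrow> Y \<bullet> x < Y \<bullet> y"
    using isolate[OF x] by metis
  have "rleq (fpos \<bullet> y) a" if y: "isR y" "\<not> rleq (cst (tc qeps \<bullet> j)) (rdst x y)" "I01 y" for y
  proof -
    have "\<not> rleq (cst (tc qeps \<bullet> j)) (rdst y x)" using y(2) by (simp add: rleq_def abs_minus_commute)
    then have "ep (Y' y) \<le> ep (Y' x)"
      using Y'_cong[OF y(1) x] Y'_gt[OF y(3) j[OF y(3)]] True by (cases "requ y x") (auto simp: Y'_def)
    then show ?thesis using n True unfolding rleq_def sq_fpos by (meson order_trans)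
  qed
  then show ?thesis by blast
next
  case False
  \<comment> \<open>A real outside [0,1] fails one of the two bounds at some index by a margin;
    half-way points are avoided by taking \<open>ep j\<close> below that margin.\<close>
  then consider n where "sq x n + 2 * ep n < 0" | n where "1 + 2 * ep n < sq x n"
    using x by (auto simp: I01_def not_le)
  then show ?thesis
  proof cases
    case 1
    then have "0 < - (sq x n + 2 * ep n)" by simp
    from ep_archimedean[OF this] obtain j where j: "ep j < - (sq x n + 2 * ep n)" by blast
    have "\<not> I01 y" if y: "\<not> rleq (cst (tc qeps \<bullet> j)) (rdst x y)" for y
    proof
      assume "I01 y"
      obtain m where m: "\<bar>sq x (m + 1) - sq y (m + 1)\<bar> + 2 * ep m < ep j" using not_rleq_cst[OF y] by blast
      have "0 \<le> sq y (m + 1) + (ep (m + 1) + ep (m + 1))" using \<open>I01 y\<close> by (simp add: I01_def)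
      then show False using m j isR_two[OF x, of "m + 1" n] ep_Suc[of m] ep_pos[of n] ep_pos[of "m + 1"]
        by linarith
    qed
    then show ?thesis by blast
  next
    case 2
    then have "0 < sq x n - (1 + 2 * ep n)" by simp
    from ep_archimedean[OF this] obtain j where j: "ep j < sq x n - (1 + 2 * ep n)" by blast
    have "\<not> I01 y" if y: "\<not> rleq (cst (tc qeps \<bullet> j)) (rdst x y)" for y
    proof
      assume "I01 y"
      obtain m where m: "\<bar>sq x (m + 1) - sq y (m + 1)\<bar> + 2 * ep m < ep j" using not_rleq_cst[OF y] by blast
      have "sq y (m + 1) \<le> 1 + (ep (m + 1) + ep (m + 1))" using \<open>I01 y\<close> by (simp add: I01_def)
      then show False using m j isR_two[OF x, of "m + 1" n] ep_Suc[of m] ep_pos[of n] ep_pos[of "m + 1"]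
        by linarith
    qed
    then show ?thesis by blast
  qed
qed

text \<open>By \<open>fpos_open\<close> the complement \<open>C\<close> is open for every real
  \<open>a\<close>. It is returned together with \<open>B\<close>, as a \<sigma>-algebra contains
  \<open>B\<close> by way of the open set and the complement clause.\<close>

lemma fpos_borel:
  assumes a: "isR a"
  shows "\<exists>B C. setP B \<and> openP C \<and> (\<forall>x. isR x \<longrightarrow> (B \<bullet> x = 1 \<longleftrightarrow> C \<bullet> x \<noteq> 1)) \<and>
    (\<forall>x. isR x \<longrightarrow> (B \<bullet> x = 1 \<longleftrightarrow> I01 x \<and> \<not> rleq (fpos \<bullet> x) a))"
proof -
  define B where "B = LAM (\<lambda>x. if I01 x \<and> \<not> rleq (fpos \<bullet> x) a then 1 else 0 :: nn)"
  define C where "C = LAM (\<lambda>x. if I01 x \<and> \<not> rleq (fpos \<bullet> x) a then 0 else 1 :: nn)"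
  have B: "B \<bullet> x = (if I01 x \<and> \<not> rleq (fpos \<bullet> x) a then 1 else 0)" for x
    unfolding B_def by (rule LAM_app) (intro dfns)
  have C: "C \<bullet> x = (if I01 x \<and> \<not> rleq (fpos \<bullet> x) a then 0 else 1)" for x
    unfolding C_def by (rule LAM_app) (intro dfns)
  have cong: "(I01 x \<and> \<not> rleq (fpos \<bullet> x) a) \<longleftrightarrow> (I01 y \<and> \<not> rleq (fpos \<bullet> y) a)"
    if xy: "isR x" "isR y" "requ x y" for x y
  proof -
    have "I01 x \<longleftrightarrow> I01 y" using I01_cong[of x y] I01_cong[of y x] requ_sym[of x y] xy by blast
    moreover have "rleq (fpos \<bullet> x) a \<longleftrightarrow> rleq (fpos \<bullet> y) a" using Y'_cong[OF xy] by (simp add: rleq_def)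
    ultimately show ?thesis by blast
  qed
  have "setP B" unfolding setP_def B using cong by auto
  moreover have "setP C" unfolding setP_def C using cong by auto
  moreover have "\<exists>n::nn. \<forall>y. isR y \<and> \<not> rleq (cst (tc qeps \<bullet> n)) (rdst x y) \<longrightarrow> C \<bullet> y = 1"
    if "isR x" "C \<bullet> x = 1" for x
  proof -
    have "\<not> (I01 x \<and> \<not> rleq (fpos \<bullet> x) a)" using that(2) by (auto simp: C split: if_splits)
    from fpos_open[OF a that(1) this] show ?thesis by (auto simp: C)
  qed
  ultimately have "setP B" "openP C" unfolding openP_def by blast+
  moreover have "\<forall>x. isR x \<longrightarrow> (B \<bullet> x = 1 \<longleftrightarrow> C \<bullet> x \<noteq> 1)"
    "\<forall>x. isR x \<longrightarrow> (B \<bullet> x = 1 \<longleftrightarrow> I01 x \<and> \<not> rleq (fpos \<bullet> x) a)"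
    by (simp_all add: B C)
  ultimately show ?thesis by blast
qed

text \<open>The ball is chosen next to \<open>x\<close>, not around it: its centre is \<open>x \<plusminus> 2\<^sup>-\<^sup>p\<close>, its radius \<open>2\<^sup>-\<^sup>p\<^sup>-\<^sup>1\<close>.\<close>

lemma fpos_cliquish:
  assumes x: "I01 x" and \<epsilon>: "posR \<epsilon>" and U: "openP U" "U \<bullet> x = 1"
  shows "\<exists>c r. I01 c \<and> posR r \<and> (\<forall>y. I01 y \<and> \<not> rleq r (rdst y c) \<longrightarrow> U \<bullet> y = 1) \<and>
    (\<forall>y z. I01 y \<and> \<not> rleq r (rdst y c) \<and> I01 z \<and> \<not> rleq r (rdst z c) \<longrightarrow>
      \<not> rleq \<epsilon> (rdst (fpos \<bullet> z) (fpos \<bullet> y)))"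
proof -
  note xR = I01_isR[OF x]
  obtain d n0 where d: "0 < d" "d = sq \<epsilon> n0 - 2 * ep n0" using posR_gap[OF \<epsilon>] by metis
  obtain k where k: "ep k < d" using ep_archimedean[OF d(1)] by blast
  obtain j :: nn where j: "\<And>y. I01 y \<Longrightarrow> \<not> requ y x \<Longrightarrow> \<not> rleq (cst (tc qeps \<bullet> j)) (rdst y x) \<Longrightarrow> k < Y \<bullet> y"
    using isolate[OF xR] by metis
  obtain n :: nn where n: "\<And>y. isR y \<Longrightarrow> \<not> rleq (cst (tc qeps \<bullet> n)) (rdst x y) \<Longrightarrow> U \<bullet> y = 1"
    using U xR unfolding openP_def by metis
  \<comment> \<open>The ball will lie within distance \<open>2 * ep p\<close> of \<open>x\<close>,
    so this has to fit into both the neighbourhood \<open>U\<close> and the isolating one; the bound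
    1/4 keeps the centre in [0,1].\<close>
  define p where "p = max n j + 1 + 1"
  have p: "2 * ep p \<le> ep n" "2 * ep p \<le> ep j" "ep p \<le> 1 / 4"
    using ep_antimono[OF max.cobounded1[of n j]] ep_antimono[OF max.cobounded2[of j n]] ep_Suc[of "max n j"]
      ep_Suc[of "max n j + 1"] ep_pos[of p] ep_le_1[of "max n j"] unfolding p_def by linarith+
  \<comment> \<open>The approximation at index 2 has error at most 1/4, enough to tell on which side
    of \<open>x\<close> the interval has room for a shift by at most 1/4.\<close>
  define e where "e = (if sq x (1 + 1) \<le> 1 / 2 then ep p else - ep p)"
  have e: "\<bar>e\<bar> = ep p" by (simp add: e_def)
  obtain c0 where c0: "qv c0 = e" using qv_surj by blast
  define c where "c = LAM (\<lambda>m. tc qadd \<bullet> (x \<bullet> m) \<bullet> c0 :: nn)"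
  have "c \<bullet> m = tc qadd \<bullet> (x \<bullet> m) \<bullet> c0" for m unfolding c_def by (rule LAM_app) (intro dfns)
  then have c: "sq c m = sq x m + e" for m by (simp add: sq_def c0)
  have cR: "isR c" using xR by (simp add: isR_def c)
  have quarter: "ep (1 + 1) = 1 / 4" using ep_Suc[of 0] ep_Suc[of 1] by simp
  have "0 \<le> sq c m + (ep m + ep m) \<and> sq c m \<le> 1 + (ep m + ep m)" for m
  proof -
    have "0 \<le> sq x m + (ep m + ep m)" "sq x m \<le> 1 + (ep m + ep m)" using x by (auto simp: I01_def)
    moreover have "\<bar>sq x m - sq x (1 + 1)\<bar> < ep m + 1 / 4" using isR_two[OF xR, of m "1 + 1"] quarter by simp
    ultimately show ?thesis
      unfolding c e_def using p(3) ep_pos[of p] ep_pos[of m]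
      by (cases "sq x (1 + 1) \<le> 1 / 2") (simp_all only: if_True if_False, linarith+)
  qed
  then have cI: "I01 c" using cR by (simp add: I01_def)
  define r where "r = cst (tc qeps \<bullet> (p + 1))"
  have near: "U \<bullet> y = 1 \<and> ep (Y' y) < d" if y: "I01 y" "\<not> rleq r (rdst y c)" for y
  proof -
    obtain m where m: "\<bar>sq y (m + 1) - sq c (m + 1)\<bar> + 2 * ep m < ep (p + 1)"
      using y(2) not_rleq_cst unfolding r_def by blast
    \<comment> \<open>Points of the ball are nearer to \<open>x\<close> than \<open>2 * ep p\<close>
      but farther than \<open>ep (p + 1)\<close>. So they belong to the isolating neighbourhood and
      differ from \<open>x\<close> itself, where the value could be large.\<close>
    then have m': "\<bar>sq y (m + 1) - sq x (m + 1)\<bar> + 2 * ep m < 2 * ep p"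
      "ep (p + 1) + 2 * ep m < \<bar>sq y (m + 1) - sq x (m + 1)\<bar>"
      using e ep_Suc[of p] ep_pos[of p] unfolding c by linarith+
    have 1: "\<not> rleq (cst (tc qeps \<bullet> n)) (rdst x y)"
      by (rule not_rleq_cstI[of _ m]) (use m'(1) p(1) in \<open>simp add: abs_minus_commute\<close>)
    have 2: "\<not> rleq (cst (tc qeps \<bullet> j)) (rdst y x)"
      by (rule not_rleq_cstI[of _ m]) (use m'(1) p(2) in simp)
    have "\<not> requ y x"
    proof
      assume "requ y x"
      then have "\<bar>sq y (m + 1) - sq x (m + 1)\<bar> \<le> 2 * ep (m + 1)" by (simp add: requ_def)
      then show False using m'(2) ep_Suc[of m] ep_pos[of "m + 1"] ep_pos[of "p + 1"] by linarith
    qed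
    then have "ep (Y' y) < ep k" using Y'_gt[OF y(1)] j[OF y(1) _ 2] by blast
    then show ?thesis using k n[OF I01_isR[OF y(1)] 1] by simp
  qed
  have "\<not> rleq \<epsilon> (rdst (fpos \<bullet> z) (fpos \<bullet> y))"
    if yz: "I01 y" "\<not> rleq r (rdst y c)" "I01 z" "\<not> rleq r (rdst z c)" for y z
  proof
    assume "rleq \<epsilon> (rdst (fpos \<bullet> z) (fpos \<bullet> y))"
    then have "sq \<epsilon> n0 \<le> \<bar>ep (Y' z) - ep (Y' y)\<bar> + (ep n0 + ep n0)" by (simp add: rleq_def)
    then show False using near[OF yz(1,2)] near[OF yz(3,4)] d(2) ep_pos[of "Y' z"] ep_pos[of "Y' y"] by linarith
  qed
  then show ?thesis using cI near posR_ep unfolding r_def by blast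
qed

end


section \<open>The claims hold in the model\<close>

lemma wff_partition [simp]:
  "wt x \<Longrightarrow> tyof x = (T0 \<rightarrow> T1) \<Longrightarrow> wt n \<Longrightarrow> tyof n = T0 \<Longrightarrow> wff (partition x n)"
  by (simp add: partition_def)

lemma wff_set [simp]:
  "wt x \<Longrightarrow> tyof x = T1 \<Longrightarrow> wt X \<Longrightarrow> tyof X = T2 \<Longrightarrow> wff (x \<in>\<^sub>R X)"
  "wt X \<Longrightarrow> tyof X = T2 \<Longrightarrow> wff (is_set X)"
  "wt X \<Longrightarrow> tyof X = T2 \<Longrightarrow> wff (is_open X)"
  by (simp_all add: mem_def is_set_def is_open_def Let_def)

lemma wff_functions [simp]:
  "wff fun01" "wff funR" "wff injQ" "wff bounded_variation" "wff riemann_integrable"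
  "wff upper_semicontinuous" "wff lower_semicontinuous" "wff cliquish"
  "wff sigma_algebra" "wff NIN" "wff IND0"
  by (simp_all add: fun01_def funR_def injQ_def bounded_variation_def riemann_integrable_def
      upper_semicontinuous_def lower_semicontinuous_def cliquish_def sigma_algebra_def NIN_def IND0_def Let_def
      del: lam.simps)

lemma wff_borel [simp]: "wff borel_set" "wff borel_function"
  by (simp_all add: borel_set_def borel_function_def)

lemma wff_no_injection [simp]: "wff P \<Longrightarrow> wff (no_injection P)"
  by (simp add: no_injection_def)

lemma wff_claims: "\<phi> \<in> claims \<Longrightarrow> wff \<phi>"
  by (auto simp: claims_def NIN_Riemann_def NIN_Borel_def NIN_cliq_def NIN_semi_def NIN_semi'_def)

context model
begin

text \<open>Abstractions inside formulas, such as the summands handed to \<open>rsum\<close>, are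
  brought into the form \<open>LAM\<close> in which the estimates are stated.\<close>

lemma val_LAM [simp]:
  assumes "denv e" "wt t" "tyof t = T1"
  shows "val e (lam T0 t) = rep (LAM (\<lambda>i::nn. un (val (push T0 (rep i) e) t) :: N1))"
proof -
  obtain h :: "(nn, N1) fn" where h: "val e (lam T0 t) = rep h" "\<forall>u. rep (h \<bullet> u) = val (push T0 (rep u) e) t"
    using lam_obj[of e t T0, where 'a = nn and 'b = N1] assms by auto
  then have u: "h \<bullet> u = un (val (push T0 (rep u) e) t)" for u by (metis un_rep)
  have "\<forall>i. LAM (\<lambda>i::nn. un (val (push T0 (rep i) e) t) :: N1) \<bullet> i = un (val (push T0 (rep i) e) t)"
    unfolding LAM_def by (rule someI[of _ h]) (simp add: u)
  then have "LAM (\<lambda>i::nn. un (val (push T0 (rep i) e) t) :: N1) = h" by (intro fn_ext) (simp add: u)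
  then show ?thesis using h(1) by simp
qed

lemma Sat_fun01: "denv e \<Longrightarrow> e RR 0 = rep f \<Longrightarrow> Sat e fun01 \<longleftrightarrow> fun01P f"
  by (simp add: fun01_def fun01P_def)

lemma Sat_funR: "denv e \<Longrightarrow> e RR 0 = rep f \<Longrightarrow> Sat e funR \<longleftrightarrow> (\<forall>x. isR x \<longrightarrow> isR (f \<bullet> x)) \<and>
    (\<forall>x y. isR x \<and> isR y \<and> requ x y \<longrightarrow> requ (f \<bullet> x) (f \<bullet> y))"
  by (simp add: funR_def)

lemma Sat_injQ: "denv e \<Longrightarrow> e RR 0 = rep f \<Longrightarrow> Sat e injQ \<longleftrightarrow> injQP f"
  by (simp add: injQ_def injQP_def)

lemma Sat_no_injection: "denv e \<Longrightarrow> wff P \<Longrightarrow> Sat e (no_injection P) \<longleftrightarrow>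
    \<not> (\<exists>f. fun01P f \<and> injQP f \<and> Sat (push RR (rep f) e) P)"
  by (simp add: no_injection_def Sat_fun01 Sat_injQ)

lemma Sat_NIN: "denv e \<Longrightarrow> Sat e NIN \<longleftrightarrow> \<not> (\<exists>Y. injN Y)"
  by (simp add: NIN_def injN_def)

lemma Sat_partition [simp]:
  assumes "denv e" "wt x" "tyof x = (T0 \<rightarrow> T1)" "wt n" "tyof n = T0"
  shows "Sat e (partition x n) \<longleftrightarrow> partP (un (val e x)) (un (val e n))"
proof -
  have x: "val e x = rep (un (val e x) :: (nn, N1) fn)" and n: "val e n = rep (un (val e n) :: nn)"
    using assms by (simp_all add: rep_un)
  show ?thesis using assms
    by (subst partition_def) (simp add: partP_def, subst (1 2 3 4 5 6) x, subst n, simp)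
qed

lemma Sat_IND0: "denv e \<Longrightarrow> Sat e IND0 \<longleftrightarrow> IND0P"
  by (simp add: IND0_def IND0P_def Let_def bin_def cong del: imp_cong)

lemma Sat_set:
  assumes "denv e" "e T2 i = rep X"
  shows "Sat e (is_set (Var T2 i)) \<longleftrightarrow> setP X" "Sat e (is_open (Var T2 i)) \<longleftrightarrow> openP X"
proof -
  show s: "Sat e (is_set (Var T2 i)) \<longleftrightarrow> setP X"
    using assms by (simp add: is_set_def setP_def Let_def)
  show "Sat e (is_open (Var T2 i)) \<longleftrightarrow> openP X"
    using assms s by (simp add: is_open_def openP_def Let_def mem_def)
qed

text \<open>The bound on the variation has to be a number of the model; 8 is the sum of the bounds 4
  for the left and the right endpoints.\<close>

lemma rational_8: "\<exists>k. \<iota> k = 8"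
proof -
  have "\<iota> ((1 + 1) * ((1 + 1) * (1 + 1))) = 8" by (simp only: \<iota>_simps) simp
  then show ?thesis by blast
qed

end

context injection
begin

lemma Sat_bv:
  assumes "denv e" "e RR 0 = rep fpos"
  shows "Sat e bounded_variation"
proof -
  obtain k where k: "\<iota> k = 8" using rational_8 by blast
  have "rleq (tc rsum \<bullet> LAM (\<lambda>i. rdst (fpos \<bullet> (x \<bullet> i)) (fpos \<bullet> (x \<bullet> (i + 1)))) \<bullet> n) (cst (tc qnat \<bullet> k))"
    if "partP x n" for x n
    by (rule bv_fpos[OF that LAM_app k]) (intro dfns)
  then show ?thesis using assms
    by (simp add: bounded_variation_def Let_def del: lam.simps) (intro exI[of _ k], simp)
qed

lemma Sat_riemann:
  assumes "denv e" "e RR 0 = rep fpos"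
  shows "Sat e riemann_integrable"
proof -
  let ?I = "cst (tc qnat \<bullet> (0::nn))"
  let ?S = "\<lambda>x t. LAM (\<lambda>i. (tc rmul :: (N1, (N1, N1) fn) fn) \<bullet> (fpos \<bullet> (t \<bullet> i)) \<bullet> (tc rsub \<bullet> (x \<bullet> (i + 1)) \<bullet> (x \<bullet> i)))"
  have "\<exists>\<delta>. posR \<delta> \<and> (\<forall>(x :: (nn, N1) fn) (t :: (nn, N1) fn) n. partP x n \<and> (\<forall>i. i < n \<longrightarrow>
      isR (t \<bullet> i) \<and> rleq (x \<bullet> i) (t \<bullet> i) \<and> rleq (t \<bullet> i) (x \<bullet> (i + 1)) \<and>
      \<not> rleq \<delta> (tc rsub \<bullet> (x \<bullet> (i + 1)) \<bullet> (x \<bullet> i))) \<longrightarrow>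
    \<not> rleq \<epsilon> (rdst (tc rsum \<bullet> ?S x t \<bullet> n) ?I))" if \<epsilon>: "posR \<epsilon>" for \<epsilon>
  proof -
    obtain n0 where n0: "2 * ep n0 < sq \<epsilon> n0" using \<epsilon> by (auto simp: posR_def not_le)
    \<comment> \<open>The divisor 8 leaves room: for mesh below \<open>d\<close> the Riemann sum is
      at most \<open>4 * d\<close> up to errors below \<open>3 * d\<close>, while \<epsilon> exceeds
      \<open>8 * d\<close> at late indices.\<close>
    define d where "d = (sq \<epsilon> n0 - 2 * ep n0) / 8"
    have d: "0 < d" using n0 by (simp add: d_def)
    have "8 * d = sq \<epsilon> n0 - 2 * ep n0" by (simp add: d_def)
    then have d': "sq \<epsilon> n0 = 8 * d + 2 * ep n0" by simp
    have "isR \<epsilon>" using \<epsilon> by (simp add: posR_def)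
    obtain c where c: "qv c = d" using qv_surj by blast
    have "posR (cst c)"
    proof -
      obtain m where "ep m < d / 2" using ep_archimedean[of "d / 2"] d by auto
      then have "\<not> sq (cst c) m \<le> ep m + ep m" by (simp add: c)
      then show ?thesis unfolding posR_def by (blast intro: isR_cst)
    qed
    moreover have "\<not> rleq \<epsilon> (rdst (tc rsum \<bullet> ?S x t \<bullet> n) ?I)"
      if p: "partP x n" and t: "\<And>i. i < n \<Longrightarrow> isR (t \<bullet> i) \<and> rleq (x \<bullet> i) (t \<bullet> i) \<and>
        rleq (t \<bullet> i) (x \<bullet> (i + 1)) \<and> \<not> rleq (cst c) (tc rsub \<bullet> (x \<bullet> (i + 1)) \<bullet> (x \<bullet> i))"
      for x t :: "(nn, N1) fn" and n
    proof
      assume *: "rleq \<epsilon> (rdst (tc rsum \<bullet> ?S x t \<bullet> n) ?I)"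
      have b: "\<bar>sq (tc rsum \<bullet> ?S x t \<bullet> n) k\<bar> \<le> 4 * (d + 2 * ep k)" for k
      proof -
        have g: "?S x t \<bullet> i = (tc rmul :: (N1, (N1, N1) fn) fn) \<bullet> (fpos \<bullet> (t \<bullet> i)) \<bullet> (tc rsub \<bullet> (x \<bullet> (i + 1)) \<bullet> (x \<bullet> i))" for i
          by (rule LAM_app) (intro dfns)
        show ?thesis by (rule riemann_fpos[OF _ _ isR_cst p t g]) (use d in \<open>simp_all add: c\<close>)
      qed
      obtain m0 where m0: "ep m0 < d / 2" using ep_archimedean[of "d / 2"] d by auto
      define m where "m = max m0 n0"
      have m: "ep m < d / 2" "n0 \<le> m" using m0 ep_antimono[of m0 m] by (auto simp: m_def)
      have "sq \<epsilon> m \<le> \<bar>sq (tc rsum \<bullet> ?S x t \<bullet> n) (m + 1)\<bar> + (ep m + ep m)"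
        using * by (simp add: rleq_def)
      also have "\<dots> \<le> 4 * (d + 2 * ep (m + 1)) + (ep m + ep m)" by (rule add_right_mono) (rule b)
      also have "\<dots> = 4 * d + 8 * ep (m + 1) + (ep m + ep m)" by (simp add: distrib_left)
      finally show False
        using ep_Suc[of m] isR_le[OF \<open>isR \<epsilon>\<close> m(2)] m(1) d d' ep_pos[of n0] by linarith
    qed
    ultimately show ?thesis by blast
  qed
  then show ?thesis using assms
    by (simp add: riemann_integrable_def Let_def del: lam.simps) (intro exI[of _ ?I], simp)
qed

end

context injection_IND0
begin

lemma Sat_usc:
  assumes "denv e" "e RR 0 = rep fpos"
  shows "Sat e upper_semicontinuous"
  using assms semicontinuous by (simp add: upper_semicontinuous_def) blast

lemma Sat_lsc:
  assumes "denv e" "e RR 0 = rep fneg"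
  shows "Sat e lower_semicontinuous"
  using assms semicontinuous by (simp add: lower_semicontinuous_def) blast

lemma Sat_cliquish:
  assumes "denv e" "e RR 0 = rep fpos"
  shows "Sat e cliquish"
  using assms by (simp add: cliquish_def Sat_set mem_def) (use fpos_cliquish in blast)

lemma Sat_borel:
  assumes "denv e" "e RR 0 = rep fpos"
  shows "Sat e borel_function"
proof -
  \<comment> \<open>The clauses on open sets and on complements are evaluated separately and chained
    through \<open>C\<close>.\<close>
  have sigma: "A \<bullet> B = 1" if "denv e" "e T3 0 = rep A" "Sat e sigma_algebra"
    "openP C" "setP B" "\<forall>x. isR x \<longrightarrow> (B \<bullet> x = 1 \<longleftrightarrow> C \<bullet> x \<noteq> 1)"
    for e B C and A :: "(N2, nn) fn"
  proof -
    let ?A = "\<lambda>X. Eq (Var T3 0 \<cdot> X) one"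
    let ?P = "\<^bold>\<forall>\<^bsub>T2\<^esub> is_open (Var T2 0) \<^bold>\<longrightarrow> ?A (Var T2 0)"
    let ?Q = "\<^bold>\<forall>\<^bsub>T2\<^esub> \<^bold>\<forall>\<^bsub>T2\<^esub> is_set (Var T2 1) \<^bold>\<and> is_set (Var T2 0) \<^bold>\<and> ?A (Var T2 1) \<^bold>\<and>
        (\<^bold>\<forall>\<^bsub>T1\<^esub> is_real (v1 0) \<^bold>\<longrightarrow> (v1 0 \<in>\<^sub>R Var T2 0 \<^bold>\<longleftrightarrow> \<^bold>\<not> v1 0 \<in>\<^sub>R Var T2 1)) \<^bold>\<longrightarrow> ?A (Var T2 0)"
    have "Sat e ?P" "Sat e ?Q"
      using that(1,3) wff_functions(9) unfolding sigma_algebra_def Let_def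
      by (simp_all only: denv_simps wff_connectives)
    moreover have "Sat e ?P \<longleftrightarrow> (\<forall>X. openP X \<longrightarrow> A \<bullet> X = 1)"
      using that(1,2) by (simp add: Sat_set)
    moreover have "Sat e ?Q \<longleftrightarrow> (\<forall>X W. setP X \<and> setP W \<and> A \<bullet> X = 1 \<and>
        (\<forall>x. isR x \<longrightarrow> (W \<bullet> x = 1 \<longleftrightarrow> X \<bullet> x \<noteq> 1)) \<longrightarrow> A \<bullet> W = 1)"
      using that(1,2) by (simp add: Sat_set mem_def)
    ultimately have "\<forall>X. openP X \<longrightarrow> A \<bullet> X = 1"
      "\<forall>X W. setP X \<and> setP W \<and> A \<bullet> X = 1 \<and> (\<forall>x. isR x \<longrightarrow> (W \<bullet> x = 1 \<longleftrightarrow> X \<bullet> x \<noteq> 1)) \<longrightarrow> A \<bullet> W = 1"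
      by blast+
    then show ?thesis using that(4-6) unfolding openP_def by blast
  qed
  have "\<exists>B::N2. Sat (push T2 (rep B) (push T1 (rep a) e)) borel_set \<and>
      (\<forall>x. isR x \<longrightarrow> (B \<bullet> x = 1 \<longleftrightarrow> I01 x \<and> \<not> rleq (fpos \<bullet> x) a))" if "isR a" for a
  proof -
    obtain B C where B: "setP B" "openP C" "\<forall>x. isR x \<longrightarrow> (B \<bullet> x = 1 \<longleftrightarrow> C \<bullet> x \<noteq> 1)"
      "\<forall>x. isR x \<longrightarrow> (B \<bullet> x = 1 \<longleftrightarrow> I01 x \<and> \<not> rleq (fpos \<bullet> x) a)" using fpos_borel[OF \<open>isR a\<close>] by blast
    have "A \<bullet> B = 1" if "Sat (push T3 (rep A) (push T2 (rep B) (push T1 (rep a) e))) sigma_algebra"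
      for A :: "(N2, nn) fn"
      by (rule sigma[OF _ _ that B(2,1,3)]) (use assms in simp_all)
    then have "Sat (push T2 (rep B) (push T1 (rep a) e)) borel_set"
      using assms(1) B(1) by (simp add: borel_set_def Sat_set)
    with B(4) show ?thesis by (intro exI[of _ B]) simp
  qed
  then show ?thesis using assms by (simp add: borel_function_def mem_def)
qed

end

context model
begin

lemma Sat_claims: "\<phi> \<in> claims \<Longrightarrow> Sat e0 \<phi>"
proof -
  have inj: "injection Y" if "injN Y" for Y using that by unfold_locales
  have ind: "injection_IND0 Y" if "injN Y" IND0P for Y using that by unfold_locales
  have bv: "\<exists>f. fun01P f \<and> injQP f \<and> Sat (push RR (rep f) e0) (funR \<^bold>\<and> bounded_variation)"
    "\<exists>f. fun01P f \<and> injQP f \<and> Sat (push RR (rep f) e0) riemann_integrable"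
    if "injN Y" for Y
  proof -
    interpret injection Y using inj that .
    show "\<exists>f. fun01P f \<and> injQP f \<and> Sat (push RR (rep f) e0) (funR \<^bold>\<and> bounded_variation)"
      using fpos_fneg_props Sat_bv funR_fpos by (intro exI[of _ fpos]) (simp add: Sat_funR)
    show "\<exists>f. fun01P f \<and> injQP f \<and> Sat (push RR (rep f) e0) riemann_integrable"
      using fpos_fneg_props Sat_riemann by (intro exI[of _ fpos]) simp
  qed
  have other: "\<exists>f. fun01P f \<and> injQP f \<and> Sat (push RR (rep f) e0) P"
    if "P \<in> {borel_function, cliquish, upper_semicontinuous, lower_semicontinuous}" "injN Y" IND0P for Y P
  proof -
    interpret injection_IND0 Y using ind that by blast
    show ?thesis
    proof (cases "P = lower_semicontinuous")
      case True
      then show ?thesis using fpos_fneg_props Sat_lsc by (intro exI[of _ fneg]) simp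
    next
      case False
      then show ?thesis using that(1) fpos_fneg_props Sat_usc Sat_cliquish Sat_borel
        by (intro exI[of _ fpos]) auto
    qed
  qed
  have no_inj: "Sat e0 (no_injection P \<^bold>\<longrightarrow> NIN)"
    if "wff P" "\<And>Y. injN Y \<Longrightarrow> \<exists>f. fun01P f \<and> injQP f \<and> Sat (push RR (rep f) e0) P" for P
    using that by (simp add: Sat_no_injection Sat_NIN) blast
  have "Sat e0 (NIN \<^bold>\<longrightarrow> no_injection (Falsum \<^bold>\<longrightarrow> Falsum))"
    using injQ_injN by (simp add: Sat_no_injection Sat_NIN) blast
  moreover have "Sat e0 (no_injection (funR \<^bold>\<and> bounded_variation) \<^bold>\<longrightarrow> NIN)"
    "Sat e0 (no_injection riemann_integrable \<^bold>\<longrightarrow> NIN)"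
    using bv by (intro no_inj; simp)+
  moreover have "Sat e0 (IND0 \<^bold>\<longrightarrow> no_injection P \<^bold>\<longrightarrow> NIN)"
    if "P \<in> {borel_function, cliquish, upper_semicontinuous, lower_semicontinuous}" for P
  proof -
    have "wff P" using that by auto
    then show ?thesis using no_inj[of P] other[OF that] by (simp add: Sat_IND0)
  qed
  moreover assume "\<phi> \<in> claims"
  ultimately show ?thesis
    unfolding claims_def NIN_Riemann_def NIN_Borel_def NIN_cliq_def NIN_semi_def NIN_semi'_def by blast
qed

text \<open>\<open>Sat\<close> was evaluated in \<open>e0\<close>, whereas membership in
  \<open>H0\<close> is truth under \<open>Var\<close>. As \<open>e0\<close> consists of the normal
  forms of the variables, \<open>Sat_nf\<close> closes the gap.\<close>

lemma claims_H0: "claims \<subseteq> H0"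
proof
  fix \<phi> assume "\<phi> \<in> claims"
  then have "Sat e0 \<phi>" "wff \<phi>" using Sat_claims wff_claims by auto
  moreover have "e0 = (\<lambda>\<sigma> i. nf (Var \<sigma> i))" by (intro ext) (simp add: e0_def)
  ultimately have "Sat Var \<phi>" using Sat_nf[of Var \<phi>] by simp
  then show "\<phi> \<in> H0" by (simp add: Sat_def sat_def)
qed

end

text \<open>If some claim were underivable, completeness would give a set that omits it. The global
  choice \<open>H0\<close> would then be a genuine counterexample, in particular a model, contrary
  to \<open>claims_H0\<close>.\<close>

lemma claims_provable: "\<phi> \<in> claims \<Longrightarrow> ACA0\<omega> \<turnstile> \<phi>"
proof (rule ccontr)
  assume \<phi>: "\<phi> \<in> claims" "\<not> (ACA0\<omega> \<turnstile> \<phi>)"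
  then obtain H where "mcs ACA0\<omega> H" "\<phi> \<notin> H" using completeness wff_claims by blast
  then have "\<exists>H. mcs ACA0\<omega> H \<and> \<not> claims \<subseteq> H" using \<phi> by blast
  then have H0: "mcs ACA0\<omega> H0 \<and> \<not> claims \<subseteq> H0" unfolding H0_def by (rule someI_ex)
  then interpret model by unfold_locales (simp add: good_def)
  show False using H0 claims_H0 by blast
qed

section \<open>The equivalences\<close>

lemma proves_mono: "T \<turnstile> \<phi> \<Longrightarrow> T \<subseteq> T' \<Longrightarrow> T' \<turnstile> \<phi>"
proof -
  have "deriv T \<Gamma> \<phi> \<Longrightarrow> T \<subseteq> T' \<Longrightarrow> deriv T' \<Gamma> \<phi>" for \<Gamma>
  proof (induction rule: deriv.induct)
    case (RAA \<phi> \<Gamma>)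
    then show ?case by (intro deriv.RAA[OF RAA.hyps(1)])
  qed (blast intro: deriv.Ax deriv.Hyp deriv.ImpI deriv.ImpE deriv.AllI deriv.AllE)+
  then show "T \<turnstile> \<phi> \<Longrightarrow> T \<subseteq> T' \<Longrightarrow> T' \<turnstile> \<phi>" by (simp add: proves_def)
qed

lemma provesI:
  assumes "wff \<phi>" "\<And>H. mcs T H \<Longrightarrow> sat H Var \<phi>"
  shows "T \<turnstile> \<phi>"
  using completeness[OF assms(1)] assms(2) by (auto simp: sat_def)

text \<open>From here on the argument takes place in an arbitrary maximal consistent set of an
  extension \<open>T\<close>, where the derivable claims hold as theorems of a subtheory.\<close>

lemma sat_claims:
  assumes "mcs T H" "ACA0\<omega> \<subseteq> T"
  shows "sat H Var NIN \<longrightarrow> sat H Var (no_injection (Falsum \<^bold>\<longrightarrow> Falsum))"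
    "sat H Var (no_injection (funR \<^bold>\<and> bounded_variation)) \<longrightarrow> sat H Var NIN"
    "sat H Var NIN_Riemann \<longrightarrow> sat H Var NIN"
    "IND0 \<in> T \<Longrightarrow> sat H Var NIN_Borel \<longrightarrow> sat H Var NIN"
    "IND0 \<in> T \<Longrightarrow> sat H Var NIN_cliq \<longrightarrow> sat H Var NIN"
    "IND0 \<in> T \<Longrightarrow> sat H Var NIN_semi \<longrightarrow> sat H Var NIN"
    "IND0 \<in> T \<Longrightarrow> sat H Var NIN_semi' \<longrightarrow> sat H Var NIN"
proof -
  have c: "sat H Var \<phi>" if "\<phi> \<in> claims" for \<phi>
    using that assms wff_claims claims_provable proves_mono sat_theorem wenv_Var by metis
  have i: "sat H Var IND0" if "IND0 \<in> T"
    using that assms by (intro sat_theorem[OF assms(1)]) (auto simp: proves_def intro: deriv.Ax)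
  note s = sat_simps[OF assms(1) wenv_Var]
  have w: "wff (no_injection (Falsum \<^bold>\<longrightarrow> Falsum))" "wff (no_injection (funR \<^bold>\<and> bounded_variation))"
    "wff NIN_Riemann" "wff NIN_Borel" "wff NIN_cliq" "wff NIN_semi" "wff NIN_semi'"
    by (simp_all add: NIN_Riemann_def NIN_Borel_def NIN_cliq_def NIN_semi_def NIN_semi'_def)
  have "sat H Var (NIN \<^bold>\<longrightarrow> no_injection (Falsum \<^bold>\<longrightarrow> Falsum))"
    "sat H Var (no_injection (funR \<^bold>\<and> bounded_variation) \<^bold>\<longrightarrow> NIN)"
    "sat H Var (NIN_Riemann \<^bold>\<longrightarrow> NIN)"
    "sat H Var (IND0 \<^bold>\<longrightarrow> NIN_Borel \<^bold>\<longrightarrow> NIN)"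
    "sat H Var (IND0 \<^bold>\<longrightarrow> NIN_cliq \<^bold>\<longrightarrow> NIN)"
    "sat H Var (IND0 \<^bold>\<longrightarrow> NIN_semi \<^bold>\<longrightarrow> NIN)"
    "sat H Var (IND0 \<^bold>\<longrightarrow> NIN_semi' \<^bold>\<longrightarrow> NIN)"
    by (rule c, simp add: claims_def)+
  then show "sat H Var NIN \<longrightarrow> sat H Var (no_injection (Falsum \<^bold>\<longrightarrow> Falsum))"
    "sat H Var (no_injection (funR \<^bold>\<and> bounded_variation)) \<longrightarrow> sat H Var NIN"
    "sat H Var NIN_Riemann \<longrightarrow> sat H Var NIN"
    "IND0 \<in> T \<Longrightarrow> sat H Var NIN_Borel \<longrightarrow> sat H Var NIN"
    "IND0 \<in> T \<Longrightarrow> sat H Var NIN_cliq \<longrightarrow> sat H Var NIN"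
    "IND0 \<in> T \<Longrightarrow> sat H Var NIN_semi \<longrightarrow> sat H Var NIN"
    "IND0 \<in> T \<Longrightarrow> sat H Var NIN_semi' \<longrightarrow> sat H Var NIN"
    using i by (simp_all add: s w)
qed

text \<open>The property occurs negatively: excluding injections with a weaker property excludes
  more of them.\<close>

lemma sat_no_injection_mono:
  assumes "mcs T H" "wff P" "wff Q"
    "\<And>t. wt t \<Longrightarrow> tyof t = RR \<Longrightarrow> sat H (push RR t Var) P \<Longrightarrow> sat H (push RR t Var) Q"
  shows "sat H Var (no_injection Q) \<longrightarrow> sat H Var (no_injection P)"
proof -
  have "sat H Var (no_injection R) \<longleftrightarrow> \<not> (\<exists>t. wt t \<and> tyof t = RR \<and> sat H (push RR t Var) fun01 \<and>
      sat H (push RR t Var) injQ \<and> sat H (push RR t Var) R)" if "wff R" for R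
    using that assms(1) by (simp add: no_injection_def sat_Ex sat_simps[OF assms(1)] cong: conj_cong)
  then show ?thesis using assms by blast
qed

text \<open>\<open>NIN\<close> excludes all injections into the rationals, whatever their property,
  so only the converse has to be supplied for each item.\<close>

lemma equivalence:
  assumes "ACA0\<omega> \<subseteq> T" "wff P" "\<And>H. mcs T H \<Longrightarrow> sat H Var (no_injection P) \<Longrightarrow> sat H Var NIN"
  shows "T \<turnstile> (no_injection P \<^bold>\<longleftrightarrow> NIN)"
proof (rule provesI)
  fix H assume H: "mcs T H"
  have "sat H Var (no_injection (Falsum \<^bold>\<longrightarrow> Falsum)) \<longrightarrow> sat H Var (no_injection P)"
    using assms(2) by (intro sat_no_injection_mono[OF H]) (auto simp: sat_simps[OF H])
  then show "sat H Var (no_injection P \<^bold>\<longleftrightarrow> NIN)"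
    using assms sat_claims(1)[OF H assms(1)] by (auto simp: sat_simps[OF H] H)
qed (use assms in simp)

text \<open>The derivation behind \<open>bv_property\<close> carries over to \<open>T\<close>, so
  every function of bounded variation has the property there, and the principle for \<open>Y\<close>
  implies the one for bounded variation. Parameters of \<open>Y\<close> keep their values under
  \<open>Var\<close> throughout.\<close>

lemma equivalence_Y:
  assumes "ACA0\<omega> \<subseteq> T" "bv_property Y"
  shows "T \<turnstile> (NIN_Y Y \<^bold>\<longleftrightarrow> NIN)"
  unfolding NIN_Y_def
proof (rule equivalence[OF assms(1)])
  show w: "wff (funR \<^bold>\<and> Y)" using assms(2) by (simp add: bv_property_def)
  fix H assume H: "mcs T H" "sat H Var (no_injection (funR \<^bold>\<and> Y))"
  have "RCA0\<omega> \<subseteq> T" using assms(1) by (auto simp: ACA0\<omega>_def)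
  then have "T \<turnstile> (\<^bold>\<forall>\<^bsub>RR\<^esub> funR \<^bold>\<and> bounded_variation \<^bold>\<longrightarrow> Y)"
    using assms(2) proves_mono by (auto simp: bv_property_def)
  then have "sat H Var (\<^bold>\<forall>\<^bsub>RR\<^esub> funR \<^bold>\<and> bounded_variation \<^bold>\<longrightarrow> Y)"
    using w by (intro sat_theorem[OF H(1)]) auto
  then have "sat H (push RR t Var) (funR \<^bold>\<and> Y)"
    if "wt t" "tyof t = RR" "sat H (push RR t Var) (funR \<^bold>\<and> bounded_variation)" for t
    using that w by (simp add: sat_All[OF H(1)] sat_simps[OF H(1)])
  then have "sat H Var (no_injection (funR \<^bold>\<and> bounded_variation))"
    using sat_no_injection_mono[OF H(1), of "funR \<^bold>\<and> bounded_variation" "funR \<^bold>\<and> Y"] w H(2) by auto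
  then show "sat H Var NIN" using sat_claims(2)[OF H(1) assms(1)] by blast
qed

lemma equivalence_bv:
  assumes "ACA0\<omega> \<subseteq> T"
  shows "T \<turnstile> (NIN_bv \<^bold>\<longleftrightarrow> NIN)"
  unfolding NIN_bv_def
proof (rule equivalence[OF assms])
  fix H assume H: "mcs T H" "sat H Var (no_injection bounded_variation)"
  then have "sat H Var (no_injection (funR \<^bold>\<and> bounded_variation))"
    using sat_no_injection_mono[OF H(1), of "funR \<^bold>\<and> bounded_variation" bounded_variation]
    by (auto simp: sat_simps[OF H(1)])
  then show "sat H Var NIN" using sat_claims(2)[OF H(1) assms] by blast
qed simp


theorem theorem5:
  shows "(ACA0\<omega> \<union> {IND0} \<turnstile> (NIN_bv \<^bold>\<longleftrightarrow> NIN))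
    \<and> (\<forall>Y. bv_property Y \<longrightarrow> (ACA0\<omega> \<union> {IND0} \<turnstile> (NIN_Y Y \<^bold>\<longleftrightarrow> NIN)))
    \<and> (ACA0\<omega> \<union> {IND0} \<turnstile> (NIN_Riemann \<^bold>\<longleftrightarrow> NIN))
    \<and> (ACA0\<omega> \<union> {IND0} \<turnstile> (NIN_Borel \<^bold>\<longleftrightarrow> NIN))
    \<and> (ACA0\<omega> \<union> {IND0} \<turnstile> (NIN_cliq \<^bold>\<longleftrightarrow> NIN))
    \<and> (ACA0\<omega> \<union> {IND0} \<turnstile> (NIN_semi \<^bold>\<longleftrightarrow> NIN))
    \<and> (ACA0\<omega> \<union> {IND0} \<turnstile> (NIN_semi' \<^bold>\<longleftrightarrow> NIN))
    \<and> (ACA0\<omega> \<turnstile> (NIN_bv \<^bold>\<longleftrightarrow> NIN))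
    \<and> (\<forall>Y. bv_property Y \<longrightarrow> (ACA0\<omega> \<turnstile> (NIN_Y Y \<^bold>\<longleftrightarrow> NIN)))
    \<and> (ACA0\<omega> \<turnstile> (NIN_Riemann \<^bold>\<longleftrightarrow> NIN))"
proof -
  let ?T = "ACA0\<omega> \<union> {IND0}"
  have T: "ACA0\<omega> \<subseteq> ?T" "IND0 \<in> ?T" "ACA0\<omega> \<subseteq> ACA0\<omega>" by auto
  have r: "T' \<turnstile> (NIN_Riemann \<^bold>\<longleftrightarrow> NIN)" if "ACA0\<omega> \<subseteq> T'" for T'
    using sat_claims(3)[OF _ that] unfolding NIN_Riemann_def by (intro equivalence[OF that]) simp_all
  have "?T \<turnstile> (NIN_Borel \<^bold>\<longleftrightarrow> NIN)"
    using sat_claims(4)[OF _ T(1,2)] unfolding NIN_Borel_def by (intro equivalence[OF T(1)]) simp_all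
  moreover have "?T \<turnstile> (NIN_cliq \<^bold>\<longleftrightarrow> NIN)"
    using sat_claims(5)[OF _ T(1,2)] unfolding NIN_cliq_def by (intro equivalence[OF T(1)]) simp_all
  moreover have "?T \<turnstile> (NIN_semi \<^bold>\<longleftrightarrow> NIN)"
    using sat_claims(6)[OF _ T(1,2)] unfolding NIN_semi_def by (intro equivalence[OF T(1)]) simp_all
  moreover have "?T \<turnstile> (NIN_semi' \<^bold>\<longleftrightarrow> NIN)"
    using sat_claims(7)[OF _ T(1,2)] unfolding NIN_semi'_def by (intro equivalence[OF T(1)]) simp_all
  ultimately show ?thesis
    using r[OF T(1)] r[OF T(3)] equivalence_bv[OF T(1)] equivalence_bv[OF T(3)]
      equivalence_Y[OF T(1)] equivalence_Y[OF T(3)] by blast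
qed

end
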